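(* There are exactly $104015259648 = 2^{11}\cdot 3^8\cdot 7741$ standard division sudokus of rank $3$. There are exactly $186$ standard division sudokus of rank $3$ up to ds-isotopism. There are exactly $45$ standard division sudokus of rank $3$ up to ds-paratopism.
   Context: A latin square on a finite set $X$ is an array $L=(L(x,y))_{x,y\in X}$ with entries in $X$ such that every row and every column contains all symbols of $X$. Its orthogonal array is $O(L)=\{(x,y,L(x,y)):x,y\in X\}$. For $\theta\in\mathrm{Sym}(3)$, the conjugate $L^\theta$ is the latin square with orthogonal array $\{(x_{\theta(1)},x_{\theta(2)},x_{\theta(3)}):(x_1,x_2,x_3)\in O(L)\}$. Let $|X|=m^2$. A sudoku partition of $X$ is a partition $\{X_1,\dots,X_m\}$ of $X$ into $m$ blocks of size $m$. The standard sudoku partition of $X=\{1,\dots,m^2\}$ has blocks $X_i=\{(i-1)m+1,\dots,im\}$. Relative to a sudoku partition, the bands, stacks and piles of $L$ are $B_i=\{(x,y,z)\in O(L):x\in X_i\}$, $S_i=\{(x,y,z)\in O(L):y\in X_i\}$, $P_i=\{(x,y,z)\in O(L):z\in X_i\}$. A division sudoku of rank $m$ (with respect to the partition) is a latin square $L$ on $X$ such that for all $i,j$: every $z\in X$ occurs as a third coordinate in $B_i\cap S_j$, every $y\in X$ occurs as a second coordinate in $B_i\cap P_j$, and every $x\in X$ occurs as a first coordinate in $S_i\cap P_j$. It is standard if the partition is standard (so standard division sudokus of rank $3$ are latin squares on $\{1,\dots,9\}$, with partition $\{\{1,2,3\},\{4,5,6\},\{7,8,9\}\}$). An isotopism from $L_1$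 to $L_2$ is a triple $(\alpha,\beta,\gamma)$ of permutations of $X$ with $L_2(\alpha(x),\beta(y))=\gamma(L_1(x,y))$ for all $x,y$. Two division sudokus on $X$ (same partition) are ds-isotopic if there is an isotopism $(\alpha,\beta,\gamma)$ between them such that each of $\alpha,\beta,\gamma$ maps every block to a block; they are ds-paratopic if one is ds-isotopic to a conjugate of the other. "Up to" means the number of equivalence classes. *)

theory Defs
  imports "HOL-Library.FuncSet" "HOL-Library.Disjoint_Sets" "HOL-Combinatorics.Permutations"
begin

text \<open>Arrays indexed by \<open>X \<times> X\<close> are extensional functions on \<open>X \<times> X\<close>, so that equality of
  arrays is equality of functions and latin squares on \<open>X\<close> can be counted by \<^const>\<open>card\<close>.\<close>

definition latin_square :: "'a set \<Rightarrow> ('a \<times> 'a \<Rightarrow> 'a) \<Rightarrow> bool" where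
  "latin_square X L \<longleftrightarrow>
     finite X \<and> L \<in> X \<times> X \<rightarrow>\<^sub>E X \<and>
     (\<forall>x\<in>X. (\<lambda>y. L (x, y)) ` X = X) \<and>
     (\<forall>y\<in>X. (\<lambda>x. L (x, y)) ` X = X)"

definition orth_array :: "'a set \<Rightarrow> ('a \<times> 'a \<Rightarrow> 'a) \<Rightarrow> ('a \<times> 'a \<times> 'a) set" where
  "orth_array X L = {(x, y, L (x, y)) | x y. x \<in> X \<and> y \<in> X}"

text \<open>The coordinates of a triple are numbered 1, 2, 3; \<open>Sym(3)\<close> is the set of
  \<open>\<theta> :: nat \<Rightarrow> nat\<close> with \<open>\<theta> permutes {1, 2, 3}\<close>.\<close>

definition coord :: "'a \<times> 'a \<times> 'a \<Rightarrow> nat \<Rightarrow> 'a" where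
  "coord t i = (case t of (x\<^sub>1, x\<^sub>2, x\<^sub>3) \<Rightarrow> if i = 1 then x\<^sub>1 else if i = 2 then x\<^sub>2 else x\<^sub>3)"

definition conjugate :: "'a set \<Rightarrow> (nat \<Rightarrow> nat) \<Rightarrow> ('a \<times> 'a \<Rightarrow> 'a) \<Rightarrow> ('a \<times> 'a \<Rightarrow> 'a)" where
  "conjugate X \<theta> L = (THE L'. latin_square X L' \<and>
     orth_array X L' = (\<lambda>t. (coord t (\<theta> 1), coord t (\<theta> 2), coord t (\<theta> 3))) ` orth_array X L)"

definition sudoku_partition :: "nat \<Rightarrow> 'a set \<Rightarrow> 'a set set \<Rightarrow> bool" where
  "sudoku_partition m X P \<longleftrightarrow>
     finite X \<and> card X = m\<^sup>2 \<and> partition_on X P \<and> card P = m \<and> (\<forall>A\<in>P. card A = m)"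

text \<open>Bands, stacks and piles are indexed by the blocks of the partition themselves.\<close>

definition band :: "'a set \<Rightarrow> ('a \<times> 'a \<Rightarrow> 'a) \<Rightarrow> 'a set \<Rightarrow> ('a \<times> 'a \<times> 'a) set" where
  "band X L A = {(x, y, z). (x, y, z) \<in> orth_array X L \<and> x \<in> A}"

definition stack :: "'a set \<Rightarrow> ('a \<times> 'a \<Rightarrow> 'a) \<Rightarrow> 'a set \<Rightarrow> ('a \<times> 'a \<times> 'a) set" where
  "stack X L A = {(x, y, z). (x, y, z) \<in> orth_array X L \<and> y \<in> A}"

definition pile :: "'a set \<Rightarrow> ('a \<times> 'a \<Rightarrow> 'a) \<Rightarrow> 'a set \<Rightarrow> ('a \<times> 'a \<times> 'a) set" where
  "pile X L A = {(x, y, z). (x, y, z) \<in> orth_array X L \<and> z \<in> A}"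

definition division_sudoku :: "nat \<Rightarrow> 'a set \<Rightarrow> 'a set set \<Rightarrow> ('a \<times> 'a \<Rightarrow> 'a) \<Rightarrow> bool" where
  "division_sudoku m X P L \<longleftrightarrow>
     sudoku_partition m X P \<and> latin_square X L \<and>
     (\<forall>A\<in>P. \<forall>B\<in>P.
        (\<forall>z\<in>X. \<exists>x y. (x, y, z) \<in> band X L A \<inter> stack X L B) \<and>
        (\<forall>y\<in>X. \<exists>x z. (x, y, z) \<in> band X L A \<inter> pile X L B) \<and>
        (\<forall>x\<in>X. \<exists>y z. (x, y, z) \<in> stack X L A \<inter> pile X L B))"

definition standard_partition :: "nat \<Rightarrow> nat set set" where
  "standard_partition m = {{(i - 1) * m + 1..i * m} | i. i \<in> {1..m}}"

definition standard_division_sudokus :: "nat \<Rightarrow> (nat \<times> nat \<Rightarrow> nat) set" where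
  "standard_division_sudokus m = {L. division_sudoku m {1..m\<^sup>2} (standard_partition m) L}"

definition isotopism ::
  "'a set \<Rightarrow> ('a \<times> 'a \<Rightarrow> 'a) \<Rightarrow> ('a \<times> 'a \<Rightarrow> 'a) \<Rightarrow> ('a \<Rightarrow> 'a) \<Rightarrow> ('a \<Rightarrow> 'a) \<Rightarrow> ('a \<Rightarrow> 'a) \<Rightarrow> bool" where
  "isotopism X L\<^sub>1 L\<^sub>2 \<alpha> \<beta> \<gamma> \<longleftrightarrow>
     \<alpha> permutes X \<and> \<beta> permutes X \<and> \<gamma> permutes X \<and>
     (\<forall>x\<in>X. \<forall>y\<in>X. L\<^sub>2 (\<alpha> x, \<beta> y) = \<gamma> (L\<^sub>1 (x, y)))"

definition maps_blocks :: "'a set set \<Rightarrow> ('a \<Rightarrow> 'a) \<Rightarrow> bool" where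
  "maps_blocks P \<pi> \<longleftrightarrow> (\<forall>A\<in>P. \<pi> ` A \<in> P)"

definition ds_isotopic ::
  "'a set \<Rightarrow> 'a set set \<Rightarrow> ('a \<times> 'a \<Rightarrow> 'a) \<Rightarrow> ('a \<times> 'a \<Rightarrow> 'a) \<Rightarrow> bool" where
  "ds_isotopic X P L\<^sub>1 L\<^sub>2 \<longleftrightarrow>
     (\<exists>\<alpha> \<beta> \<gamma>. isotopism X L\<^sub>1 L\<^sub>2 \<alpha> \<beta> \<gamma> \<and> maps_blocks P \<alpha> \<and> maps_blocks P \<beta> \<and> maps_blocks P \<gamma>)"

definition ds_paratopic ::
  "'a set \<Rightarrow> 'a set set \<Rightarrow> ('a \<times> 'a \<Rightarrow> 'a) \<Rightarrow> ('a \<times> 'a \<Rightarrow> 'a) \<Rightarrow> bool" where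
  "ds_paratopic X P L\<^sub>1 L\<^sub>2 \<longleftrightarrow>
     (\<exists>\<theta>. \<theta> permutes {1, 2, 3} \<and>
        (ds_isotopic X P L\<^sub>1 (conjugate X \<theta> L\<^sub>2) \<or> ds_isotopic X P L\<^sub>2 (conjugate X \<theta> L\<^sub>1)))"

text \<open>\<open>ds_isotopic\<close> and \<open>ds_paratopic\<close> are equivalence relations on the division sudokus of a given
  sudoku partition (not on arbitrary arrays), so the quotient is taken of their restriction to
  a set \<open>D\<close> of division sudokus.\<close>

definition rel_on :: "'b set \<Rightarrow> ('b \<Rightarrow> 'b \<Rightarrow> bool) \<Rightarrow> ('b \<times> 'b) set" where
  "rel_on D R = {(L\<^sub>1, L\<^sub>2). L\<^sub>1 \<in> D \<and> L\<^sub>2 \<in> D \<and> R L\<^sub>1 L\<^sub>2}"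

definition num_classes :: "'b set \<Rightarrow> ('b \<Rightarrow> 'b \<Rightarrow> bool) \<Rightarrow> nat" where
  "num_classes D R = card (D // rel_on D R)"

end

theory Submission
  imports Defs
begin

text \<open>
  Number the blocks and the places in a block by the field with three elements, so that a row, a
  column and a symbol become points \<open>(i, x)\<close>, \<open>(j, y)\<close> and \<open>(k, z)\<close>.  Inside the subsquare of blocks
  \<open>i\<close> and \<open>j\<close>, the block \<open>k\<close> of the symbol is a latin square of order \<open>3\<close> in \<open>x\<close> and \<open>y\<close>, and every
  such latin square is an affine function (lemma \<open>latin_square_affine\<close>).  The conditions are symmetric
  in the three coordinates, so \<open>i\<close> is likewise affine in \<open>y\<close> and \<open>z\<close>, and \<open>j\<close> in \<open>z\<close> and \<open>x\<close>.  The
  slopes of the three laws are compatible only if signs \<open>u i\<close>, \<open>v j\<close>, \<open>w k\<close> exist with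

    \<open>v j * y - u i * x = A i j * k + p i j\<close>,
    \<open>w k * z - v j * y = B j k * i + q j k\<close>,
    \<open>u i * x - w k * z = C k i * j + r k i\<close>

  for sign matrices \<open>A\<close>, \<open>B\<close>, \<open>C\<close> (lemma \<open>ds_relation_imp_affine_rel\<close>).  The right-hand sides add up to
  \<open>0\<close>, which is called the cocycle equation below.  Conversely, all solutions of that equation give
  division sudokus, and a division sudoku determines its data up to a common sign.

  For given \<open>(A, B, C)\<close> the cocycle equation for \<open>(p, q, r)\<close> is solvable if and only if seven linear
  conditions on the moments of the matrices hold (lemma \<open>triples_iff\<close>), and then the solutions are a
  coset of the \<open>3^8\<close> coboundaries.  The moments also allow to count the triples \<open>(A, B, C)\<close>: there are
  \<open>61928 = 8 * 7741\<close> of them.  With \<open>8 * 8 * 8 / 2\<close> choices of \<open>(u, v, w)\<close> this gives the number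
  \<open>2^8 * 3^8 * 61928\<close> of division sudokus.

  A ds-isotopism changes \<open>(A, B, C)\<close> only through its permutations of the blocks, which are affine
  permutations of the field, and a common sign.  Conversely, if two triples are related in this way,
  then the permutations inside the blocks can be chosen so that they remove the difference of the
  constant terms, which is a coboundary (lemma \<open>iso_rel_iff\<close>).  So the ds-isotopism classes are the
  orbits of a group of order \<open>2 * 6^3\<close> on the \<open>61928\<close> triples; for ds-paratopism the six conjugations
  are added.  An orbit is counted by its lexicographically least triple.  There are few candidates,
  because the first matrix of a least triple is least itself, and the simplifier tests them all.
\<close>

section \<open>The field with three elements\<close>

text \<open>A datatype, and not residues, so that the case distinctions of the proof and the final
  computation are rewriting with constructors.\<close>

datatype gf3 = G0 | G1 | G2

instantiation gf3 :: comm_ring_1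
begin

definition zero_gf3 :: gf3 where "0 = G0"
definition one_gf3 :: gf3 where "1 = G1"

fun plus_gf3 :: "gf3 \<Rightarrow> gf3 \<Rightarrow> gf3" where
  "G0 + x = x"
| "G1 + G0 = G1" | "G1 + G1 = G2" | "G1 + G2 = G0"
| "G2 + G0 = G2" | "G2 + G1 = G0" | "G2 + G2 = G1"

fun uminus_gf3 :: "gf3 \<Rightarrow> gf3" where
  "- G0 = G0" | "- G1 = G2" | "- G2 = G1"

fun times_gf3 :: "gf3 \<Rightarrow> gf3 \<Rightarrow> gf3" where
  "G0 * x = G0" | "G1 * x = x" | "G2 * x = - x"

definition minus_gf3 :: "gf3 \<Rightarrow> gf3 \<Rightarrow> gf3" where "x - y = x + - (y::gf3)"

instance
proof
  fix a b c :: gf3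
  show "a + b + c = a + (b + c)" by (cases a; cases b; cases c) simp_all
  show "a + b = b + a" by (cases a; cases b) simp_all
  show "0 + a = a" by (simp add: zero_gf3_def)
  show "- a + a = 0" by (cases a) (simp_all add: zero_gf3_def)
  show "a - b = a + - b" by (simp add: minus_gf3_def)
  show "a * b * c = a * (b * c)" by (cases a; cases b; cases c) simp_all
  show "a * b = b * a" by (cases a; cases b) simp_all
  show "1 * a = a" by (simp add: one_gf3_def)
  show "(a + b) * c = a * c + b * c" by (cases a; cases b; cases c) simp_all
  show "(0::gf3) \<noteq> 1" by (simp add: zero_gf3_def one_gf3_def)
qed

end

instantiation gf3 :: linorder
begin

fun less_eq_gf3 :: "gf3 \<Rightarrow> gf3 \<Rightarrow> bool" where
  "G0 \<le> x \<longleftrightarrow> True" | "G1 \<le> x \<longleftrightarrow> x \<noteq> G0" | "G2 \<le> x \<longleftrightarrow> x = G2"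

fun less_gf3 :: "gf3 \<Rightarrow> gf3 \<Rightarrow> bool" where
  "G0 < x \<longleftrightarrow> x \<noteq> G0" | "G1 < x \<longleftrightarrow> x = G2" | "G2 < x \<longleftrightarrow> False"

instance
proof
  fix x y z :: gf3
  show "x < y \<longleftrightarrow> x \<le> y \<and> \<not> y \<le> x" by (cases x; cases y) simp_all
  show "x \<le> x" by (cases x) simp_all
  show "x \<le> y \<Longrightarrow> y \<le> z \<Longrightarrow> x \<le> z" by (cases x; cases y; cases z) simp_all
  show "x \<le> y \<Longrightarrow> y \<le> x \<Longrightarrow> x = y" by (cases x; cases y) simp_all
  show "x \<le> y \<or> y \<le> x" by (cases x; cases y) simp_all
qed

end

lemma UNIV_gf3: "UNIV = {G0, G1, G2}"
  using gf3.exhaust by auto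

instance gf3 :: finite
  by standard (simp add: UNIV_gf3)

lemma card_UNIV_gf3: "card (UNIV :: gf3 set) = 3"
  by (simp add: UNIV_gf3)

lemma all_gf3: "(\<forall>x::gf3. P x) \<longleftrightarrow> P G0 \<and> P G1 \<and> P G2"
  by (metis gf3.exhaust)

lemma minus_gf3_eval: "x - G0 = x" "x - G1 = x + G2" "x - G2 = x + G1"
  by (simp_all only: minus_gf3_def uminus_gf3.simps) (cases x; simp)

lemmas gf3_eval = zero_gf3_def one_gf3_def minus_gf3_eval

lemma square_gf3: "s * s = 1" "s * (s * x) = x" if "s \<noteq> 0" for s x :: gf3
  using that by (cases s; cases x; simp add: gf3_eval)+

lemma mult_nonzero_gf3: "s * t \<noteq> 0" if "s \<noteq> 0" "t \<noteq> 0" for s t :: gf3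
  using that by (cases s; cases t) (auto simp: gf3_eval)

lemma mult_cancel_gf3: "s * x = s * y \<longleftrightarrow> x = y" if "s \<noteq> 0" for s x y :: gf3
  using that by (cases s; cases x; cases y) (auto simp: gf3_eval)

lemma solve_gf3: "s * x = y \<longleftrightarrow> x = s * y" if "s \<noteq> 0" for s x y :: gf3
  using that by (cases s; cases x; cases y) (auto simp: gf3_eval)

text \<open>The power moments of a function on the field are, up to sign, the coefficients of its
  interpolating polynomial.\<close>

definition mom0 :: "(gf3 \<Rightarrow> gf3) \<Rightarrow> gf3" where "mom0 f = f G0 + f G1 + f G2"
definition mom1 :: "(gf3 \<Rightarrow> gf3) \<Rightarrow> gf3" where "mom1 f = f G1 - f G2"

lemma interpolation: "f x = f 0 - mom1 f * x - mom0 f * (x * x)"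
  by (cases x; cases "f G0"; cases "f G1"; cases "f G2"; simp add: mom0_def mom1_def gf3_eval)


section \<open>Triples, and matrices as triples of rows\<close>

datatype 'a tri = Tri 'a 'a 'a

instantiation tri :: (linorder) linorder
begin

fun less_eq_tri :: "'a tri \<Rightarrow> 'a tri \<Rightarrow> bool" where
  "Tri a b c \<le> Tri a' b' c' \<longleftrightarrow>
     (if a = a' then if b = b' then c \<le> c' else b < b' else a < a')"

fun less_tri :: "'a tri \<Rightarrow> 'a tri \<Rightarrow> bool" where
  "Tri a b c < Tri a' b' c' \<longleftrightarrow>
     (if a = a' then if b = b' then c < c' else b < b' else a < a')"

instance
proof
  fix x y z :: "'a tri"
  show "x < y \<longleftrightarrow> x \<le> y \<and> \<not> y \<le> x" by (cases x; cases y) auto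
  show "x \<le> x" by (cases x) simp_all
  show "x \<le> y \<Longrightarrow> y \<le> z \<Longrightarrow> x \<le> z"
    by (cases x; cases y; cases z) (auto split: if_splits)
  show "x \<le> y \<Longrightarrow> y \<le> x \<Longrightarrow> x = y" by (cases x; cases y) (auto split: if_splits)
  show "x \<le> y \<or> y \<le> x" by (cases x; cases y) auto
qed

end

fun nth3 :: "'a tri \<Rightarrow> gf3 \<Rightarrow> 'a" where
  "nth3 (Tri a b c) G0 = a" | "nth3 (Tri a b c) G1 = b" | "nth3 (Tri a b c) G2 = c"

type_synonym mat = "gf3 tri tri"

definition ent :: "mat \<Rightarrow> gf3 \<Rightarrow> gf3 \<Rightarrow> gf3" where
  "ent A i j = nth3 (nth3 A i) j"

definition tab :: "(gf3 \<Rightarrow> 'a) \<Rightarrow> 'a tri" where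
  "tab f = Tri (f G0) (f G1) (f G2)"

definition mat_of :: "(gf3 \<Rightarrow> gf3 \<Rightarrow> gf3) \<Rightarrow> mat" where
  "mat_of f = tab (\<lambda>i. tab (f i))"

lemma nth3_tab [simp]: "nth3 (tab f) i = f i"
  by (cases i) (simp_all add: tab_def)

lemma ent_mat_of [simp]: "ent (mat_of f) i j = f i j"
  by (simp add: ent_def mat_of_def)

lemma tri_eq_iff: "t = t' \<longleftrightarrow> (\<forall>i. nth3 t i = nth3 t' i)"
  by (cases t; cases t') (auto simp: all_gf3)

lemma mat_eq_iff: "A = B \<longleftrightarrow> (\<forall>i j. ent A i j = ent B i j)"
  by (auto simp: tri_eq_iff ent_def)

definition signs_row :: "gf3 tri \<Rightarrow> bool" where
  "signs_row r \<longleftrightarrow> (\<forall>j. nth3 r j \<noteq> 0)"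

definition signs :: "mat \<Rightarrow> bool" where
  "signs A \<longleftrightarrow> (\<forall>i j. ent A i j \<noteq> 0)"

lemma signs_Tri: "signs (Tri r0 r1 r2) \<longleftrightarrow> signs_row r0 \<and> signs_row r1 \<and> signs_row r2"
  by (simp add: signs_def signs_row_def ent_def all_gf3)

instance tri :: (finite) finite
proof
  have "(UNIV :: 'a tri set) = (\<lambda>(a, b, c). Tri a b c) ` UNIV"
    by (auto simp: image_iff) (metis tri.exhaust)
  then show "finite (UNIV :: 'a tri set)"
    by (metis finite finite_imageI)
qed

section \<open>Division sudokus as ternary relations\<close>

type_synonym point = "gf3 \<times> gf3"
type_synonym rel3 = "point \<Rightarrow> point \<Rightarrow> point \<Rightarrow> bool"

text \<open>The relation holds if the symbol at row \<open>X\<close> and column \<open>Y\<close> is \<open>Z\<close>.  The three coordinates enter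
  in the same way, so a statement about one pair of them can be rotated to the other pairs.\<close>

definition ds_relation :: "rel3 \<Rightarrow> bool" where
  "ds_relation O' \<longleftrightarrow>
     (\<forall>X Y. \<exists>!Z. O' X Y Z) \<and> (\<forall>Y Z. \<exists>!X. O' X Y Z) \<and> (\<forall>Z X. \<exists>!Y. O' X Y Z) \<and>
     (\<forall>i j Z. \<exists>x y. O' (i, x) (j, y) Z) \<and>
     (\<forall>j k X. \<exists>y z. O' X (j, y) (k, z)) \<and>
     (\<forall>k i Y. \<exists>z x. O' (i, x) Y (k, z))"

definition rotate_rel :: "rel3 \<Rightarrow> rel3" where
  "rotate_rel O' = (\<lambda>Y Z X. O' X Y Z)"

definition swap12 :: "rel3 \<Rightarrow> rel3" where
  "swap12 O' = (\<lambda>Y X Z. O' X Y Z)"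

lemma ds_relation_rotate: "ds_relation O' \<Longrightarrow> ds_relation (rotate_rel O')"
  unfolding ds_relation_def rotate_rel_def by (elim conjE) (intro conjI; assumption)

lemma ds_relationD:
  assumes "ds_relation O'"
  shows "\<exists>!Z. O' X Y Z" "\<exists>!X. O' X Y Z" "\<exists>!Y. O' X Y Z"
    "\<exists>x y. O' (i, x) (j, y) Z" "\<exists>y z. O' X (j, y) (k, z)" "\<exists>z x. O' (i, x) Y (k, z)"
  by (rule assms[unfolded ds_relation_def, THEN conjunct1, rule_format]
      assms[unfolded ds_relation_def, THEN conjunct2, THEN conjunct1, rule_format]
      assms[unfolded ds_relation_def, THEN conjunct2, THEN conjunct2, THEN conjunct1, rule_format]
      assms[unfolded ds_relation_def, THEN conjunct2, THEN conjunct2, THEN conjunct2,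
        THEN conjunct1, rule_format]
      assms[unfolded ds_relation_def, THEN conjunct2, THEN conjunct2, THEN conjunct2,
        THEN conjunct2, THEN conjunct1, rule_format]
      assms[unfolded ds_relation_def, THEN conjunct2, THEN conjunct2, THEN conjunct2,
        THEN conjunct2, THEN conjunct2, rule_format])+

text \<open>Both sets of permutations of the field, the affine ones and all, have six elements.\<close>

lemma injective_affine:
  fixes f :: "gf3 \<Rightarrow> gf3"
  assumes "inj f"
  shows "\<exists>s c. s \<noteq> 0 \<and> (\<forall>x. f x = s * x + c)"
proof -
  have ne: "f G0 \<noteq> f G1" "f G0 \<noteq> f G2" "f G1 \<noteq> f G2"
    using assms by (simp_all add: inj_eq)
  have "f x = (f G1 - f G0) * x + f G0" for x
    using ne by (cases x; cases "f G0"; cases "f G1"; cases "f G2"; simp add: gf3_eval)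
  moreover have "f G1 - f G0 \<noteq> 0" using ne by simp
  ultimately show ?thesis by blast
qed

text \<open>Rows of different slope would agree in some column.\<close>

lemma latin_square_affine:
  fixes f :: "gf3 \<Rightarrow> gf3 \<Rightarrow> gf3"
  assumes "\<And>x. inj (f x)" "\<And>y. inj (\<lambda>x. f x y)"
  shows "\<exists>a b c. a \<noteq> 0 \<and> b \<noteq> 0 \<and> (\<forall>x y. f x y = a * x + b * y + c)"
proof -
  obtain s c where f: "\<And>x. s x \<noteq> 0" "\<And>x y. f x y = s x * y + c x"
    using injective_affine[OF assms(1)] by metis
  have s: "s x = s 0" for x
  proof (rule ccontr)
    assume "s x \<noteq> s 0"
    then have d: "s x - s 0 \<noteq> 0" by simp
    define y where "y = (s x - s 0) * (c 0 - c x)"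
    have "(s x - s 0) * y = c 0 - c x"
      unfolding y_def by (rule square_gf3(2)[OF d])
    then have "f x y = f 0 y"
      by (simp add: f algebra_simps)
    then have "x = 0"
      using injD[OF assms(2)[of y]] by blast
    then show False using \<open>s x \<noteq> s 0\<close> by simp
  qed
  have "inj c"
  proof (rule injI)
    fix x x' assume "c x = c x'"
    then have "f x 0 = f x' 0" by (simp add: f)
    then show "x = x'" using injD[OF assms(2)[of 0]] by blast
  qed
  then obtain a e where ae: "a \<noteq> 0" "\<And>x. c x = a * x + e"
    using injective_affine by metis
  have "f x y = a * x + s 0 * y + e" for x y
    by (simp add: f(2) s[of x] ae(2) ac_simps)
  then show ?thesis
    using f(1) ae(1) by blast
qed

text \<open>Inside the subsquare of blocks \<open>i\<close> and \<open>j\<close>, the blocks of the symbols form a latin square of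
  order \<open>3\<close>.\<close>

lemma blocks_affine:
  assumes "ds_relation O'"
  shows "\<exists>a b c. a \<noteq> 0 \<and> b \<noteq> 0 \<and>
    (\<forall>x y k. (\<exists>z. O' (i, x) (j, y) (k, z)) \<longleftrightarrow> k = a * x + b * y + c)"
proof -
  note ex1 = ds_relationD(1)[OF assms] and row = ds_relationD(5)[OF assms]
    and col = ds_relationD(6)[OF assms]
  define f where "f x y = fst (THE Z. O' (i, x) (j, y) Z)" for x y
  have f: "(\<exists>z. O' (i, x) (j, y) (k, z)) \<longleftrightarrow> k = f x y" for x y k
  proof -
    obtain k' z' where Z: "O' (i, x) (j, y) (k', z')"
      "\<And>Z. O' (i, x) (j, y) Z \<Longrightarrow> Z = (k', z')"
      using ex1[of "(i, x)" "(j, y)"] by (elim ex1E) (metis surj_pair)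
    then have "(THE Z. O' (i, x) (j, y) Z) = (k', z')"
      by (rule the_equality)
    then have "f x y = k'" by (simp add: f_def)
    then show ?thesis using Z(1) Z(2)[of "(k, _)"] by blast
  qed
  have "surj (f x)" for x
    unfolding surj_def using row f by metis
  then have "inj (f x)" for x
    using finite_UNIV_surj_inj[of "f x"] by simp
  moreover have "surj (\<lambda>x. f x y)" for y
    unfolding surj_def using col f by metis
  then have "inj (\<lambda>x. f x y)" for y
    using finite_UNIV_surj_inj[of "\<lambda>x. f x y"] by simp
  ultimately show ?thesis
    using latin_square_affine[of f] f by metis
qed


lemma blocks_affine_functions:
  assumes "ds_relation O'"
  obtains a b c where "\<And>i j. a i j \<noteq> 0" "\<And>i j. b i j \<noteq> 0"
    "\<And>i j x y k. (\<exists>z. O' (i, x) (j, y) (k, z)) \<longleftrightarrow> k = a i j * x + b i j * y + c i j"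
  using blocks_affine[OF assms] by metis


section \<open>Affine coordinates\<close>

type_synonym vec = "gf3 \<Rightarrow> gf3"
type_synonym fmat = "gf3 \<Rightarrow> gf3 \<Rightarrow> gf3"

definition nonzero1 :: "vec \<Rightarrow> bool" where "nonzero1 u \<longleftrightarrow> (\<forall>i. u i \<noteq> 0)"
definition nonzero2 :: "fmat \<Rightarrow> bool" where "nonzero2 A \<longleftrightarrow> (\<forall>i j. A i j \<noteq> 0)"

text \<open>The third equation \<open>u i * x - w k * z = C k i * j + r k i\<close> is the negative sum of these two, by
  the cocycle equation below; lemma \<open>rotate_affine_rel\<close> exchanges it with the first one.\<close>

definition affine_rel ::
  "vec \<Rightarrow> vec \<Rightarrow> vec \<Rightarrow> fmat \<Rightarrow> fmat \<Rightarrow> fmat \<Rightarrow> fmat \<Rightarrow> rel3" where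
  "affine_rel u v w A B p q = (\<lambda>(i, x) (j, y) (k, z).
     v j * y - u i * x = A i j * k + p i j \<and> w k * z - v j * y = B j k * i + q j k)"

definition cocycle :: "fmat \<Rightarrow> fmat \<Rightarrow> fmat \<Rightarrow> fmat \<Rightarrow> fmat \<Rightarrow> fmat \<Rightarrow> bool" where
  "cocycle A B C p q r \<longleftrightarrow>
     (\<forall>i j k. A i j * k + p i j + (B j k * i + q j k) + (C k i * j + r k i) = 0)"

lemma cocycle_rotate:
  assumes "cocycle A B C p q r"
  shows "cocycle B C A q r p"
  unfolding cocycle_def
proof (intro allI)
  fix i j k
  show "B i j * k + q i j + (C j k * i + r j k) + (A k i * j + p k i) = 0"
    using assms[unfolded cocycle_def, rule_format, of k i j] by (simp add: ac_simps)
qed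

lemma rotate_affine_rel:
  assumes "cocycle A B C p q r"
  shows "rotate_rel (affine_rel u v w A B p q) = affine_rel v w u B C q r"
proof -
  have "v j * y - u i * x = A i j * k + p i j \<and> w k * z - v j * y = B j k * i + q j k \<longleftrightarrow>
      w k * z - v j * y = B j k * i + q j k \<and> u i * x - w k * z = C k i * j + r k i"
    for i j k x y z
  proof -
    have c: "A i j * k + p i j = - (B j k * i + q j k) - (C k i * j + r k i)"
      using assms unfolding cocycle_def by (simp add: algebra_simps add_eq_0_iff2)
    show ?thesis unfolding c by (auto simp: algebra_simps)
  qed
  then show ?thesis
    by (auto simp: rotate_rel_def affine_rel_def fun_eq_iff)
qed


lemma affine_rel_unique_third:
  assumes "nonzero1 w" "nonzero2 A"
  shows "\<exists>!Z. affine_rel u v w A B p q X Y Z"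
proof -
  obtain i x j y where XY: "X = (i, x)" "Y = (j, y)" by (cases X; cases Y)
  let ?k = "A i j * (v j * y - u i * x - p i j)"
  let ?z = "w ?k * (v j * y + B j ?k * i + q j ?k)"
  have nz: "A i j \<noteq> 0" "w k \<noteq> 0" for k
    using assms by (auto simp: nonzero1_def nonzero2_def)
  have "v j * y - u i * x = A i j * k + p i j \<longleftrightarrow> k = ?k" for k
    using solve_gf3[OF nz(1), of k "v j * y - u i * x - p i j"] by (auto simp: algebra_simps)
  moreover have "w k * z - v j * y = B j k * i + q j k \<longleftrightarrow>
      z = w k * (v j * y + B j k * i + q j k)" for k z
    using solve_gf3[OF nz(2), of k z "v j * y + B j k * i + q j k"] by (auto simp: algebra_simps)
  ultimately have "affine_rel u v w A B p q X Y Z \<longleftrightarrow> Z = (?k, ?z)" for Z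
    unfolding XY affine_rel_def by (cases Z) auto
  then show ?thesis by auto
qed

lemma affine_rel_box:
  assumes "nonzero1 u" "nonzero1 v"
  shows "\<exists>x y. affine_rel u v w A B p q (i, x) (j, y) Z"
proof -
  obtain k z where Z: "Z = (k, z)" by (cases Z)
  have nz: "u i \<noteq> 0" "v j \<noteq> 0" using assms by (auto simp: nonzero1_def)
  let ?y = "v j * (w k * z - B j k * i - q j k)"
  let ?x = "u i * (v j * ?y - A i j * k - p i j)"
  have "affine_rel u v w A B p q (i, ?x) (j, ?y) Z"
    by (simp add: affine_rel_def Z square_gf3 nz)
  then show ?thesis by blast
qed

text \<open>The two preceding lemmas, applied to all rotations.\<close>

lemma ds_relation_affine_rel:
  assumes "nonzero1 u" "nonzero1 v" "nonzero1 w" "nonzero2 A" "nonzero2 B" "nonzero2 C"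
    and "cocycle A B C p q r"
  shows "ds_relation (affine_rel u v w A B p q)"
proof -
  let ?O = "affine_rel u v w A B p q"
  have r1: "rotate_rel ?O = affine_rel v w u B C q r"
    by (rule rotate_affine_rel[OF assms(7)])
  have r2: "rotate_rel (affine_rel v w u B C q r) = affine_rel w u v C A r p"
    by (rule rotate_affine_rel[OF cocycle_rotate[OF assms(7)]])
  have e1: "?O X Y Z = affine_rel v w u B C q r Y Z X" for X Y Z
    unfolding r1[symmetric] by (simp add: rotate_rel_def)
  have e2: "?O X Y Z = affine_rel w u v C A r p Z X Y" for X Y Z
    unfolding e1 r2[symmetric] by (simp add: rotate_rel_def)
  have "\<exists>!Z. ?O X Y Z" "\<exists>x y. ?O (i, x) (j, y) Z" for X Y Z i j
    by (rule affine_rel_unique_third[OF assms(3,4)] affine_rel_box[OF assms(1,2)])+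
  moreover have "\<exists>!X. ?O X Y Z" "\<exists>y z. ?O X (j, y) (k, z)" for X Y Z j k
    unfolding e1 by (rule affine_rel_unique_third[OF assms(1,5)] affine_rel_box[OF assms(2,3)])+
  moreover have "\<exists>!Y. ?O X Y Z" "\<exists>z x. ?O (i, x) Y (k, z)" for X Y Z i k
    unfolding e2 by (rule affine_rel_unique_third[OF assms(2,6)] affine_rel_box[OF assms(3,1)])+
  ultimately show ?thesis
    unfolding ds_relation_def by (intro conjI allI)
qed

text \<open>Conversely, in the cell of blocks \<open>i, j, k\<close> the affine laws of the three kinds of subsquares
  make \<open>y\<close> an affine function of \<open>x\<close>, \<open>z\<close> one of \<open>y\<close>, and \<open>z\<close> one of \<open>x\<close>.  So their slopes satisfy
  \<open>f k i = e j k * d i j\<close> for all \<open>i, j, k\<close>, and a sign matrix \<open>d\<close> of this kind is a product of two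
  sign vectors.\<close>

lemma sign_product:
  fixes d e f :: fmat
  assumes nz: "nonzero2 d" "nonzero2 e" "nonzero2 f" and eq: "\<And>i j k. f k i = e j k * d i j"
  shows "\<exists>u v w. nonzero1 u \<and> nonzero1 v \<and> nonzero1 w \<and>
    (\<forall>i j. d i j = u i * v j) \<and> (\<forall>j k. e j k = v j * w k) \<and> (\<forall>k i. f k i = w k * u i)"
proof -
  have sq: "d i j * d i j = 1" "d i j * (d i j * x) = x" "e j k * e j k = 1"
    "e j k * (e j k * x) = x" for i j k x
    using nz square_gf3 by (auto simp: nonzero2_def)
  define u where "u i = d i 0 * d 0 0" for i
  define v where "v j = d 0 j" for j
  define w where "w k = f k 0" for k
  have e: "e j k = f k i * d i j" for i j k
    by (simp add: eq[of k i j] mult.assoc sq)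
  have d: "d i j = u i * v j" for i j
  proof -
    have "d i j * d 0 j = e j 0 * (e j 0 * (d i j * d 0 j))" by (simp add: sq)
    also have "\<dots> = f 0 i * f 0 0" by (simp add: eq[of 0 i j] eq[of 0 0 j] ac_simps)
    also have "\<dots> = e 0 0 * (e 0 0 * (d i 0 * d 0 0))"
      by (simp add: eq[of 0 i 0] eq[of 0 0 0] ac_simps)
    also have "\<dots> = u i" by (simp add: sq u_def)
    finally have "d i j * d 0 j * d 0 j = u i * v j" by (simp add: v_def)
    then show ?thesis by (simp add: mult.assoc sq)
  qed
  have "e j k = v j * w k" for j k
    unfolding v_def w_def using e[of j k 0] by (simp add: mult.commute)
  moreover have "f k i = w k * u i" for k i
    using eq[of k i 0] eq[of k 0 0] by (simp add: u_def w_def ac_simps sq)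
  moreover have "nonzero1 u" "nonzero1 v" "nonzero1 w"
    using nz by (auto simp: u_def v_def w_def nonzero1_def nonzero2_def mult_nonzero_gf3)
  ultimately show ?thesis using d by blast
qed

text \<open>Solving the equation of a line for \<open>k\<close>, which multiplies it by \<open>v * b\<close>.\<close>

lemma line_eq:
  fixes u v b :: gf3
  assumes "u \<noteq> 0" "v \<noteq> 0" "b \<noteq> 0"
  shows "v * y - u * x = v * b * k + - (v * b * c) \<longleftrightarrow> k = - (u * v * b) * x + b * y + c"
  using assms by (cases u; cases v; cases b) (auto simp: zero_gf3_def algebra_simps)

lemma ds_relation_imp_affine_rel:
  assumes O: "ds_relation O'"
  shows "\<exists>u v w A B C p q r. nonzero1 u \<and> nonzero1 v \<and> nonzero1 w \<and>
    nonzero2 A \<and> nonzero2 B \<and> nonzero2 C \<and> cocycle A B C p q r \<and> O' = affine_rel u v w A B p q"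
proof -
  have O1: "ds_relation (rotate_rel O')" and O2: "ds_relation (rotate_rel (rotate_rel O'))"
    using ds_relation_rotate O by blast+
  obtain a1 b1 c1 where 1: "\<And>i j. a1 i j \<noteq> 0" "\<And>i j. b1 i j \<noteq> 0"
    "\<And>i j x y k. (\<exists>z. O' (i, x) (j, y) (k, z)) \<longleftrightarrow> k = a1 i j * x + b1 i j * y + c1 i j"
    by (rule blocks_affine_functions[OF O]) blast
  obtain a2 b2 c2 where 2: "\<And>j k. a2 j k \<noteq> 0" "\<And>j k. b2 j k \<noteq> 0"
    "\<And>j k y z i. (\<exists>x. O' (i, x) (j, y) (k, z)) \<longleftrightarrow> i = a2 j k * y + b2 j k * z + c2 j k"
    by (rule blocks_affine_functions[OF O1, unfolded rotate_rel_def]) blast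
  obtain a3 b3 c3 where 3: "\<And>k i. a3 k i \<noteq> 0" "\<And>k i. b3 k i \<noteq> 0"
    "\<And>k i z x j. (\<exists>y. O' (i, x) (j, y) (k, z)) \<longleftrightarrow> j = a3 k i * z + b3 k i * x + c3 k i"
    by (rule blocks_affine_functions[OF O2, unfolded rotate_rel_def]) blast
  note sq = square_gf3[OF 1(1)] square_gf3[OF 1(2)] square_gf3[OF 2(1)] square_gf3[OF 2(2)]
    square_gf3[OF 3(1)] square_gf3[OF 3(2)]
  have rel: "O' (i, x) (j, y) (k, z) \<longleftrightarrow>
      k = a1 i j * x + b1 i j * y + c1 i j \<and> i = a2 j k * y + b2 j k * z + c2 j k" for i x j y k z
  proof
    assume "O' (i, x) (j, y) (k, z)"
    then show "k = a1 i j * x + b1 i j * y + c1 i j \<and> i = a2 j k * y + b2 j k * z + c2 j k"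
      using 1(3) 2(3) by blast
  next
    assume r: "k = a1 i j * x + b1 i j * y + c1 i j \<and> i = a2 j k * y + b2 j k * z + c2 j k"
    then obtain z' where z': "O' (i, x) (j, y) (k, z')" using 1(3) by blast
    then have "i = a2 j k * y + b2 j k * z' + c2 j k" using 2(3) by blast
    then have "b2 j k * z = b2 j k * z'" using r by (metis add_left_cancel add_right_cancel)
    then have "z = z'" by (simp add: mult_cancel_gf3[OF 2(2)])
    then show "O' (i, x) (j, y) (k, z)" using z' by simp
  qed
  define d e f where "d i j = - (a1 i j * b1 i j)" and "e j k = - (a2 j k * b2 j k)"
    and "f k i = - (a3 k i * b3 k i)" for i j k
  have slope1: "y = d i j * x + b1 i j * (k - c1 i j)" if "O' (i, x) (j, y) (k, z)" for i x j y k z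
  proof -
    have "b1 i j * y = k - c1 i j - a1 i j * x"
      using that[unfolded rel, THEN conjunct1] by simp
    then have "y = b1 i j * (k - c1 i j - a1 i j * x)" by (simp add: solve_gf3[OF 1(2)])
    then show ?thesis by (simp add: d_def algebra_simps)
  qed
  have slope2: "z = e j k * y + b2 j k * (i - c2 j k)" if "O' (i, x) (j, y) (k, z)" for i x j y k z
  proof -
    have "b2 j k * z = i - c2 j k - a2 j k * y"
      using that[unfolded rel, THEN conjunct2] by simp
    then have "z = b2 j k * (i - c2 j k - a2 j k * y)" by (simp add: solve_gf3[OF 2(2)])
    then show ?thesis by (simp add: e_def algebra_simps)
  qed
  have slope3: "z = f k i * x + a3 k i * (j - c3 k i)" if "O' (i, x) (j, y) (k, z)" for i x j y k z
  proof -
    have "j = a3 k i * z + b3 k i * x + c3 k i"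
      by (rule 3(3)[THEN iffD1, OF exI, OF that])
    then have "a3 k i * z = j - c3 k i - b3 k i * x" by simp
    then have "z = a3 k i * (j - c3 k i - b3 k i * x)" by (simp add: solve_gf3[OF 3(1)])
    then show ?thesis by (simp add: f_def algebra_simps)
  qed
  have "f k i = e j k * d i j" for i j k
  proof -
    obtain y z where z: "O' (i, 0) (j, y) (k, z)"
      using ds_relationD(5)[OF O] by blast
    obtain y' z' where z': "O' (i, 1) (j, y') (k, z')"
      using ds_relationD(5)[OF O] by blast
    have "f k i = z' - z"
      using slope3[OF z] slope3[OF z'] by simp
    also have "\<dots> = e j k * (y' - y)"
      by (subst slope2[OF z], subst slope2[OF z']) (simp add: right_diff_distrib)
    also have "y' - y = d i j"
      using slope1[OF z] slope1[OF z'] by simp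
    finally show ?thesis .
  qed
  moreover have "nonzero2 d" "nonzero2 e" "nonzero2 f"
    by (simp_all add: nonzero2_def d_def e_def f_def mult_nonzero_gf3 1(1,2) 2(1,2) 3(1,2))
  ultimately obtain u v w where uvw: "nonzero1 u" "nonzero1 v" "nonzero1 w"
    "\<And>i j. d i j = u i * v j" "\<And>j k. e j k = v j * w k" "\<And>k i. f k i = w k * u i"
    using sign_product[of d e f] by blast
  then have uvw_nz: "u i \<noteq> 0" "v j \<noteq> 0" "w k \<noteq> 0" for i j k
    by (simp_all add: nonzero1_def)
  \<comment> \<open>The law \<open>k = a1 i j * x + b1 i j * y + c1 i j\<close> has \<open>a1 i j = - u i * v j * b1 i j\<close>; multiplied
    by \<open>v j * b1 i j\<close> it becomes the first affine equation.\<close>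
  define A B C where "A i j = v j * b1 i j" and "B j k = w k * b2 j k"
    and "C k i = - (w k * a3 k i)" for i j k
  define p q r where "p i j = - (A i j * c1 i j)" and "q j k = - (B j k * c2 j k)"
    and "r k i = - (C k i * c3 k i)" for i j k
  have nz: "nonzero2 A" "nonzero2 B" "nonzero2 C"
    by (simp_all add: nonzero2_def A_def B_def C_def mult_nonzero_gf3 uvw_nz 1(1,2) 2(1,2) 3(1,2))
  have slope: "a = - (s * b)" if "- (a * b) = s" "b \<noteq> 0" for a b s :: gf3
    using square_gf3[OF that(2)] by (simp add: that(1)[symmetric] mult.assoc)
  have eqA: "v j * y - u i * x = A i j * k + p i j \<longleftrightarrow> k = a1 i j * x + b1 i j * y + c1 i j"
    for i j k x y
  proof -
    have "a1 i j = - (u i * v j * b1 i j)"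
      using uvw(4)[of i j] by (intro slope[OF _ 1(2)]) (simp add: d_def)
    then show ?thesis
      using line_eq[of "u i" "v j" "b1 i j" y x k "c1 i j"] uvw_nz 1(2) by (simp add: A_def p_def)
  qed
  have eqB: "w k * z - v j * y = B j k * i + q j k \<longleftrightarrow> i = a2 j k * y + b2 j k * z + c2 j k"
    for i j k y z
  proof -
    have "a2 j k = - (v j * w k * b2 j k)"
      using uvw(5)[of j k] by (intro slope[OF _ 2(2)]) (simp add: e_def)
    then show ?thesis
      using line_eq[of "v j" "w k" "b2 j k" z y i "c2 j k"] uvw_nz 2(2) by (simp add: B_def q_def)
  qed
  have eqC: "u i * x - w k * z = C k i * j + r k i" if "j = a3 k i * z + b3 k i * x + c3 k i"
    for i j k x z
  proof -
    have "b3 k i = - (u i * w k * a3 k i)"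
      using uvw(6)[of k i] by (intro slope[OF _ 3(1)]) (simp add: f_def ac_simps)
    then have "w k * z - u i * x = w k * a3 k i * j + - (w k * a3 k i * c3 k i)"
      using line_eq[of "u i" "w k" "a3 k i" z x j "c3 k i"] uvw_nz 3(1) that by (simp add: ac_simps)
    then have "- (w k * z - u i * x) = - (w k * a3 k i * j + - (w k * a3 k i * c3 k i))"
      by (rule arg_cong)
    then show ?thesis by (simp add: C_def r_def)
  qed
  have O_eq: "O' = affine_rel u v w A B p q"
    by (auto simp: fun_eq_iff rel affine_rel_def eqA eqB)
  have "cocycle A B C p q r"
    unfolding cocycle_def
  proof (intro allI)
    fix i j k
    obtain x y z where xyz: "O' (i, x) (j, y) (k, z)"
      using ds_relationD(5)[OF O] by blast
    have eC: "C k i * j + r k i = u i * x - w k * z"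
      by (rule eqC[OF 3(3)[THEN iffD1, OF exI, OF xyz], symmetric])
    have eA: "A i j * k + p i j = v j * y - u i * x" and eB: "B j k * i + q j k = w k * z - v j * y"
      using xyz by (simp_all add: O_eq affine_rel_def)
    show "A i j * k + p i j + (B j k * i + q j k) + (C k i * j + r k i) = 0"
      unfolding eA eB eC by simp
  qed
  then show ?thesis using O_eq nz uvw(1-3) by blast
qed

lemma affine_rel_scale:
  assumes "s \<noteq> 0"
  shows "affine_rel (\<lambda>i. s * u i) (\<lambda>j. s * v j) (\<lambda>k. s * w k) (\<lambda>i j. s * A i j)
      (\<lambda>j k. s * B j k) (\<lambda>i j. s * p i j) (\<lambda>j k. s * q j k) = affine_rel u v w A B p q"
proof -
  have "s * a * b - s * c * d = s * e * f + s * g \<longleftrightarrow> a * b - c * d = e * f + g"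
    for a b c d e f g :: gf3
    using mult_cancel_gf3[OF assms, of "a * b - c * d" "e * f + g"] by (simp add: algebra_simps)
  then show ?thesis by (simp add: affine_rel_def)
qed

text \<open>A line determines its equation up to a scalar.\<close>

lemma line_unique:
  fixes u :: gf3
  assumes "\<And>x k. t * (u * x + a * k + p) - u' * x = a' * k + p'"
  shows "p' = t * p" "a' = t * a" "u' = t * u"
proof -
  show p: "p' = t * p" using assms[of 0 0] by simp
  show "a' = t * a" using assms[of 0 1] p by (simp add: algebra_simps)
  show "u' = t * u" using assms[of 1 0] p by (simp add: algebra_simps)
qed

text \<open>For all \<open>i\<close> and \<open>j\<close>, two coordinate systems give equations of the same line.  Their ratio is
  \<open>v' j * v j\<close> and also \<open>u' i * u i\<close>, so it depends on neither \<open>i\<close> nor \<open>j\<close>.\<close>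

lemma affine_rel_unique:
  assumes nz: "nonzero1 u" "nonzero1 v" "nonzero1 w" "nonzero1 u'" "nonzero1 v'"
    and eq: "affine_rel u v w A B p q = affine_rel u' v' w' A' B' p' q'"
  shows "\<exists>s. s \<noteq> 0 \<and> u' = (\<lambda>i. s * u i) \<and> v' = (\<lambda>j. s * v j) \<and> w' = (\<lambda>k. s * w k) \<and>
    A' = (\<lambda>i j. s * A i j) \<and> B' = (\<lambda>j k. s * B j k) \<and>
    p' = (\<lambda>i j. s * p i j) \<and> q' = (\<lambda>j k. s * q j k)"
proof -
  have sq: "u i * (u i * x) = x" "v j * (v j * x) = x" "w k * (w k * x) = x" for i j k x
    using nz by (simp_all add: nonzero1_def square_gf3)
  have rel: "v' j * y - u' i * x = A' i j * k + p' i j \<and> w' k * z - v' j * y = B' j k * i + q' j k"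
    if "v j * y - u i * x = A i j * k + p i j" "w k * z - v j * y = B j k * i + q j k"
    for i x j y k z
    using fun_cong[OF fun_cong[OF fun_cong[OF eq, of "(i, x)"], of "(j, y)"], of "(k, z)"] that
    by (simp add: affine_rel_def)
  have first: "v' j * v j * (u i * x + A i j * k + p i j) - u' i * x = A' i j * k + p' i j"
    for i j x k
  proof -
    let ?y = "v j * (u i * x + A i j * k + p i j)"
    let ?z = "w k * (v j * ?y + B j k * i + q j k)"
    have "v' j * ?y - u' i * x = A' i j * k + p' i j"
      by (rule rel[where z = ?z, THEN conjunct1]) (simp_all add: sq)
    then show ?thesis by (simp add: mult.assoc)
  qed
  have second: "w' k * w k * (v j * y + B j k * i + q j k) - v' j * y = B' j k * i + q' j k"
    for j k y i
  proof -
    let ?z = "w k * (v j * y + B j k * i + q j k)"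
    let ?x = "u i * (v j * y - A i j * k - p i j)"
    have "w' k * ?z - v' j * y = B' j k * i + q' j k"
      by (rule rel[where x = ?x, THEN conjunct2]) (simp_all add: sq)
    then show ?thesis by (simp add: mult.assoc)
  qed
  note l1 = line_unique[OF first] and l2 = line_unique[OF second]
  define s where "s = v' 0 * v 0"
  have nz': "u i \<noteq> 0" "v j \<noteq> 0" "w k \<noteq> 0" for i j k using nz by (simp_all add: nonzero1_def)
  have "v' j * v j * u 0 = s * u 0" for j
    using l1(3)[of 0 j] l1(3)[of 0 0] by (simp add: s_def)
  then have sv: "v' j * v j = s" for j
    using mult_cancel_gf3[OF nz'(1)[of 0], of "v' j * v j" s] by (simp add: mult.commute)
  then have v': "v' j = s * v j" for j
    using sq(2)[of j "v' j"] by (metis mult.commute mult.assoc)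
  have "w' k * w k * v 0 = s * v 0" for k
    using l2(3)[of 0 k] v'[of 0] by simp
  then have sw: "w' k * w k = s" for k
    using mult_cancel_gf3[OF nz'(2)[of 0], of "w' k * w k" s] by (simp add: mult.commute)
  then have w': "w' k = s * w k" for k
    using sq(3)[of k "w' k"] by (metis mult.commute mult.assoc)
  have "s \<noteq> 0"
    using nz by (simp add: s_def nonzero1_def mult_nonzero_gf3)
  then show ?thesis
    using v' w' l1 l2 sv sw by (intro exI[of _ s]) (simp add: fun_eq_iff)
qed

lemma cocycle_third_unique:
  assumes "cocycle A B C p q r" "cocycle A B C' p q r'"
  shows "C' = C" "r' = r"
proof -
  have eq: "C' k i * j + r' k i = C k i * j + r k i" for i j k
    using assms unfolding cocycle_def by (metis add_left_cancel)
  have r: "r' k i = r k i" for k i using eq[of k i 0] by simp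
  show "r' = r" using r by (simp add: fun_eq_iff)
  show "C' = C" using eq[of _ _ 1] r by (simp add: fun_eq_iff)
qed

lemma cocycle_scale:
  assumes "cocycle A B C p q r"
  shows "cocycle (\<lambda>i j. s * A i j) (\<lambda>j k. s * B j k) (\<lambda>k i. s * C k i)
    (\<lambda>i j. s * p i j) (\<lambda>j k. s * q j k) (\<lambda>k i. s * r k i)"
  unfolding cocycle_def
proof (intro allI)
  fix i j k
  have "s * (A i j * k + p i j + (B j k * i + q j k) + (C k i * j + r k i)) = 0"
    using assms by (simp add: cocycle_def)
  then show "s * A i j * k + s * p i j + (s * B j k * i + s * q j k) +
      (s * C k i * j + s * r k i) = 0"
    by (simp only: distrib_left mult.assoc)
qed

text \<open>Applied to the differences of the constant terms of two solutions with the same slopes.  Setting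
  one index to \<open>0\<close> in the equation splits each function into two summands of one variable.\<close>

lemma coboundary:
  fixes f g h :: fmat
  assumes eq: "\<And>i j k. f i j + g j k + h k i = 0"
  shows "\<exists>a b c. a 0 = 0 \<and> f = (\<lambda>i j. b j - a i) \<and> g = (\<lambda>j k. c k - b j) \<and> h = (\<lambda>k i. a i - c k)"
proof -
  let ?a = "\<lambda>i. f 0 0 - f i 0" and ?b = "\<lambda>j. f 0 j" and ?c = "\<lambda>k. - h k 0"
  have "g j k + (f i j + h k i) = 0" "f i j + (g j k + h k i) = 0" for i j k
    using eq[of i j k] by (simp_all add: ac_simps)
  then have "g j k = - (f i j + h k i)" "f i j = - (g j k + h k i)" for i j k
    by (simp_all only: eq_neg_iff_add_eq_0)
  then have g: "g j k = - f i j - h k i" and f: "f i j = - g j k - h k i" for i j k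
    by simp_all
  have fh: "f i j = f 0 j + h k 0 - h k i" for i j k
    by (subst f[of i j k], subst f[of 0 j k]) simp
  have "?a 0 = 0" by simp
  moreover have "f = (\<lambda>i j. ?b j - ?a i)"
  proof (intro ext)
    fix i j
    show "f i j = f 0 j - (f 0 0 - f i 0)"
      by (subst fh[of i j 0], subst fh[of i 0 0]) simp
  qed
  moreover have "g = (\<lambda>j k. ?c k - ?b j)"
  proof (intro ext)
    fix j k
    show "g j k = - h k 0 - f 0 j"
      by (subst g[of j k 0]) simp
  qed
  moreover have "h = (\<lambda>k i. ?a i - ?c k)"
  proof (intro ext)
    fix k i
    show "h k i = f 0 0 - f i 0 - - h k 0"
      by (subst fh[of i 0 k]) simp
  qed
  ultimately show ?thesis
    by (intro exI[of _ ?a] exI[of _ ?b] exI[of _ ?c] conjI)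
qed


section \<open>The slopes that occur\<close>

definition mmom :: "((gf3 \<Rightarrow> gf3) \<Rightarrow> gf3) \<Rightarrow> ((gf3 \<Rightarrow> gf3) \<Rightarrow> gf3) \<Rightarrow> mat \<Rightarrow> gf3" where
  "mmom m m' A = m (\<lambda>i. m' (ent A i))"

text \<open>The conditions under which the cocycle equation is solvable, as lemma \<open>triples_iff\<close> shows.  The
  indices of the three matrices are \<open>(i, j)\<close>, \<open>(j, k)\<close> and \<open>(k, i)\<close>.\<close>

definition triples :: "mat tri set" where
  "triples = {Tri A B C | A B C. signs A \<and> signs B \<and> signs C \<and>
     mmom mom0 mom0 A = 0 \<and> mmom mom0 mom0 B = 0 \<and> mmom mom0 mom0 C = 0 \<and>
     mmom mom1 mom0 A + mmom mom0 mom1 B = 0 \<and>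
     mmom mom1 mom0 B + mmom mom0 mom1 C = 0 \<and>
     mmom mom1 mom0 C + mmom mom0 mom1 A = 0 \<and>
     mmom mom1 mom1 A + mmom mom1 mom1 B + mmom mom1 mom1 C = 0}"

lemma mom_linear:
  "mom0 (\<lambda>x. c) = 0" "mom1 (\<lambda>x. c) = 0" "mom0 (\<lambda>x. c * x) = 0" "mom1 (\<lambda>x. c * x) = - c"
  by (cases c; simp add: mom0_def mom1_def gf3_eval)+

lemma mom_compose:
  "mom0 (\<lambda>x. f x + g x) = mom0 f + mom0 g" "mom1 (\<lambda>x. f x + g x) = mom1 f + mom1 g"
  "mom0 (\<lambda>x. f x - g x) = mom0 f - mom0 g" "mom1 (\<lambda>x. f x - g x) = mom1 f - mom1 g"
  "mom0 (\<lambda>x. - f x) = - mom0 f" "mom1 (\<lambda>x. - f x) = - mom1 f"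
  "mom0 (\<lambda>x. f x * c) = mom0 f * c" "mom1 (\<lambda>x. f x * c) = mom1 f * c"
  by (simp_all add: mom0_def mom1_def algebra_simps)

lemma mom1_swap: "mom1 (\<lambda>x. mom1 (\<lambda>y. f x y)) = mom1 (\<lambda>y. mom1 (\<lambda>x. f x y))"
  by (simp add: mom1_def algebra_simps)

text \<open>Take moments of the cocycle equation in all three indices.  A term loses its contribution
  when it is constant in an index, or linear in an index of which the zeroth moment is taken.\<close>

lemma cocycle_imp_moments:
  assumes "cocycle A B C p q r"
  shows "mom0 (\<lambda>i. mom0 (A i)) = 0"
    and "mom1 (\<lambda>i. mom0 (A i)) + mom0 (\<lambda>j. mom1 (B j)) = 0"
    and "mom1 (\<lambda>i. mom1 (A i)) + mom1 (\<lambda>j. mom1 (B j)) + mom1 (\<lambda>k. mom1 (C k)) = 0"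
proof -
  let ?F = "\<lambda>i j k. (A i j * k + p i j) + (B j k * i + q j k) + (C k i * j + r k i)"
  have F: "(\<lambda>k. ?F i j k) = (\<lambda>k. 0)" for i j
    using assms by (simp add: cocycle_def)
  have "mom0 (\<lambda>i. mom0 (\<lambda>j. mom1 (?F i j))) = 0"
    unfolding F by (simp add: mom_linear)
  then show "mom0 (\<lambda>i. mom0 (A i)) = 0"
    by (simp add: mom_linear mom_compose)
  have "mom1 (\<lambda>i. mom0 (\<lambda>j. mom1 (?F i j))) = 0"
    unfolding F by (simp add: mom_linear)
  then have "- (mom1 (\<lambda>i. mom0 (A i)) + mom0 (\<lambda>j. mom1 (B j))) = 0"
    by (simp add: mom_linear mom_compose)
  then show "mom1 (\<lambda>i. mom0 (A i)) + mom0 (\<lambda>j. mom1 (B j)) = 0"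
    by (simp only: neg_equal_0_iff_equal)
  have "mom1 (\<lambda>i. mom1 (\<lambda>j. mom1 (?F i j))) =
      - mom1 (\<lambda>i. mom1 (A i)) + (- mom1 (\<lambda>j. mom1 (B j)) + - mom1 (\<lambda>k. mom1 (C k)))"
    by (simp only: mom_linear mom_compose mom1_swap[of "\<lambda>i k. C k i"] add_0_left add_0_right add.assoc)
  then have "- (mom1 (\<lambda>i. mom1 (A i)) + mom1 (\<lambda>j. mom1 (B j)) + mom1 (\<lambda>k. mom1 (C k))) = 0"
    unfolding F by (simp only: mom_linear minus_add_distrib add.assoc)
  then show "mom1 (\<lambda>i. mom1 (A i)) + mom1 (\<lambda>j. mom1 (B j)) + mom1 (\<lambda>k. mom1 (C k)) = 0"
    by (simp only: neg_equal_0_iff_equal)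
qed

text \<open>Interpolation in both indices.  The terms with an index to the power \<open>0\<close> are collected in the
  entries of the first row and the first column.\<close>

lemma matrix_interpolation:
  fixes A :: fmat
  assumes "mom0 (\<lambda>i. mom0 (A i)) = 0"
  shows "A i j = A i 0 + A 0 j - A 0 0 + mom1 (\<lambda>i. mom1 (A i)) * i * j +
    mom1 (\<lambda>i. mom0 (A i)) * i * j * j + mom0 (\<lambda>i. mom1 (A i)) * i * i * j"
proof -
  have row: "A i j = A i 0 - mom1 (A i) * j - mom0 (A i) * (j * j)" for i
    by (rule interpolation)
  have 1: "mom1 (A i) = mom1 (A 0) - mom1 (\<lambda>i. mom1 (A i)) * i - mom0 (\<lambda>i. mom1 (A i)) * (i * i)"
    by (rule interpolation)
  have 0: "mom0 (A i) = mom0 (A 0) - mom1 (\<lambda>i. mom0 (A i)) * i"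
    using interpolation[of "\<lambda>i. mom0 (A i)" i] assms by simp
  have "A i j - A i 0 - (A 0 j - A 0 0) =
      mom1 (\<lambda>i. mom1 (A i)) * i * j + mom1 (\<lambda>i. mom0 (A i)) * i * j * j +
      mom0 (\<lambda>i. mom1 (A i)) * i * i * j"
    by (subst row, subst row[of 0], subst 1, subst 0) (simp add: algebra_simps)
  then show ?thesis by (simp add: algebra_simps)
qed

text \<open>After interpolation, the terms of \<open>A i j * k + B j k * i + C k i * j\<close> that contain all three
  indices cancel by the moment conditions.  Every other term contains only two indices, so it can be
  removed by \<open>p\<close>, \<open>q\<close> or \<open>r\<close>.\<close>

lemma moments_imp_cocycle:
  fixes A B C :: fmat
  assumes "mom0 (\<lambda>i. mom0 (A i)) = 0" "mom0 (\<lambda>j. mom0 (B j)) = 0" "mom0 (\<lambda>k. mom0 (C k)) = 0"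
    and AB: "mom1 (\<lambda>i. mom0 (A i)) + mom0 (\<lambda>j. mom1 (B j)) = 0"
    and BC: "mom1 (\<lambda>j. mom0 (B j)) + mom0 (\<lambda>k. mom1 (C k)) = 0"
    and CA: "mom1 (\<lambda>k. mom0 (C k)) + mom0 (\<lambda>i. mom1 (A i)) = 0"
    and ABC: "mom1 (\<lambda>i. mom1 (A i)) + mom1 (\<lambda>j. mom1 (B j)) + mom1 (\<lambda>k. mom1 (C k)) = 0"
  shows "\<exists>p q r. cocycle A B C p q r"
proof (intro exI)
  let ?p = "\<lambda>i j. - (B j 0 * i - B 0 0 * i + C 0 i * j - C 0 0 * j)"
  let ?q = "\<lambda>j k. - (A 0 j * k - A 0 0 * k + C k 0 * j)"
  let ?r = "\<lambda>k i. - (A i 0 * k + B 0 k * i)"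
  show "cocycle A B C ?p ?q ?r"
    unfolding cocycle_def
  proof (intro allI)
    fix i j k
    define a1 b1 c1 where "a1 = mom1 (\<lambda>i. mom1 (A i))" and "b1 = mom1 (\<lambda>j. mom1 (B j))"
      and "c1 = mom1 (\<lambda>k. mom1 (C k))"
    define a2 b2 c2 where "a2 = mom1 (\<lambda>i. mom0 (A i))" and "b2 = mom1 (\<lambda>j. mom0 (B j))"
      and "c2 = mom1 (\<lambda>k. mom0 (C k))"
    define a3 b3 c3 where "a3 = mom0 (\<lambda>i. mom1 (A i))" and "b3 = mom0 (\<lambda>j. mom1 (B j))"
      and "c3 = mom0 (\<lambda>k. mom1 (C k))"
    have A: "A i j = A i 0 + A 0 j - A 0 0 + a1 * i * j + a2 * i * j * j + a3 * i * i * j"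
      unfolding a1_def a2_def a3_def by (rule matrix_interpolation[OF assms(1)])
    have B: "B j k = B j 0 + B 0 k - B 0 0 + b1 * j * k + b2 * j * k * k + b3 * j * j * k"
      unfolding b1_def b2_def b3_def by (rule matrix_interpolation[OF assms(2)])
    have C: "C k i = C k 0 + C 0 i - C 0 0 + c1 * k * i + c2 * k * i * i + c3 * k * k * i"
      unfolding c1_def c2_def c3_def by (rule matrix_interpolation[OF assms(3)])
    have "A i j * k + ?p i j + (B j k * i + ?q j k) + (C k i * j + ?r k i) =
        (a1 + b1 + c1) * i * j * k + (a2 + b3) * i * j * j * k + (b2 + c3) * i * j * k * k +
        (c2 + a3) * i * i * j * k"
      by (subst A, subst B, subst C) (simp add: algebra_simps)
    also have "\<dots> = 0"
      using AB BC CA ABC by (simp add: a1_def b1_def c1_def a2_def b2_def c2_def a3_def b3_def c3_def)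
    finally show "A i j * k + ?p i j + (B j k * i + ?q j k) + (C k i * j + ?r k i) = 0" .
  qed
qed

lemma triples_iff:
  "Tri A B C \<in> triples \<longleftrightarrow> signs A \<and> signs B \<and> signs C \<and>
     (\<exists>p q r. cocycle (ent A) (ent B) (ent C) p q r)"
proof
  assume "Tri A B C \<in> triples"
  then show "signs A \<and> signs B \<and> signs C \<and> (\<exists>p q r. cocycle (ent A) (ent B) (ent C) p q r)"
    using moments_imp_cocycle[of "ent A" "ent B" "ent C"] by (auto simp: triples_def mmom_def)
next
  assume "signs A \<and> signs B \<and> signs C \<and> (\<exists>p q r. cocycle (ent A) (ent B) (ent C) p q r)"
  then obtain p q r where s: "signs A" "signs B" "signs C"
    and c: "cocycle (ent A) (ent B) (ent C) p q r" by blast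
  note c1 = cocycle_rotate[OF c] and c2 = cocycle_rotate[OF cocycle_rotate[OF c]]
  show "Tri A B C \<in> triples"
    using s cocycle_imp_moments[OF c] cocycle_imp_moments(1,2)[OF c1]
      cocycle_imp_moments(1,2)[OF c2]
    by (simp add: triples_def mmom_def)
qed


section \<open>Enumeration of the sign triples\<close>

fun sign_rows_with :: "gf3 \<Rightarrow> gf3 \<Rightarrow> gf3 tri list" where
  "sign_rows_with G0 G0 = [Tri G1 G1 G1, Tri G2 G2 G2]"
| "sign_rows_with G0 _ = []"
| "sign_rows_with G1 G0 = [Tri G2 G1 G1]"
| "sign_rows_with G1 G1 = [Tri G1 G2 G1]"
| "sign_rows_with G1 G2 = [Tri G1 G1 G2]"
| "sign_rows_with G2 G0 = [Tri G1 G2 G2]"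
| "sign_rows_with G2 G1 = [Tri G2 G2 G1]"
| "sign_rows_with G2 G2 = [Tri G2 G1 G2]"

lemma set_sign_rows_with:
  "set (sign_rows_with s t) = {r. signs_row r \<and> mom0 (nth3 r) = s \<and> mom1 (nth3 r) = t}"
proof -
  have *: "Tri a b c \<in> set (sign_rows_with s t) \<longleftrightarrow>
      a \<noteq> G0 \<and> b \<noteq> G0 \<and> c \<noteq> G0 \<and> a + b + c = s \<and> b - c = t" for a b c
    by (cases a; cases b; cases c; cases s; cases t; simp add: gf3_eval)
  have "r \<in> set (sign_rows_with s t) \<longleftrightarrow>
      signs_row r \<and> mom0 (nth3 r) = s \<and> mom1 (nth3 r) = t" for r
    by (cases r) (simp add: * signs_row_def all_gf3 mom0_def mom1_def zero_gf3_def)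
  then show ?thesis by blast
qed

definition sign_rows :: "gf3 tri list" where
  "sign_rows = [Tri G1 G1 G1, Tri G1 G1 G2, Tri G1 G2 G1, Tri G1 G2 G2,
                Tri G2 G1 G1, Tri G2 G1 G2, Tri G2 G2 G1, Tri G2 G2 G2]"

lemma set_sign_rows: "set sign_rows = {r. signs_row r}"
proof -
  have *: "Tri a b c \<in> set sign_rows \<longleftrightarrow> a \<noteq> G0 \<and> b \<noteq> G0 \<and> c \<noteq> G0" for a b c
    by (cases a; cases b; cases c; simp add: sign_rows_def)
  have "r \<in> set sign_rows \<longleftrightarrow> signs_row r" for r
    by (cases r) (simp add: * signs_row_def all_gf3 zero_gf3_def)
  then show ?thesis by blast
qed

text \<open>The rows \<open>r0\<close> and \<open>r1\<close> of a matrix with given moments are found from \<open>r2\<close>: if their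
  sums are \<open>s0, s1, s2\<close>, then \<open>s0 + s1 + s2 = 0\<close> and \<open>s1 - s2\<close> is the moment \<open>a\<close>; similarly for
  their first moments and for \<open>b\<close> and \<open>c\<close>.  Every function below has a name of its own, because
  the simplifier would otherwise evaluate under an abstraction.\<close>

definition join_rows :: "gf3 tri \<Rightarrow> gf3 tri \<Rightarrow> gf3 tri \<Rightarrow> mat" where
  "join_rows r2 r1 r0 = Tri r0 r1 r2"

definition join_upper :: "gf3 tri list \<Rightarrow> gf3 tri \<Rightarrow> gf3 tri \<Rightarrow> mat list" where
  "join_upper r0s r2 r1 = map (join_rows r2 r1) r0s"

definition mats_above :: "gf3 \<Rightarrow> gf3 \<Rightarrow> gf3 \<Rightarrow> gf3 tri \<Rightarrow> mat list" where
  "mats_above a b c r2 = concat (map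
     (join_upper (sign_rows_with (mom0 (nth3 r2) - a) (mom1 (nth3 r2) + b - c)) r2)
     (sign_rows_with (mom0 (nth3 r2) + a) (mom1 (nth3 r2) + c)))"

definition mats_with :: "gf3 \<Rightarrow> gf3 \<Rightarrow> gf3 \<Rightarrow> mat list" where
  "mats_with a b c = concat (map (mats_above a b c) sign_rows)"

lemma mats_with_iff:
  "A \<in> set (mats_with a b c) \<longleftrightarrow> signs A \<and> mmom mom0 mom0 A = 0 \<and>
     mmom mom1 mom0 A = a \<and> mmom mom0 mom1 A = b \<and> mmom mom1 mom1 A = c"
proof -
  obtain r0 r1 r2 where A: "A = Tri r0 r1 r2" by (cases A)
  have e: "ent A G0 = nth3 r0" "ent A G1 = nth3 r1" "ent A G2 = nth3 r2"
    by (simp_all add: fun_eq_iff ent_def A)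
  have m: "mmom mom0 mom0 A = mom0 (nth3 r0) + mom0 (nth3 r1) + mom0 (nth3 r2)"
    "mmom mom1 mom0 A = mom0 (nth3 r1) - mom0 (nth3 r2)"
    "mmom mom0 mom1 A = mom1 (nth3 r0) + mom1 (nth3 r1) + mom1 (nth3 r2)"
    "mmom mom1 mom1 A = mom1 (nth3 r1) - mom1 (nth3 r2)"
    unfolding mmom_def
    by (simp_all add: mom0_def[of "\<lambda>i. mom0 (ent A i)"] mom0_def[of "\<lambda>i. mom1 (ent A i)"]
        mom1_def[of "\<lambda>i. mom0 (ent A i)"] mom1_def[of "\<lambda>i. mom1 (ent A i)"] e)
  have arith: "s0 = s2 - a \<and> s1 = s2 + a \<longleftrightarrow> s0 + s1 + s2 = 0 \<and> s1 - s2 = a"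
    "t0 = t2 + b - c \<and> t1 = t2 + c \<longleftrightarrow> t0 + t1 + t2 = b \<and> t1 - t2 = c"
    for s0 s1 s2 t0 t1 t2 :: gf3
  proof -
    show "s0 = s2 - a \<and> s1 = s2 + a \<longleftrightarrow> s0 + s1 + s2 = 0 \<and> s1 - s2 = a"
      by (cases s0; cases s1; cases s2; cases a; simp add: gf3_eval)
    have "t0 = t2 + b - c \<longleftrightarrow> t0 + t1 + t2 = b" if "t1 = t2 + c"
      by (cases t0; cases b; cases t2; cases c; simp add: gf3_eval that)
    then show "t0 = t2 + b - c \<and> t1 = t2 + c \<longleftrightarrow> t0 + t1 + t2 = b \<and> t1 - t2 = c"
      by auto
  qed
  have "A \<in> set (mats_with a b c) \<longleftrightarrow> signs A \<and>
      (mom0 (nth3 r0) = mom0 (nth3 r2) - a \<and> mom0 (nth3 r1) = mom0 (nth3 r2) + a) \<and>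
      (mom1 (nth3 r0) = mom1 (nth3 r2) + b - c \<and> mom1 (nth3 r1) = mom1 (nth3 r2) + c)"
    by (auto simp: A mats_with_def mats_above_def join_upper_def join_rows_def
        set_sign_rows set_sign_rows_with signs_Tri)
  then show ?thesis
    unfolding arith m by blast
qed

lemma distinct_mats_with: "distinct (mats_with a b c)"
  by (cases a; cases b; cases c; hypsubst; code_simp)

lemma length_mats_with:
  "length (mats_with a b c) = (if a = 0 \<and> b = 0 \<and> c = 0 then 14 else 6)"
proof -
  have "length (mats_with G0 G0 G0) = 14" by code_simp
  moreover have "length (mats_with a b c) = 6" if "(a, b, c) \<noteq> (G0, G0, G0)"
    using that by (cases a; cases b; cases c; hypsubst; simp; code_simp)
  ultimately show ?thesis by (auto simp: zero_gf3_def)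
qed

text \<open>The moments \<open>x, y, c\<close> of \<open>A\<close> and \<open>z, d\<close> of \<open>B\<close> can be chosen freely; the conditions then
  determine the other moments of \<open>B\<close> and all moments of \<open>C\<close>.\<close>

lemma sum_triples:
  "(\<Sum>t\<in>triples. f t :: int) = (\<Sum>x\<in>UNIV. \<Sum>y\<in>UNIV. \<Sum>c\<in>UNIV. \<Sum>A\<in>set (mats_with x y c).
     \<Sum>z\<in>UNIV. \<Sum>d\<in>UNIV. \<Sum>B\<in>set (mats_with z (- x) d).
     \<Sum>C\<in>set (mats_with (- y) (- z) (- (c + d))). f (Tri A B C))"
proof -
  let ?I = "SIGMA x:UNIV. SIGMA y:UNIV. SIGMA c:UNIV. SIGMA A:set (mats_with x y c).
     SIGMA z:UNIV. SIGMA d:UNIV. SIGMA B:set (mats_with z (- x) d).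
     set (mats_with (- y) (- z) (- (c + d)))"
  let ?h = "\<lambda>(x::gf3, y::gf3, c::gf3, A::mat, z::gf3, d::gf3, B::mat, C::mat). Tri A B C"
  have neg: "u = - v \<longleftrightarrow> v + u = 0" for u v :: gf3
    by (metis add.commute add_eq_0_iff2 add.inverse_inverse)
  have "inj_on ?h ?I"
    by (auto simp: inj_on_def mats_with_iff)
  moreover have "?h ` ?I = triples"
  proof
    show "?h ` ?I \<subseteq> triples"
      by (auto simp: mats_with_iff triples_def) 
    show "triples \<subseteq> ?h ` ?I"
    proof
      fix t assume "t \<in> triples"
      then obtain A B C where t: "t = Tri A B C" "signs A" "signs B" "signs C"
        "mmom mom0 mom0 A = 0" "mmom mom0 mom0 B = 0" "mmom mom0 mom0 C = 0"
        "mmom mom1 mom0 A + mmom mom0 mom1 B = 0" "mmom mom1 mom0 B + mmom mom0 mom1 C = 0"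
        "mmom mom0 mom1 A + mmom mom1 mom0 C = 0"
        "(mmom mom1 mom1 A + mmom mom1 mom1 B) + mmom mom1 mom1 C = 0"
        unfolding triples_def by (auto simp: add.commute)
      then have "(mmom mom1 mom0 A, mmom mom0 mom1 A, mmom mom1 mom1 A, A,
          mmom mom1 mom0 B, mmom mom1 mom1 B, B, C) \<in> ?I"
        using neg[THEN iffD2, OF t(8)] neg[THEN iffD2, OF t(9)] neg[THEN iffD2, OF t(10)]
          neg[THEN iffD2, OF t(11)]
        by (simp add: mats_with_iff)
      then show "t \<in> ?h ` ?I"
        using t(1) by force
    qed
  qed
  ultimately have "(\<Sum>t\<in>triples. f t) = (\<Sum>i\<in>?I. f (?h i))"
    using sum.reindex[of ?h ?I f] by simp
  also have "\<dots> = (\<Sum>x\<in>UNIV. \<Sum>y\<in>UNIV. \<Sum>c\<in>UNIV. \<Sum>A\<in>set (mats_with x y c).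
     \<Sum>z\<in>UNIV. \<Sum>d\<in>UNIV. \<Sum>B\<in>set (mats_with z (- x) d).
     \<Sum>C\<in>set (mats_with (- y) (- z) (- (c + d))). f (Tri A B C))"
    by (simp add: sum.Sigma case_prod_unfold)
  finally show ?thesis .
qed

lemma finite_triples: "finite triples"
  by simp

text \<open>For each matrix there are \<open>6\<close> choices with given moments, and \<open>8\<close> more if its moments vanish.  Of
  the \<open>3^5\<close> choices of free moments, the moments of a given matrix vanish for \<open>9\<close>, and those of two
  matrices vanish only if all do.  Hence the count is \<open>3^5 * 6^3 + 3 * 9 * 8 * 6^2 + 3 * 8^2 * 6 + 8^3\<close>.\<close>

lemma card_triples: "card triples = 61928"
proof -
  have "int (card triples) = (\<Sum>t\<in>triples. 1)" by simp
  also have "\<dots> = (\<Sum>x\<in>UNIV. \<Sum>y\<in>UNIV. \<Sum>c\<in>UNIV. \<Sum>z\<in>UNIV. \<Sum>d\<in>UNIV.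
     int (length (mats_with x y c)) * (int (length (mats_with z (- x) d)) *
     int (length (mats_with (- y) (- z) (- (c + d))))))"
    unfolding sum_triples by (simp add: distinct_card[OF distinct_mats_with] sum_distrib_left)
  also have "\<dots> = 61928"
    by (simp add: length_mats_with UNIV_gf3 gf3_eval)
  finally show ?thesis by linarith
qed


section \<open>The number of division sudokus\<close>

lemma card_functions:
  fixes S :: "gf3 \<Rightarrow> 'a set"
  shows "card {f. \<forall>i. f i \<in> S i} = card (S G0) * card (S G1) * card (S G2)"
proof -
  have "{f. \<forall>i. f i \<in> S i} = PiE UNIV S" by (auto simp: PiE_UNIV_domain)
  then show ?thesis by (simp add: card_PiE UNIV_gf3)
qed

lemma card_nonzero1: "card {u. nonzero1 u} = 8" "card {u. nonzero1 u \<and> u 0 = 1} = 4"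
proof -
  have "{x. x \<noteq> G0} = {G1, G2}" using UNIV_gf3 by auto
  then have 2: "card {x. x \<noteq> G0} = 2" by simp
  have "{u. nonzero1 u} = {u. \<forall>i. u i \<in> {x. x \<noteq> 0}}" by (simp add: nonzero1_def)
  then show "card {u. nonzero1 u} = 8"
    by (simp only: card_functions[of "\<lambda>_. {x. x \<noteq> 0}"]) (simp add: 2 zero_gf3_def)
  have "{u. nonzero1 u \<and> u 0 = 1} = {u. \<forall>i. u i \<in> (if i = 0 then {1} else {x. x \<noteq> 0})}"
    by (auto simp: nonzero1_def all_gf3 zero_gf3_def one_gf3_def)
  then show "card {u. nonzero1 u \<and> u 0 = 1} = 4"
    by (simp only: card_functions) (simp add: 2 zero_gf3_def)
qed

definition gauges :: "mat tri \<Rightarrow> (fmat \<times> fmat \<times> fmat) set" where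
  "gauges t = (case t of Tri A B C \<Rightarrow> {(p, q, r). cocycle (ent A) (ent B) (ent C) p q r})"

text \<open>Two solutions of the cocycle equation differ by a coboundary, and the coboundary of
  \<open>(a, b, c)\<close> determines \<open>(a, b, c)\<close> if \<open>a 0 = 0\<close>.\<close>

lemma card_gauges:
  assumes "t \<in> triples"
  shows "card (gauges t) = 3 ^ 8"
proof -
  obtain A B C where t: "t = Tri A B C" by (cases t)
  obtain p q r where c: "cocycle (ent A) (ent B) (ent C) p q r"
    using assms unfolding t triples_iff by blast
  let ?V = "{a::vec. a 0 = 0} \<times> (UNIV :: vec set) \<times> (UNIV :: vec set)"
  let ?h = "\<lambda>(a, b, c). (\<lambda>i j. p i j + (b j - a i), \<lambda>j k. q j k + (c k - b j),
    \<lambda>k i. r k i + (a i - c k)) :: fmat \<times> fmat \<times> fmat"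
  have inj: "inj_on ?h ?V"
  proof (rule inj_onI, clarsimp simp: fun_eq_iff)
    fix a b c a' b' c' :: vec
    assume "a 0 = 0" "a' 0 = 0" "\<forall>i j. b j - a i = b' j - a' i" "\<forall>j k. c k - b j = c' k - b' j"
    then have b: "b j = b' j" for j by (metis diff_zero)
    moreover have "a i = a' i" for i
      using \<open>\<forall>i j. b j - a i = b' j - a' i\<close>[rule_format, of 0 i] b[of 0] by simp
    moreover have "c k = c' k" for k
      using \<open>\<forall>j k. c k - b j = c' k - b' j\<close>[rule_format, of k 0] b[of 0] by simp
    ultimately show "(\<forall>x. a x = a' x) \<and> (\<forall>x. b x = b' x) \<and> (\<forall>x. c x = c' x)"
      by simp
  qed
  have img: "?h ` ?V = gauges t"
  proof
    show "?h ` ?V \<subseteq> gauges t"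
    proof (rule image_subsetI)
      fix x assume "x \<in> ?V"
      obtain a b c' where x: "x = (a, b, c')" by (cases x)
      have "ent A i j * k + (p i j + (b j - a i)) + (ent B j k * i + (q j k + (c' k - b j))) +
          (ent C k i * j + (r k i + (a i - c' k))) = 0" for i j k
        using c[unfolded cocycle_def, rule_format, of i j k] by (simp add: algebra_simps)
      then show "?h x \<in> gauges t"
        by (simp add: x gauges_def t cocycle_def)
    qed
    show "gauges t \<subseteq> ?h ` ?V"
    proof (rule subsetI)
      fix x assume x: "x \<in> gauges t"
      obtain p' q' r' where x_eq: "x = (p', q', r')" by (cases x)
      have c': "cocycle (ent A) (ent B) (ent C) p' q' r'"
        using x by (simp add: gauges_def t x_eq)
      have "(p' i j - p i j) + (q' j k - q j k) + (r' k i - r k i) = 0" for i j k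
      proof -
        have "(p' i j - p i j) + (q' j k - q j k) + (r' k i - r k i) =
            (ent A i j * k + p' i j + (ent B j k * i + q' j k) + (ent C k i * j + r' k i)) -
            (ent A i j * k + p i j + (ent B j k * i + q j k) + (ent C k i * j + r k i))"
          by (simp add: algebra_simps)
        also have "\<dots> = 0"
          by (simp only: c[unfolded cocycle_def, rule_format]
              c'[unfolded cocycle_def, rule_format] diff_self)
        finally show ?thesis .
      qed
      then obtain a b c'' where abc: "a 0 = 0" "(\<lambda>i j. p' i j - p i j) = (\<lambda>i j. b j - a i)"
        "(\<lambda>j k. q' j k - q j k) = (\<lambda>j k. c'' k - b j)"
        "(\<lambda>k i. r' k i - r k i) = (\<lambda>k i. a i - c'' k)"
        using coboundary[of "\<lambda>i j. p' i j - p i j" "\<lambda>j k. q' j k - q j k" "\<lambda>k i. r' k i - r k i"]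
        by blast
      then have d: "p' i j - p i j = b j - a i" "q' j k - q j k = c'' k - b j"
        "r' k i - r k i = a i - c'' k" for i j k
        by (metis (no_types))+
      have "p' i j = p i j + (b j - a i)" "q' j k = q j k + (c'' k - b j)"
        "r' k i = r k i + (a i - c'' k)" for i j k
        by (simp_all add: d[symmetric])
      then have "x = ?h (a, b, c'')" by (simp add: fun_eq_iff x_eq)
      then show "x \<in> ?h ` ?V" using abc(1) by blast
    qed
  qed
  have "card (gauges t) = card ?V"
    unfolding img[symmetric] by (rule card_image[OF inj])
  also have "card {a::vec. a 0 = 0} = 9"
  proof -
    have "{a::vec. a 0 = 0} = {a. \<forall>i. a i \<in> (if i = 0 then {0} else UNIV)}"
      by (auto simp: all_gf3 zero_gf3_def)
    then show ?thesis
      by (simp only: card_functions) (simp add: card_UNIV_gf3 zero_gf3_def)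
  qed
  then have "card ?V = 3 ^ 8"
    using card_functions[of "\<lambda>_. UNIV :: gf3 set"] by (simp add: card_UNIV_gf3 card_cartesian_product del: UNIV_Times_UNIV)
  finally show ?thesis .
qed

text \<open>This is not a function of the relation, because a common sign of all coordinates is free.\<close>

definition has_signs :: "rel3 \<Rightarrow> mat tri \<Rightarrow> bool" where
  "has_signs O' t \<longleftrightarrow> (\<exists>u v w A B C p q r. nonzero1 u \<and> nonzero1 v \<and> nonzero1 w \<and>
     t = Tri A B C \<and> signs A \<and> signs B \<and> signs C \<and> cocycle (ent A) (ent B) (ent C) p q r \<and>
     O' = affine_rel u v w (ent A) (ent B) p q)"

lemma has_signsI:
  assumes "nonzero1 u" "nonzero1 v" "nonzero1 w" "nonzero2 A" "nonzero2 B" "nonzero2 C"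
    "cocycle A B C p q r" "O' = affine_rel u v w A B p q"
    "t = Tri (mat_of A) (mat_of B) (mat_of C)"
  shows "has_signs O' t"
proof -
  have "ent (mat_of M) = M" "signs (mat_of M) \<longleftrightarrow> nonzero2 M" for M
    by (simp_all add: fun_eq_iff signs_def nonzero2_def)
  then show ?thesis unfolding has_signs_def using assms by metis
qed

lemma nonzero2_ent: "nonzero2 (ent A) \<longleftrightarrow> signs A"
  by (simp add: nonzero2_def signs_def)

lemma has_signs_in_triples: "has_signs O' t \<Longrightarrow> t \<in> triples"
  unfolding has_signs_def using triples_iff by blast

lemma has_signs_ds_relation: "has_signs O' t \<Longrightarrow> ds_relation O'"
  unfolding has_signs_def nonzero2_ent[symmetric] using ds_relation_affine_rel by blast

lemma ds_relation_has_signs: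
  assumes "ds_relation O'"
  shows "\<exists>t. has_signs O' t"
proof -
  obtain u v w A B C p q r where "nonzero1 u" "nonzero1 v" "nonzero1 w"
    "nonzero2 A" "nonzero2 B" "nonzero2 C" "cocycle A B C p q r" "O' = affine_rel u v w A B p q"
    using ds_relation_imp_affine_rel[OF assms] by (elim exE conjE)
  then show ?thesis using has_signsI by blast
qed

lemma triples_has_signs:
  assumes "t \<in> triples"
  shows "\<exists>O'. has_signs O' t"
proof -
  obtain A B C where t: "t = Tri A B C" by (cases t)
  have "nonzero1 (\<lambda>_. 1)" by (simp add: nonzero1_def)
  then show ?thesis using assms unfolding t triples_iff has_signs_def by blast
qed

text \<open>The coordinates of a relation are unique up to a common sign, so the condition \<open>u 0 = 1\<close> makes
  them unique.\<close>

lemma card_ds_relations: "card {O'. ds_relation O'} = 104015259648"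
proof -
  let ?U = "{u. nonzero1 u \<and> u 0 = 1}" and ?V = "{u. nonzero1 u}"
  let ?P = "?U \<times> ?V \<times> ?V \<times> (SIGMA t:triples. gauges t)"
  define h :: "vec \<times> vec \<times> vec \<times> mat tri \<times> fmat \<times> fmat \<times> fmat \<Rightarrow> rel3" where
    "h = (\<lambda>(u, v, w, t, p, q, r). case t of Tri A B C \<Rightarrow> affine_rel u v w (ent A) (ent B) p q)"
  have inj: "inj_on h ?P"
  proof (rule inj_onI)
    fix x x' assume xP: "x \<in> ?P" "x' \<in> ?P" and h_eq: "h x = h x'"
    obtain u v w t p q r u' v' w' t' p' q' r' where x: "x = (u, v, w, t, p, q, r)"
      "x' = (u', v', w', t', p', q', r')"
      by (cases x; cases x')
    have nz: "nonzero1 u" "nonzero1 v" "nonzero1 w" "nonzero1 u'" "nonzero1 v'" "nonzero1 w'"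
      and one: "u 0 = 1" "u' 0 = 1"
      and g: "(p, q, r) \<in> gauges t" "(p', q', r') \<in> gauges t'"
      using xP by (simp_all add: x)
    obtain A B C A' B' C' where tt: "t = Tri A B C" "t' = Tri A' B' C'"
      by (cases t; cases t')
    have "affine_rel u v w (ent A) (ent B) p q = affine_rel u' v' w' (ent A') (ent B') p' q'"
      using h_eq by (simp add: x h_def tt)
    then obtain s where s: "u' = (\<lambda>i. s * u i)" "v' = (\<lambda>j. s * v j)" "w' = (\<lambda>k. s * w k)"
      "ent A' = (\<lambda>i j. s * ent A i j)" "ent B' = (\<lambda>j k. s * ent B j k)"
      "p' = (\<lambda>i j. s * p i j)" "q' = (\<lambda>j k. s * q j k)"
      using affine_rel_unique[OF nz(1-5)] by blast
    have "s = 1" using s(1) one by simp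
    then have e: "u' = u" "v' = v" "w' = w" "ent A' = ent A" "ent B' = ent B" "p' = p" "q' = q"
      using s by simp_all
    have "ent C' = ent C" "r' = r"
      using cocycle_third_unique[of "ent A" "ent B" "ent C" p q r "ent C'" r'] g
      by (simp_all add: gauges_def tt e)
    then show "x = x'"
      using e by (simp add: x tt mat_eq_iff)
  qed
  have img: "h ` ?P = {O'. ds_relation O'}"
  proof
    show "h ` ?P \<subseteq> {O'. ds_relation O'}"
    proof (rule image_subsetI)
      fix x assume "x \<in> ?P"
      then obtain u v w t p q r where x: "x = (u, v, w, t, p, q, r)" and
        a: "nonzero1 u" "nonzero1 v" "nonzero1 w" "t \<in> triples" "(p, q, r) \<in> gauges t"
        by auto
      obtain A B C where t: "t = Tri A B C" by (cases t)
      show "h x \<in> {O'. ds_relation O'}"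
        using a ds_relation_affine_rel[of u v w "ent A" "ent B" "ent C" p q r]
        by (simp add: x h_def t gauges_def triples_iff nonzero2_ent)
    qed
    show "{O'. ds_relation O'} \<subseteq> h ` ?P"
    proof (rule subsetI)
      fix O' assume "O' \<in> {O'. ds_relation O'}"
      then have "ds_relation O'" by simp
      then obtain u v w A B C p q r where nz: "nonzero1 u" "nonzero1 v" "nonzero1 w"
        "nonzero2 A" "nonzero2 B" "nonzero2 C" and c: "cocycle A B C p q r"
        and O': "O' = affine_rel u v w A B p q"
        by (elim ds_relation_imp_affine_rel[THEN exE] exE conjE)
      define s where "s = u 0"
      have s: "s \<noteq> 0" using nz(1) by (simp add: s_def nonzero1_def)
      define m where "m M = mat_of (\<lambda>i j. s * M i j)" for M
      have m: "ent (m M) = (\<lambda>i j. s * M i j)" for M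
        by (simp add: m_def fun_eq_iff)
      let ?t = "Tri (m A) (m B) (m C)"
      let ?x = "(\<lambda>i. s * u i, \<lambda>j. s * v j, \<lambda>k. s * w k, ?t,
        \<lambda>i j. s * p i j, \<lambda>j k. s * q j k, \<lambda>k i. s * r k i)"
      have c': "cocycle (ent (m A)) (ent (m B)) (ent (m C))
          (\<lambda>i j. s * p i j) (\<lambda>j k. s * q j k) (\<lambda>k i. s * r k i)"
        unfolding m by (rule cocycle_scale[OF c])
      have "signs (m M)" if "nonzero2 M" for M
        using that s by (simp add: signs_def nonzero2_def m mult_nonzero_gf3)
      then have "?t \<in> triples" using c' nz by (auto simp: triples_iff)
      then have x: "?x \<in> ?P"
        using nz s c' by (simp add: nonzero1_def mult_nonzero_gf3 gauges_def s_def square_gf3)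
      have "O' = h ?x"
        by (simp add: h_def m O' affine_rel_scale[OF s])
      then show "O' \<in> h ` ?P" by (rule image_eqI[OF _ x])
    qed
  qed
  have "card {O'. ds_relation O'} = card ?P"
    unfolding img[symmetric] by (rule card_image[OF inj])
  also have "\<dots> = 4 * (8 * (8 * (\<Sum>t\<in>triples. card (gauges t))))"
  proof -
    have "finite (gauges t)" if "t \<in> triples" for t
      using card_gauges[OF that] by (metis card.infinite power_eq_0_iff zero_neq_numeral)
    then show ?thesis
      by (simp add: card_cartesian_product card_nonzero1 card_SigmaI[OF finite_triples])
  qed
  also have "\<dots> = 104015259648"
    by (simp add: card_gauges card_triples)
  finally show ?thesis .
qed


section \<open>Symmetries of triples of sign matrices\<close>

text \<open>A symmetry consists of a common sign and of three affine permutations of the field, which permute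
  the row, column and symbol blocks.  The substitution of \<open>g3 * k + h3\<close> for \<open>k\<close> multiplies the slope of
  \<open>A i j * k + p i j\<close> by \<open>g3\<close>.  So the factor \<open>g\<close> of each permutation multiplies the one matrix that it
  does not permute.\<close>

type_synonym sym = "gf3 \<times> (gf3 \<times> gf3) \<times> (gf3 \<times> gf3) \<times> (gf3 \<times> gf3)"

definition syms :: "sym set" where
  "syms = {(z, (g1, h1), (g2, h2), (g3, h3)) | z g1 h1 g2 h2 g3 h3.
     z \<noteq> 0 \<and> g1 \<noteq> 0 \<and> g2 \<noteq> 0 \<and> g3 \<noteq> 0}"

definition act_mat :: "gf3 \<Rightarrow> gf3 \<times> gf3 \<Rightarrow> gf3 \<times> gf3 \<Rightarrow> mat \<Rightarrow> mat" where
  "act_mat s a b A = mat_of (\<lambda>i j. s * ent A (fst a * i + snd a) (fst b * j + snd b))"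

fun act :: "sym \<Rightarrow> mat tri \<Rightarrow> mat tri" where
  "act (z, a, b, c) (Tri A B C) =
     Tri (act_mat (z * fst c) a b A) (act_mat (z * fst a) b c B) (act_mat (z * fst b) c a C)"

lemma ent_act_mat [simp]:
  "ent (act_mat s a b A) i j = s * ent A (fst a * i + snd a) (fst b * j + snd b)"
  by (simp add: act_mat_def)

lemma act_act_mat:
  "act_mat s (g1, h1) (g2, h2) (act_mat s' (g1', h1') (g2', h2') A) =
   act_mat (s * s') (g1' * g1, g1' * h1 + h1') (g2' * g2, g2' * h2 + h2') A"
  by (simp add: mat_eq_iff algebra_simps)

lemma act_one: "act (1, (1, 0), (1, 0), (1, 0)) t = t"
  by (cases t) (simp add: mat_eq_iff)

lemma one_in_syms: "(1, (1, 0), (1, 0), (1, 0)) \<in> syms"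
  by (simp add: syms_def)

lemma act_act:
  assumes "q \<in> syms" "q' \<in> syms"
  shows "\<exists>q''\<in>syms. \<forall>t. act q (act q' t) = act q'' t"
proof -
  obtain z g1 h1 g2 h2 g3 h3 where q: "q = (z, (g1, h1), (g2, h2), (g3, h3))"
    "z \<noteq> 0" "g1 \<noteq> 0" "g2 \<noteq> 0" "g3 \<noteq> 0"
    using assms(1) by (auto simp: syms_def)
  obtain z' g1' h1' g2' h2' g3' h3' where q': "q' = (z', (g1', h1'), (g2', h2'), (g3', h3'))"
    "z' \<noteq> 0" "g1' \<noteq> 0" "g2' \<noteq> 0" "g3' \<noteq> 0"
    using assms(2) by (auto simp: syms_def)
  show ?thesis
  proof (rule bexI, rule allI)
    fix t
    show "act q (act q' t) = act (z' * z, (g1' * g1, g1' * h1 + h1'), (g2' * g2, g2' * h2 + h2'),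
        (g3' * g3, g3' * h3 + h3')) t"
      by (cases t) (simp add: q q' act_act_mat ac_simps)
  qed (use q q' in \<open>simp add: syms_def mult_nonzero_gf3\<close>)
qed

lemma act_inverse:
  assumes "q \<in> syms"
  shows "\<exists>q'\<in>syms. \<forall>t. act q' (act q t) = t"
proof -
  obtain z g1 h1 g2 h2 g3 h3 where q: "q = (z, (g1, h1), (g2, h2), (g3, h3))"
    "z \<noteq> 0" "g1 \<noteq> 0" "g2 \<noteq> 0" "g3 \<noteq> 0"
    using assms(1) by (auto simp: syms_def)
  show ?thesis
  proof (rule bexI, rule allI)
    fix t
    show "act (z, (g1, - g1 * h1), (g2, - g2 * h2), (g3, - g3 * h3)) (act q t) = t"
      using q(2-) by (cases t)
        (simp add: q(1) act_act_mat, simp add: mat_eq_iff algebra_simps square_gf3)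
  qed (use q in \<open>simp add: syms_def\<close>)
qed

definition neg_transpose :: "mat \<Rightarrow> mat" where
  "neg_transpose A = mat_of (\<lambda>i j. - ent A j i)"

lemma ent_neg_transpose [simp]: "ent (neg_transpose A) i j = - ent A j i"
  by (simp add: neg_transpose_def)

lemma neg_transpose_twice [simp]: "neg_transpose (neg_transpose A) = A"
  by (simp add: mat_eq_iff)

text \<open>The effect on sign triples of rotating the three coordinates, and of exchanging the first two.  An
  exchange reverses the cyclic order, which changes the sign of all differences of coordinates.\<close>

fun rot :: "mat tri \<Rightarrow> mat tri" where
  "rot (Tri A B C) = Tri B C A"

fun flip :: "mat tri \<Rightarrow> mat tri" where
  "flip (Tri A B C) = Tri (neg_transpose A) (neg_transpose C) (neg_transpose B)"

definition conjs :: "(mat tri \<Rightarrow> mat tri) set" where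
  "conjs = {id, rot, rot \<circ> rot, flip, flip \<circ> rot, flip \<circ> (rot \<circ> rot)}"

lemma neg_transpose_act_mat:
  "neg_transpose (act_mat s a b A) = act_mat s b a (neg_transpose A)"
  by (simp add: mat_eq_iff)

lemma rot_act: "\<exists>q'\<in>syms. \<forall>t. rot (act q t) = act q' (rot t)" if "q \<in> syms"
proof -
  obtain z a b c where q: "q = (z, a, b, c)" by (cases q)
  show ?thesis
  proof (rule bexI, rule allI)
    show "rot (act q t) = act (z, b, c, a) (rot t)" for t
      by (cases t) (simp add: q)
  qed (use that in \<open>auto simp: syms_def q\<close>)
qed

lemma flip_act: "\<exists>q'\<in>syms. \<forall>t. flip (act q t) = act q' (flip t)" if "q \<in> syms"
proof -
  obtain z a b c where q: "q = (z, a, b, c)" by (cases q)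
  show ?thesis
  proof (rule bexI, rule allI)
    show "flip (act q t) = act (z, b, a, c) (flip t)" for t
      by (cases t) (simp add: q neg_transpose_act_mat)
  qed (use that in \<open>auto simp: syms_def q\<close>)
qed

lemma conjs_act: "\<exists>q'\<in>syms. \<forall>t. c (act q t) = act q' (c t)" if "c \<in> conjs" "q \<in> syms"
proof -
  note r = rot_act and f = flip_act
  have rr: "\<exists>q'\<in>syms. \<forall>t. rot (rot (act q t)) = act q' (rot (rot t))"
    using r[OF that(2)] r by metis
  show ?thesis
    using that(1) r[OF that(2)] f[OF that(2)] rr unfolding conjs_def
    by (elim insertE) (use that(2) f in \<open>auto, metis+\<close>)
qed

lemma conjs_relations:
  "rot \<circ> (rot \<circ> rot) = id" "rot \<circ> (rot \<circ> (rot \<circ> f)) = f"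
  "flip \<circ> flip = id" "flip \<circ> (flip \<circ> f) = f"
  "rot \<circ> flip = flip \<circ> (rot \<circ> rot)" "rot \<circ> (flip \<circ> f) = flip \<circ> (rot \<circ> (rot \<circ> f))"
proof -
  have "rot (rot (rot t)) = t" "flip (flip t) = t" "rot (flip t) = flip (rot (rot t))" for t
    by (cases t; simp)+
  then show "rot \<circ> (rot \<circ> rot) = id" "rot \<circ> (rot \<circ> (rot \<circ> f)) = f"
    "flip \<circ> flip = id" "flip \<circ> (flip \<circ> f) = f"
    "rot \<circ> flip = flip \<circ> (rot \<circ> rot)" "rot \<circ> (flip \<circ> f) = flip \<circ> (rot \<circ> (rot \<circ> f))"
    by (simp_all add: fun_eq_iff)
qed

lemma conjs_comp: "c \<circ> c' \<in> conjs" if "c \<in> conjs" "c' \<in> conjs"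
proof -
  have "rot \<circ> f \<in> conjs" "flip \<circ> f \<in> conjs" if "f \<in> conjs" for f
    using that unfolding conjs_def
    by (elim insertE emptyE; simp add: conjs_relations)+
  then show ?thesis
    using that unfolding conjs_def[THEN eqset_imp_iff, of c]
    by (elim insertE emptyE) (simp_all add: comp_assoc)
qed

lemma conjs_inverse: "\<exists>c'\<in>conjs. c' \<circ> c = id" if "c \<in> conjs"
proof -
  have "rot \<circ> rot \<circ> rot = id" "flip \<circ> rot \<circ> (flip \<circ> rot) = id"
    "flip \<circ> (rot \<circ> rot) \<circ> (flip \<circ> (rot \<circ> rot)) = id"
    by (simp_all add: comp_assoc conjs_relations)
  then show ?thesis
    using that conjs_relations(1,3) unfolding conjs_def by auto
qed

text \<open>The relations on sign data that correspond to ds-isotopism and ds-paratopism.\<close>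

definition isotopic :: "mat tri \<Rightarrow> mat tri \<Rightarrow> bool" where
  "isotopic t t' \<longleftrightarrow> (\<exists>q\<in>syms. t = act q t')"

definition paratopic :: "mat tri \<Rightarrow> mat tri \<Rightarrow> bool" where
  "paratopic t t' \<longleftrightarrow> (\<exists>c\<in>conjs. \<exists>q\<in>syms. t = act q (c t'))"

lemma isotopic_refl: "isotopic t t"
  unfolding isotopic_def using one_in_syms act_one by metis

lemma isotopic_sym: "isotopic t t' \<Longrightarrow> isotopic t' t"
  unfolding isotopic_def using act_inverse by metis

lemma isotopic_trans: "isotopic t t' \<Longrightarrow> isotopic t' t'' \<Longrightarrow> isotopic t t''"
  unfolding isotopic_def using act_act by metis

lemma paratopic_iff_isotopic: "paratopic t t' \<longleftrightarrow> (\<exists>c\<in>conjs. isotopic t (c t'))"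
  by (auto simp: paratopic_def isotopic_def)

lemma isotopic_conjs: "isotopic t t' \<Longrightarrow> c \<in> conjs \<Longrightarrow> isotopic (c t) (c t')"
  unfolding isotopic_def using conjs_act by metis

lemma paratopic_refl: "paratopic t t"
  unfolding paratopic_iff_isotopic using isotopic_refl
  by (intro bexI[of _ id]) (auto simp: conjs_def)

lemma paratopic_sym:
  assumes "paratopic t t'"
  shows "paratopic t' t"
proof -
  obtain c c' where c: "c \<in> conjs" "isotopic t (c t')" "c' \<in> conjs" "c' \<circ> c = id"
    using assms conjs_inverse unfolding paratopic_iff_isotopic by blast
  then have "isotopic (c' t) t'"
    using isotopic_conjs[of t "c t'" c'] by (metis comp_apply id_apply)
  then show ?thesis
    using c(3) isotopic_sym unfolding paratopic_iff_isotopic by blast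
qed

lemma paratopic_trans:
  assumes "paratopic t t'" "paratopic t' t''"
  shows "paratopic t t''"
proof -
  obtain c c' where c: "c \<in> conjs" "isotopic t (c t')" "c' \<in> conjs" "isotopic t' (c' t'')"
    using assms unfolding paratopic_iff_isotopic by blast
  have "isotopic t ((c \<circ> c') t'')"
    using isotopic_trans[OF c(2) isotopic_conjs[OF c(4,1)]] by simp
  then show ?thesis
    using conjs_comp[OF c(1,3)] unfolding paratopic_iff_isotopic by blast
qed


section \<open>Isotopisms and conjugates of relations\<close>

text \<open>All permutations of the points that permute the blocks have this form, because the permutations
  of the blocks and those inside the blocks are permutations of the field.\<close>

definition blockmap :: "(point \<Rightarrow> point) \<Rightarrow> bool" where
  "blockmap \<alpha> \<longleftrightarrow> (\<exists>g h m n. g \<noteq> 0 \<and> nonzero1 m \<and> \<alpha> = (\<lambda>(i, x). (g * i + h, m i * x + n i)))"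

lemma blockmapI:
  "g \<noteq> 0 \<Longrightarrow> nonzero1 m \<Longrightarrow> blockmap (\<lambda>(i, x). (g * i + h, m i * x + n i))"
  unfolding blockmap_def by blast

definition iso_rel :: "rel3 \<Rightarrow> rel3 \<Rightarrow> bool" where
  "iso_rel O1 O2 \<longleftrightarrow> (\<exists>\<alpha> \<beta> \<gamma>. blockmap \<alpha> \<and> blockmap \<beta> \<and> blockmap \<gamma> \<and>
     O1 = (\<lambda>X Y Z. O2 (\<alpha> X) (\<beta> Y) (\<gamma> Z)))"

lemma affine_rel_pullback:
  assumes "\<alpha> = (\<lambda>(i, x). (g1 * i + h1, m1 i * x + n1 i))"
    "\<beta> = (\<lambda>(j, y). (g2 * j + h2, m2 j * y + n2 j))"
    "\<gamma> = (\<lambda>(k, z). (g3 * k + h3, m3 k * z + n3 k))"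
  shows "(\<lambda>X Y Z. affine_rel u v w A B p q (\<alpha> X) (\<beta> Y) (\<gamma> Z)) =
    affine_rel (\<lambda>i. u (g1 * i + h1) * m1 i) (\<lambda>j. v (g2 * j + h2) * m2 j)
      (\<lambda>k. w (g3 * k + h3) * m3 k)
      (\<lambda>i j. g3 * A (g1 * i + h1) (g2 * j + h2)) (\<lambda>j k. g1 * B (g2 * j + h2) (g3 * k + h3))
      (\<lambda>i j. p (g1 * i + h1) (g2 * j + h2) + A (g1 * i + h1) (g2 * j + h2) * h3 -
        v (g2 * j + h2) * n2 j + u (g1 * i + h1) * n1 i)
      (\<lambda>j k. q (g2 * j + h2) (g3 * k + h3) + B (g2 * j + h2) (g3 * k + h3) * h1 -
        w (g3 * k + h3) * n3 k + v (g2 * j + h2) * n2 j)"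
proof -
  have line: "v * (m2 * y + n2) - u * (m1 * x + n1) = a * (g * k + h) + p \<longleftrightarrow>
      v * m2 * y - u * m1 * x = g * a * k + (p + a * h - v * n2 + u * n1)"
    for v m2 y n2 u m1 x n1 a g k h p :: gf3
  proof -
    have "v * (m2 * y + n2) - u * (m1 * x + n1) - (a * (g * k + h) + p) =
        v * m2 * y - u * m1 * x - (g * a * k + (p + a * h - v * n2 + u * n1))"
      by (simp add: algebra_simps)
    then show ?thesis by (metis eq_iff_diff_eq_0)
  qed
  show ?thesis
    by (intro ext, clarsimp simp: affine_rel_def assms line)
qed

lemma cocycle_pullback:
  assumes "cocycle A B C p q r"
  shows "cocycle (\<lambda>i j. g3 * A (g1 * i + h1) (g2 * j + h2)) (\<lambda>j k. g1 * B (g2 * j + h2) (g3 * k + h3))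
      (\<lambda>k i. g2 * C (g3 * k + h3) (g1 * i + h1))
      (\<lambda>i j. p (g1 * i + h1) (g2 * j + h2) + A (g1 * i + h1) (g2 * j + h2) * h3 - b j + a i)
      (\<lambda>j k. q (g2 * j + h2) (g3 * k + h3) + B (g2 * j + h2) (g3 * k + h3) * h1 - c k + b j)
      (\<lambda>k i. r (g3 * k + h3) (g1 * i + h1) + C (g3 * k + h3) (g1 * i + h1) * h2 - a i + c k)"
  unfolding cocycle_def
proof (intro allI)
  fix i j k
  let ?i = "g1 * i + h1" and ?j = "g2 * j + h2" and ?k = "g3 * k + h3"
  have "g3 * A ?i ?j * k + (p ?i ?j + A ?i ?j * h3 - b j + a i) +
      (g1 * B ?j ?k * i + (q ?j ?k + B ?j ?k * h1 - c k + b j)) +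
      (g2 * C ?k ?i * j + (r ?k ?i + C ?k ?i * h2 - a i + c k)) =
      A ?i ?j * ?k + p ?i ?j + (B ?j ?k * ?i + q ?j ?k) + (C ?k ?i * ?j + r ?k ?i)"
    by (simp add: distrib_left mult.assoc mult.left_commute[of g3] mult.left_commute[of g1]
        mult.left_commute[of g2])
  also have "\<dots> = 0" using assms by (simp only: cocycle_def)
  finally show "g3 * A ?i ?j * k + (p ?i ?j + A ?i ?j * h3 - b j + a i) +
      (g1 * B ?j ?k * i + (q ?j ?k + B ?j ?k * h1 - c k + b j)) +
      (g2 * C ?k ?i * j + (r ?k ?i + C ?k ?i * h2 - a i + c k)) = 0" .
qed

text \<open>The coordinates of \<open>O2\<close>, pulled back along the isotopism, are coordinates of \<open>O1\<close>, which are
  unique up to a common sign.\<close>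

lemma iso_rel_imp_isotopic:
  assumes "has_signs O1 t1" "has_signs O2 t2" "iso_rel O1 O2"
  shows "isotopic t1 t2"
proof -
  obtain u v w A B C p q r where 1: "nonzero1 u" "nonzero1 v" "nonzero1 w" "t1 = Tri A B C"
    "cocycle (ent A) (ent B) (ent C) p q r" "O1 = affine_rel u v w (ent A) (ent B) p q"
    using assms(1) unfolding has_signs_def by (elim exE conjE)
  obtain u' v' w' A' B' C' p' q' r' where 2: "nonzero1 u'" "nonzero1 v'" "nonzero1 w'"
    "t2 = Tri A' B' C'" "cocycle (ent A') (ent B') (ent C') p' q' r'"
    "O2 = affine_rel u' v' w' (ent A') (ent B') p' q'"
    using assms(2) unfolding has_signs_def by (elim exE conjE)
  obtain \<alpha> \<beta> \<gamma> where maps: "blockmap \<alpha>" "blockmap \<beta>" "blockmap \<gamma>"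
    "O1 = (\<lambda>X Y Z. O2 (\<alpha> X) (\<beta> Y) (\<gamma> Z))"
    using assms(3) unfolding iso_rel_def by (elim exE conjE)
  obtain g1 h1 m1 n1 where a: "g1 \<noteq> 0" "nonzero1 m1"
    "\<alpha> = (\<lambda>(i, x). (g1 * i + h1, m1 i * x + n1 i))"
    using maps(1) unfolding blockmap_def by (elim exE conjE)
  obtain g2 h2 m2 n2 where b: "g2 \<noteq> 0" "nonzero1 m2"
    "\<beta> = (\<lambda>(j, y). (g2 * j + h2, m2 j * y + n2 j))"
    using maps(2) unfolding blockmap_def by (elim exE conjE)
  obtain g3 h3 m3 n3 where c: "g3 \<noteq> 0" "nonzero1 m3"
    "\<gamma> = (\<lambda>(k, z). (g3 * k + h3, m3 k * z + n3 k))"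
    using maps(3) unfolding blockmap_def by (elim exE conjE)
  let ?p = "\<lambda>i j. p' (g1 * i + h1) (g2 * j + h2) + ent A' (g1 * i + h1) (g2 * j + h2) * h3 -
        v' (g2 * j + h2) * n2 j + u' (g1 * i + h1) * n1 i"
  let ?q = "\<lambda>j k. q' (g2 * j + h2) (g3 * k + h3) + ent B' (g2 * j + h2) (g3 * k + h3) * h1 -
        w' (g3 * k + h3) * n3 k + v' (g2 * j + h2) * n2 j"
  have nz: "nonzero1 (\<lambda>i. u' (g1 * i + h1) * m1 i)" "nonzero1 (\<lambda>j. v' (g2 * j + h2) * m2 j)"
    "nonzero1 (\<lambda>k. w' (g3 * k + h3) * m3 k)"
    using 2(1-3) a(2) b(2) c(2) by (simp_all add: nonzero1_def mult_nonzero_gf3)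
  have "affine_rel (\<lambda>i. u' (g1 * i + h1) * m1 i) (\<lambda>j. v' (g2 * j + h2) * m2 j)
      (\<lambda>k. w' (g3 * k + h3) * m3 k) (\<lambda>i j. g3 * ent A' (g1 * i + h1) (g2 * j + h2))
      (\<lambda>j k. g1 * ent B' (g2 * j + h2) (g3 * k + h3)) ?p ?q = affine_rel u v w (ent A) (ent B) p q"
    using affine_rel_pullback[OF a(3) b(3) c(3), of u' v' w' "ent A'" "ent B'" p' q']
    by (simp only: maps(4)[symmetric] 1(6)[symmetric] 2(6)[symmetric])
  from affine_rel_unique[OF nz 1(1,2) this] obtain s where s: "s \<noteq> 0"
    "ent A = (\<lambda>i j. s * (g3 * ent A' (g1 * i + h1) (g2 * j + h2)))"
    "ent B = (\<lambda>j k. s * (g1 * ent B' (g2 * j + h2) (g3 * k + h3)))"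
    "p = (\<lambda>i j. s * ?p i j)" "q = (\<lambda>j k. s * ?q j k)"
    by (elim exE conjE)
  have "ent C = (\<lambda>k i. s * (g2 * ent C' (g3 * k + h3) (g1 * i + h1)))"
    using cocycle_third_unique(1)[OF
        cocycle_scale[OF cocycle_pullback[OF 2(5), where a = "\<lambda>i. u' (g1 * i + h1) * n1 i" and
          b = "\<lambda>j. v' (g2 * j + h2) * n2 j" and c = "\<lambda>k. w' (g3 * k + h3) * n3 k"], of s]
        1(5)[unfolded s(2-5)]] .
  then have "t1 = act (s, (g1, h1), (g2, h2), (g3, h3)) t2"
    using s(2,3) by (simp add: 1(4) 2(4) mat_eq_iff fun_eq_iff mult.assoc)
  moreover have "(s, (g1, h1), (g2, h2), (g3, h3)) \<in> syms"
    using s(1) a(1) b(1) c(1) by (simp add: syms_def)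
  ultimately show ?thesis
    unfolding isotopic_def by blast
qed

text \<open>Conversely, a symmetry prescribes the permutations of the blocks.  The permutations inside the
  blocks are then found from the coordinates: their slopes from the sign vectors, and their
  translations from the constant terms, which differ by a coboundary.\<close>

lemma isotopic_imp_iso_rel:
  assumes "has_signs O1 t1" "has_signs O2 t2" "isotopic t1 t2"
  shows "iso_rel O1 O2"
proof -
  obtain u v w A B C p q r where 1: "nonzero1 u" "nonzero1 v" "nonzero1 w" "t1 = Tri A B C"
    "cocycle (ent A) (ent B) (ent C) p q r" "O1 = affine_rel u v w (ent A) (ent B) p q"
    using assms(1) unfolding has_signs_def by (elim exE conjE)
  obtain u' v' w' A' B' C' p' q' r' where 2: "nonzero1 u'" "nonzero1 v'" "nonzero1 w'"
    "t2 = Tri A' B' C'" "cocycle (ent A') (ent B') (ent C') p' q' r'"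
    "O2 = affine_rel u' v' w' (ent A') (ent B') p' q'"
    using assms(2) unfolding has_signs_def by (elim exE conjE)
  obtain s g1 h1 g2 h2 g3 h3 where nz: "s \<noteq> 0" "g1 \<noteq> 0" "g2 \<noteq> 0" "g3 \<noteq> 0"
    and t1: "t1 = act (s, (g1, h1), (g2, h2), (g3, h3)) t2"
    using assms(3) unfolding isotopic_def syms_def by auto
  let ?i = "\<lambda>i. g1 * i + h1" and ?j = "\<lambda>j. g2 * j + h2" and ?k = "\<lambda>k. g3 * k + h3"
  have A: "g3 * ent A' (?i i) (?j j) = s * ent A i j"
    and B: "g1 * ent B' (?j j) (?k k) = s * ent B j k"
    and C: "g2 * ent C' (?k k) (?i i) = s * ent C k i" for i j k
    using t1 nz by (simp_all add: 1(4) 2(4) square_gf3 mult.assoc)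
  \<comment> \<open>The differences between the required constant terms and those of the pulled back relation,
    as long as the blocks are permuted without translations inside them.\<close>
  define f where "f i j = s * p i j - (p' (?i i) (?j j) + ent A' (?i i) (?j j) * h3)" for i j
  define g where "g j k = s * q j k - (q' (?j j) (?k k) + ent B' (?j j) (?k k) * h1)" for j k
  define h where "h k i = s * r k i - (r' (?k k) (?i i) + ent C' (?k k) (?i i) * h2)" for k i
  have "f i j + g j k + h k i = 0" for i j k
  proof -
    have e1: "s * (ent A i j * k + p i j + (ent B j k * i + q j k) + (ent C k i * j + r k i)) = 0"
      using 1(5) by (simp add: cocycle_def)
    have e2: "(ent A' (?i i) (?j j) * ?k k + p' (?i i) (?j j)) +
        (ent B' (?j j) (?k k) * ?i i + q' (?j j) (?k k)) +
        (ent C' (?k k) (?i i) * ?j j + r' (?k k) (?i i)) = 0"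
      using 2(5) by (simp only: cocycle_def)
    have "f i j + g j k + h k i =
        s * (ent A i j * k + p i j + (ent B j k * i + q j k) + (ent C k i * j + r k i)) -
        (s * ent A i j * k + s * ent B j k * i + s * ent C k i * j) -
        ((ent A' (?i i) (?j j) * ?k k + p' (?i i) (?j j)) +
        (ent B' (?j j) (?k k) * ?i i + q' (?j j) (?k k)) +
        (ent C' (?k k) (?i i) * ?j j + r' (?k k) (?i i))) +
        (g3 * ent A' (?i i) (?j j) * k + g1 * ent B' (?j j) (?k k) * i +
         g2 * ent C' (?k k) (?i i) * j)"
      by (simp add: f_def g_def h_def distrib_left mult.assoc mult.left_commute[of g3]
          mult.left_commute[of g1] mult.left_commute[of g2])
    then show ?thesis unfolding e1 e2 A B C by simp
  qed
  then obtain a b c where abc: "f = (\<lambda>i j. b j - a i)" "g = (\<lambda>j k. c k - b j)"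
    using coboundary[of f g h] by blast
  have abc: "s * p i j = p' (?i i) (?j j) + ent A' (?i i) (?j j) * h3 + b j - a i"
    "s * q j k = q' (?j j) (?k k) + ent B' (?j j) (?k k) * h1 + c k - b j" for i j k
    using fun_cong[OF fun_cong[OF abc(1)], of i j] fun_cong[OF fun_cong[OF abc(2)], of j k]
    by (simp_all add: f_def g_def algebra_simps)
  define \<alpha> where "\<alpha> = (\<lambda>(i, x). (?i i, s * u' (?i i) * u i * x + - u' (?i i) * a i))"
  define \<beta> where "\<beta> = (\<lambda>(j, y). (?j j, s * v' (?j j) * v j * y + - v' (?j j) * b j))"
  define \<gamma> where "\<gamma> = (\<lambda>(k, z). (?k k, s * w' (?k k) * w k * z + - w' (?k k) * c k))"
  have sq: "u' i * (u' i * x) = x" "v' j * (v' j * x) = x" "w' k * (w' k * x) = x" for i j k x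
    using 2(1-3) by (simp_all add: nonzero1_def square_gf3)
  have "blockmap \<alpha>" "blockmap \<beta>" "blockmap \<gamma>"
    unfolding \<alpha>_def \<beta>_def \<gamma>_def
    by (intro blockmapI; use nz 1(1-3) 2(1-3) in \<open>simp add: nonzero1_def mult_nonzero_gf3\<close>)+
  moreover have "(\<lambda>X Y Z. O2 (\<alpha> X) (\<beta> Y) (\<gamma> Z)) = O1"
  proof -
    have "u' (?i i) * (s * u' (?i i) * u i) = s * u i"
      "v' (?j j) * (s * v' (?j j) * v j) = s * v j"
      "w' (?k k) * (s * w' (?k k) * w k) = s * w k" for i j k
      using sq by (simp_all add: ac_simps)
    moreover have
      "p' (?i i) (?j j) + ent A' (?i i) (?j j) * h3 - v' (?j j) * (- v' (?j j) * b j) +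
        u' (?i i) * (- u' (?i i) * a i) = s * p i j"
      "q' (?j j) (?k k) + ent B' (?j j) (?k k) * h1 - w' (?k k) * (- w' (?k k) * c k) +
        v' (?j j) * (- v' (?j j) * b j) = s * q j k" for i j k
      using sq by (simp_all add: abc)
    ultimately show ?thesis
      unfolding 2(6) affine_rel_pullback[OF \<alpha>_def \<beta>_def \<gamma>_def] A B
      by (simp only: affine_rel_scale[OF nz(1)] 1(6))
  qed
  ultimately show ?thesis
    unfolding iso_rel_def by metis
qed

lemma iso_rel_iff:
  "has_signs O1 t1 \<Longrightarrow> has_signs O2 t2 \<Longrightarrow> iso_rel O1 O2 \<longleftrightarrow> isotopic t1 t2"
  using iso_rel_imp_isotopic isotopic_imp_iso_rel by blast

lemma has_signs_rotate:
  assumes "has_signs O' t"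
  shows "has_signs (rotate_rel O') (rot t)"
proof -
  obtain u v w A B C p q r where 1: "nonzero1 u" "nonzero1 v" "nonzero1 w" "t = Tri A B C"
    "signs A" "signs B" "signs C"
    "cocycle (ent A) (ent B) (ent C) p q r" "O' = affine_rel u v w (ent A) (ent B) p q"
    using assms unfolding has_signs_def by (elim exE conjE)
  have "rotate_rel O' = affine_rel v w u (ent B) (ent C) q r"
    unfolding 1(9) by (rule rotate_affine_rel[OF 1(8)])
  moreover have "rot t = Tri B C A" by (simp add: 1(4))
  ultimately show ?thesis
    using 1 cocycle_rotate[OF 1(8)] unfolding has_signs_def by blast
qed

lemma has_signs_swap12:
  assumes "has_signs O' t"
  shows "has_signs (swap12 O') (flip t)"
proof -
  obtain u v w A B C p q r where 1: "nonzero1 u" "nonzero1 v" "nonzero1 w" "t = Tri A B C"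
    "signs A" "signs B" "signs C"
    "cocycle (ent A) (ent B) (ent C) p q r" "O' = affine_rel u v w (ent A) (ent B) p q"
    using assms unfolding has_signs_def by (elim exE conjE)
  have third: "affine_rel u v w (ent A) (ent B) p q (i, x) (j, y) (k, z) \<longleftrightarrow>
      v j * y - u i * x = ent A i j * k + p i j \<and> u i * x - w k * z = ent C k i * j + r k i"
    for i x j y k z
  proof -
    have "ent A i j * k + p i j + (ent B j k * i + q j k) + (ent C k i * j + r k i) = 0"
      using 1(8) by (simp add: cocycle_def)
    moreover have "b = - a - c" if "a + b + c = 0" for a b c :: gf3
      using that by (cases a; cases b; cases c) (simp_all add: gf3_eval)
    ultimately have B: "ent B j k * i + q j k =
        - (ent A i j * k + p i j) - (ent C k i * j + r k i)"
      by blast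
    show ?thesis unfolding affine_rel_def prod.case B by (auto simp: algebra_simps)
  qed
  have neg: "a - b = c * d + e \<longleftrightarrow> b - a = - c * d + - e" for a b c d e :: gf3
    by (metis minus_add_distrib minus_diff_eq minus_equation_iff mult_minus_left)
  have "swap12 O' = affine_rel v u w (\<lambda>j i. - ent A i j) (\<lambda>i k. - ent C k i)
      (\<lambda>j i. - p i j) (\<lambda>i k. - r k i)"
  proof (intro ext)
    fix Y X Z :: point
    obtain i x j y k z where XYZ: "X = (i, x)" "Y = (j, y)" "Z = (k, z)"
      by (cases X; cases Y; cases Z)
    show "swap12 O' Y X Z = affine_rel v u w (\<lambda>j i. - ent A i j) (\<lambda>i k. - ent C k i)
        (\<lambda>j i. - p i j) (\<lambda>i k. - r k i) Y X Z"
      unfolding swap12_def XYZ 1(9) third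
      using neg[of "v j * y" "u i * x" "ent A i j" k "p i j"]
        neg[of "u i * x" "w k * z" "ent C k i" j "r k i"]
      by (simp add: affine_rel_def)
  qed
  moreover have "flip t = Tri (mat_of (\<lambda>j i. - ent A i j)) (mat_of (\<lambda>i k. - ent C k i))
      (mat_of (\<lambda>k j. - ent B j k))"
    by (simp add: 1(4) neg_transpose_def)
  moreover have "cocycle (\<lambda>j i. - ent A i j) (\<lambda>i k. - ent C k i) (\<lambda>k j. - ent B j k)
      (\<lambda>j i. - p i j) (\<lambda>i k. - r k i) (\<lambda>k j. - q j k)"
    unfolding cocycle_def
  proof (intro allI)
    fix j i k
    have "- (ent A i j * k + p i j + (ent B j k * i + q j k) + (ent C k i * j + r k i)) = 0"
      using 1(8) by (simp add: cocycle_def)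
    then show "- ent A i j * k + - p i j + (- ent C k i * j + - r k i) +
        (- ent B j k * i + - q j k) = 0"
      by (simp add: algebra_simps)
  qed
  moreover have "nonzero2 (\<lambda>j i. - ent A i j)" "nonzero2 (\<lambda>i k. - ent C k i)"
    "nonzero2 (\<lambda>k j. - ent B j k)"
    using 1(5-7) by (simp_all add: nonzero2_def signs_def)
  ultimately show ?thesis
    using 1(1-3) by (intro has_signsI)
qed


section \<open>The standard partition in coordinates\<close>

fun index :: "gf3 \<Rightarrow> nat" where "index G0 = 0" | "index G1 = 1" | "index G2 = 2"

definition num :: "point \<Rightarrow> nat" where
  "num P = 3 * index (fst P) + index (snd P) + 1"

definition block :: "gf3 \<Rightarrow> nat set" where
  "block i = {num (i, x) | x. True}"

lemma num_eq_iff [simp]: "num P = num Q \<longleftrightarrow> P = Q"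
proof -
  obtain i x j y where "P = (i, x)" "Q = (j, y)" by (cases P; cases Q)
  then show ?thesis by (cases i; cases x; cases j; cases y; simp add: num_def)
qed

lemma range_num: "range num = {1..9}"
proof (rule card_subset_eq)
  show "range num \<subseteq> {1..9}"
  proof clarify
    fix i x show "num (i, x) \<in> {1..9}" by (cases i; cases x; simp add: num_def)
  qed
  have "card (range num) = card (UNIV :: point set)"
    by (rule card_image) (simp add: inj_on_def)
  then show "card (range num) = card {1..9::nat}"
    by (simp add: card_UNIV_gf3 flip: UNIV_Times_UNIV)
qed simp

abbreviation cells :: "nat set" where "cells \<equiv> range num"

lemma ball_num: "(\<forall>z\<in>cells. Q z) \<longleftrightarrow> (\<forall>P. Q (num P))"
  by simp

lemma num_cases: "n \<in> cells \<Longrightarrow> (\<And>P. n = num P \<Longrightarrow> thesis) \<Longrightarrow> thesis"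
  by blast

lemma block_eq: "block G0 = {1..3}" "block G1 = {4..6}" "block G2 = {7..9}"
proof -
  have *: "block i = {num (i, G0), num (i, G1), num (i, G2)}" for i
  proof -
    have "block i = (\<lambda>x. num (i, x)) ` UNIV" by (auto simp: block_def)
    then show ?thesis by (simp add: UNIV_gf3)
  qed
  show "block G0 = {1..3}" "block G1 = {4..6}" "block G2 = {7..9}"
    unfolding * by (auto simp: num_def)
qed

lemma standard_partition_eq: "standard_partition 3 = range block"
proof -
  have "standard_partition 3 = (\<lambda>i. {(i - 1) * 3 + 1..i * 3}) ` {1..3}"
    by (auto simp only: standard_partition_def)
  also have "{1..3} = {1, 2, 3::nat}" by auto
  finally show ?thesis by (simp add: UNIV_gf3 block_eq)
qed

lemma num_in_block [simp]: "num P \<in> block i \<longleftrightarrow> fst P = i"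
  by (cases P) (auto simp: block_def)

lemma ball_block: "(\<forall>A\<in>standard_partition 3. Q A) \<longleftrightarrow> (\<forall>i. Q (block i))"
  by (simp add: standard_partition_eq)

lemma sudoku_partition_standard: "sudoku_partition 3 cells (standard_partition 3)"
proof -
  have inj: "inj block"
  proof (rule injI)
    fix i j assume "block i = block j"
    moreover have "num (i, 0) \<in> block i" by simp
    ultimately have "num (i, 0) \<in> block j" by simp
    then show "i = j" by simp
  qed
  have "partition_on cells (range block)"
    unfolding partition_on_def disjoint_def
  proof (intro conjI ballI impI)
    show "\<Union> (range block) = cells"
      by (auto simp: block_def)
    fix A B assume "A \<in> range block" "B \<in> range block" "A \<noteq> B"
    then show "A \<inter> B = {}" by (auto simp: block_def)
  next
    show "{} \<notin> range block" by (auto simp: block_def)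
  qed
  moreover have "card (range block) = 3"
    using card_image[OF inj] by (simp add: card_UNIV_gf3)
  moreover have "card (block i) = 3" for i
    by (cases i) (simp_all add: block_eq)
  ultimately show ?thesis
    using range_num by (auto simp: sudoku_partition_def standard_partition_eq)
qed


section \<open>Division sudokus and relations\<close>

definition rel_of :: "(nat \<times> nat \<Rightarrow> nat) \<Rightarrow> rel3" where
  "rel_of L = (\<lambda>P Q R. L (num P, num Q) = num R)"

text \<open>Rows and columns of a latin square are onto, hence bijective.\<close>

lemma image_eq_iff:
  assumes "\<And>Q. f (num Q) \<in> cells"
  shows "f ` cells = cells \<longleftrightarrow> (\<forall>R. \<exists>!Q. f (num Q) = num R)"
proof
  assume im: "f ` cells = cells"
  then have inj: "inj_on f cells"
    by (intro eq_card_imp_inj_on) simp_all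
  show "\<forall>R. \<exists>!Q. f (num Q) = num R"
  proof
    fix R
    have "num R \<in> f ` cells" using im by simp
    then obtain Q where Q: "f (num Q) = num R"
      by auto
    moreover have "Q' = Q" if "f (num Q') = num R" for Q'
      using inj_onD[OF inj, of "num Q'" "num Q"] that Q by simp
    ultimately show "\<exists>!Q. f (num Q) = num R" by blast
  qed
next
  assume ex: "\<forall>R. \<exists>!Q. f (num Q) = num R"
  show "f ` cells = cells"
  proof
    show "f ` cells \<subseteq> cells"
      using assms by (metis image_subsetI num_cases)
    show "cells \<subseteq> f ` cells"
    proof
      fix n :: nat assume "n \<in> cells"
      then obtain R where "n = num R" by (rule num_cases)
      then obtain Q where "f (num Q) = n" using ex by metis
      then show "n \<in> f ` cells" by blast
    qed
  qed
qed

lemma mem_orth_array: "(num P, num Q, num R) \<in> orth_array cells L \<longleftrightarrow> rel_of L P Q R"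
  by (auto simp: orth_array_def rel_of_def)

lemma orth_array_num:
  assumes "L \<in> cells \<times> cells \<rightarrow>\<^sub>E cells"
  shows "orth_array cells L = {(num P, num Q, num R) | P Q R. rel_of L P Q R}"
proof
  show "orth_array cells L \<subseteq> {(num P, num Q, num R) | P Q R. rel_of L P Q R}"
  proof
    fix t assume "t \<in> orth_array cells L"
    then obtain P Q where t: "t = (num P, num Q, L (num P, num Q))"
      by (auto simp: orth_array_def)
    have "L (num P, num Q) \<in> cells" using PiE_mem[OF assms] by simp
    then obtain R where "L (num P, num Q) = num R" by (rule num_cases)
    then have "t = (num P, num Q, num R) \<and> rel_of L P Q R" by (simp add: t rel_of_def)
    then show "t \<in> {(num P, num Q, num R) | P Q R. rel_of L P Q R}" by blast
  qed
  show "{(num P, num Q, num R) | P Q R. rel_of L P Q R} \<subseteq> orth_array cells L"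
    by (auto simp: orth_array_def rel_of_def)
qed

lemma division_sudoku_iff:
  "division_sudoku 3 cells (standard_partition 3) L \<longleftrightarrow>
     L \<in> cells \<times> cells \<rightarrow>\<^sub>E cells \<and> ds_relation (rel_of L)"
proof (cases "L \<in> cells \<times> cells \<rightarrow>\<^sub>E cells")
  case True
  have val: "L (num P, num Q) \<in> cells" for P Q
    using PiE_mem[OF True] by simp
  have functional: "\<forall>P Q. \<exists>!R. rel_of L P Q R"
  proof (intro allI)
    fix P Q
    show "\<exists>!R. rel_of L P Q R"
      using val[of P Q] unfolding rel_of_def by (elim num_cases) auto
  qed
  have latin: "latin_square cells L \<longleftrightarrow>
      (\<forall>P R. \<exists>!Q. rel_of L P Q R) \<and> (\<forall>Q R. \<exists>!P. rel_of L P Q R)"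
    using True val
    by (simp add: latin_square_def ball_num image_eq_iff rel_of_def)
  have box: "(\<exists>n m. (n, m, num R) \<in> band cells L (block i) \<inter> stack cells L (block j)) \<longleftrightarrow>
      (\<exists>x y. rel_of L (i, x) (j, y) R)"
    "(\<exists>n l. (n, num Q, l) \<in> band cells L (block i) \<inter> pile cells L (block k)) \<longleftrightarrow>
      (\<exists>x z. rel_of L (i, x) Q (k, z))"
    "(\<exists>m l. (num P, m, l) \<in> stack cells L (block j) \<inter> pile cells L (block k)) \<longleftrightarrow>
      (\<exists>y z. rel_of L P (j, y) (k, z))" for i j k P Q R
    unfolding mem_orth_array[symmetric] band_def stack_def pile_def block_def by auto
  have "division_sudoku 3 cells (standard_partition 3) L \<longleftrightarrow>
      (\<forall>P R. \<exists>!Q. rel_of L P Q R) \<and> (\<forall>Q R. \<exists>!P. rel_of L P Q R) \<and>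
      (\<forall>i j. (\<forall>R. \<exists>x y. rel_of L (i, x) (j, y) R) \<and> (\<forall>Q. \<exists>x z. rel_of L (i, x) Q (j, z)) \<and>
        (\<forall>P. \<exists>y z. rel_of L P (i, y) (j, z)))"
    unfolding division_sudoku_def ball_block ball_num box latin
    using sudoku_partition_standard by simp
  also have "\<dots> \<longleftrightarrow> ds_relation (rel_of L)"
  proof
    assume r: "(\<forall>P R. \<exists>!Q. rel_of L P Q R) \<and> (\<forall>Q R. \<exists>!P. rel_of L P Q R) \<and>
      (\<forall>i j. (\<forall>R. \<exists>x y. rel_of L (i, x) (j, y) R) \<and> (\<forall>Q. \<exists>x z. rel_of L (i, x) Q (j, z)) \<and>
        (\<forall>P. \<exists>y z. rel_of L P (i, y) (j, z)))"
    note unique = functional[rule_format] r[THEN conjunct1, rule_format]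
      r[THEN conjunct2, THEN conjunct1, rule_format]
    note box = r[THEN conjunct2, THEN conjunct2, rule_format]
    note box12 = box[THEN conjunct1, rule_format]
      and box23 = box[THEN conjunct2, THEN conjunct2, rule_format]
    have box31: "\<exists>z x. rel_of L (i, x) Y (k, z)" for k i Y
      using box[THEN conjunct2, THEN conjunct1, rule_format, of i Y k] by blast
    show "ds_relation (rel_of L)"
      unfolding ds_relation_def by (intro conjI allI unique box12 box23 box31)
  next
    assume "ds_relation (rel_of L)"
    note d = ds_relationD[OF this]
    have box: "\<exists>x z. rel_of L (i, x) Y (k, z)" for i Y k using d(6)[of i Y k] by blast
    then show "(\<forall>P R. \<exists>!Q. rel_of L P Q R) \<and> (\<forall>Q R. \<exists>!P. rel_of L P Q R) \<and>
      (\<forall>i j. (\<forall>R. \<exists>x y. rel_of L (i, x) (j, y) R) \<and> (\<forall>Q. \<exists>x z. rel_of L (i, x) Q (j, z)) \<and>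
        (\<forall>P. \<exists>y z. rel_of L P (i, y) (j, z)))"
      by (intro conjI allI d box)
  qed
  finally show ?thesis using True by simp
next
  case False
  then show ?thesis by (simp add: division_sudoku_def latin_square_def)
qed

abbreviation (input) "sudokus \<equiv> standard_division_sudokus 3"

lemma mem_sudokus: "L \<in> sudokus \<longleftrightarrow> L \<in> cells \<times> cells \<rightarrow>\<^sub>E cells \<and> ds_relation (rel_of L)"
proof -
  have "{1..3\<^sup>2} = cells" by (simp add: range_num)
  then show ?thesis
    unfolding standard_division_sudokus_def using division_sudoku_iff by simp
qed

lemma bij_betw_rel_of: "bij_betw rel_of sudokus {O'. ds_relation O'}"
  unfolding bij_betw_def
proof
  show "inj_on rel_of sudokus"
  proof (rule inj_onI)
    fix L L' assume L: "L \<in> sudokus" "L' \<in> sudokus" "rel_of L = rel_of L'"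
    note E = L(1,2)[unfolded mem_sudokus, THEN conjunct1]
    show "L = L'"
    proof (rule PiE_ext[OF E])
      fix t :: "nat \<times> nat" assume "t \<in> cells \<times> cells"
      then obtain n m where t: "t = (n, m)" "n \<in> cells" "m \<in> cells" by blast
      obtain P where P: "n = num P" using t(2) by (rule num_cases)
      obtain Q where Q: "m = num Q" using t(3) by (rule num_cases)
      have "L t \<in> cells" by (rule PiE_mem[OF E(1)]) (simp add: t P Q)
      then obtain R where R: "L t = num R" by (rule num_cases)
      then have "rel_of L P Q R" by (simp add: rel_of_def t P Q)
      then show "L t = L' t" by (simp add: L(3) R) (simp add: rel_of_def t P Q)
    qed
  qed
  show "rel_of ` sudokus = {O'. ds_relation O'}"
  proof
    show "rel_of ` sudokus \<subseteq> {O'. ds_relation O'}" by (auto simp: mem_sudokus)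
    show "{O'. ds_relation O'} \<subseteq> rel_of ` sudokus"
    proof
      fix O' assume "O' \<in> {O'. ds_relation O'}"
      then have O': "ds_relation O'" by simp
      define f where "f P Q = (THE R. O' P Q R)" for P Q
      have f: "O' P Q R \<longleftrightarrow> f P Q = R" for P Q R
        unfolding f_def using ds_relationD(1)[OF O', of P Q] theI'[of "O' P Q"]
        by (metis (full_types))
      define pt where "pt = inv num"
      have pt: "pt (num P) = P" for P
        unfolding pt_def by (rule inv_f_f) (simp add: inj_on_def)
      define L where "L = restrict (\<lambda>(n, m). num (f (pt n) (pt m))) (cells \<times> cells)"
      have L: "L (num P, num Q) = num (f P Q)" for P Q
        by (simp add: L_def pt)
      have "rel_of L = O'"
        by (simp add: fun_eq_iff rel_of_def L f)
      moreover have "L \<in> cells \<times> cells \<rightarrow>\<^sub>E cells"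
        unfolding L_def restrict_PiE_iff by auto
      ultimately have "L \<in> sudokus" "rel_of L = O'" using O' by (simp_all add: mem_sudokus)
      then show "O' \<in> rel_of ` sudokus" by blast
    qed
  qed
qed

lemma block_permutation_imp_blockmap:
  assumes "\<pi> permutes cells" "maps_blocks (standard_partition 3) \<pi>"
  shows "\<exists>\<alpha>. blockmap \<alpha> \<and> (\<forall>P. \<pi> (num P) = num (\<alpha> P))"
proof -
  have inj: "\<pi> n = \<pi> n' \<longleftrightarrow> n = n'" for n n'
    using permutes_inj[OF assms(1)] by (simp add: inj_eq)
  have "\<exists>i'. \<pi> ` block i = block i'" for i
    using assms(2) unfolding maps_blocks_def standard_partition_eq by blast
  then obtain \<sigma> where \<sigma>: "\<And>i. \<pi> ` block i = block (\<sigma> i)" by metis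
  have "\<exists>y. \<pi> (num (i, x)) = num (\<sigma> i, y)" for i x
  proof -
    have "\<pi> (num (i, x)) \<in> block (\<sigma> i)"
      unfolding \<sigma>[symmetric] by (rule imageI) simp
    then show ?thesis by (auto simp: block_def)
  qed
  then obtain f where f: "\<And>i x. \<pi> (num (i, x)) = num (\<sigma> i, f i x)" by metis
  have "inj \<sigma>"
  proof (rule injI)
    fix i i' assume "\<sigma> i = \<sigma> i'"
    then have "\<pi> ` block i = \<pi> ` block i'" by (simp add: \<sigma>)
    moreover have "\<pi> (num (i, 0)) \<in> \<pi> ` block i" by (rule imageI) simp
    ultimately obtain x where "\<pi> (num (i, 0)) = \<pi> (num (i', x))" by (auto simp: block_def)
    then show "i = i'" by (simp add: inj)
  qed
  then obtain g h where g: "g \<noteq> 0" "\<And>i. \<sigma> i = g * i + h" using injective_affine by metis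
  have "inj (f i)" for i
  proof (rule injI)
    fix x x' assume "f i x = f i x'"
    then have "\<pi> (num (i, x)) = \<pi> (num (i, x'))" by (simp add: f)
    then show "x = x'" by (simp add: inj)
  qed
  then have "\<forall>i. \<exists>m n. m \<noteq> 0 \<and> (\<forall>x. f i x = m * x + n)" using injective_affine by blast
  then obtain m n where m: "\<And>i. m i \<noteq> 0" "\<And>i x. f i x = m i * x + n i" by metis
  have "blockmap (\<lambda>(i, x). (g * i + h, m i * x + n i))"
    using g(1) m(1) by (intro blockmapI) (simp_all add: nonzero1_def)
  moreover have "\<pi> (num P) = num ((\<lambda>(i, x). (g * i + h, m i * x + n i)) P)" for P
    by (cases P) (simp add: f g(2) m(2))
  ultimately show ?thesis by blast
qed

lemma blockmap_imp_block_permutation: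
  assumes "blockmap \<alpha>"
  shows "\<exists>\<pi>. \<pi> permutes cells \<and> maps_blocks (standard_partition 3) \<pi> \<and> (\<forall>P. \<pi> (num P) = num (\<alpha> P))"
proof -
  obtain g h m n where a: "g \<noteq> 0" "nonzero1 m" "\<alpha> = (\<lambda>(i, x). (g * i + h, m i * x + n i))"
    using assms unfolding blockmap_def by blast
  have "inj \<alpha>"
  proof (rule injI)
    fix P Q assume eq: "\<alpha> P = \<alpha> Q"
    obtain i x j y where PQ: "P = (i, x)" "Q = (j, y)" by (cases P; cases Q)
    have "i = j" using eq a(1) by (simp add: a(3) PQ mult_cancel_gf3)
    then show "P = Q" using eq a(2) by (simp add: a(3) PQ mult_cancel_gf3 nonzero1_def)
  qed
  then have bij: "bij \<alpha>" using finite_UNIV_inj_surj[of \<alpha>] by (simp add: bij_def)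
  define pt where "pt = inv num"
  have pt: "pt (num P) = P" for P
    unfolding pt_def by (rule inv_f_f) (simp add: inj_on_def)
  define \<pi> where "\<pi> k = (if k \<in> cells then num (\<alpha> (pt k)) else k)" for k
  have \<pi>: "\<pi> (num P) = num (\<alpha> P)" for P
    by (simp add: \<pi>_def pt)
  have "bij_betw \<pi> cells cells"
    unfolding bij_betw_def
  proof
    show "inj_on \<pi> (cells)"
      using \<open>inj \<alpha>\<close> by (auto simp: inj_on_def \<pi>)
    have "\<pi> ` cells = num ` range \<alpha>"
      by (simp add: image_image \<pi>)
    then show "\<pi> ` cells = cells"
      using bij_is_surj[OF bij] by simp
  qed
  then have "\<pi> permutes cells"
    by (rule bij_imp_permutes) (simp add: \<pi>_def)
  moreover have "maps_blocks (standard_partition 3) \<pi>"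
    unfolding maps_blocks_def ball_block
  proof
    fix i
    have "\<pi> ` block i = block (g * i + h)"
    proof
      show "\<pi> ` block i \<subseteq> block (g * i + h)" by (auto simp: block_def \<pi> a(3))
      show "block (g * i + h) \<subseteq> \<pi> ` block i"
      proof
        fix k assume "k \<in> block (g * i + h)"
        then obtain y where k: "k = num (g * i + h, y)" by (auto simp: block_def)
        have "k = \<pi> (num (i, m i * (y - n i)))"
          using a(2) by (simp add: k \<pi> a(3) nonzero1_def square_gf3)
        then show "k \<in> \<pi> ` block i" by (intro image_eqI[of _ _ "num (i, m i * (y - n i))"]) simp_all
      qed
    qed
    then show "\<pi> ` block i \<in> standard_partition 3" by (simp add: standard_partition_eq)
  qed
  ultimately show ?thesis using \<pi> by blast
qed

lemma ds_isotopic_iff: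
  assumes "L\<^sub>1 \<in> sudokus" "L\<^sub>2 \<in> sudokus"
  shows "ds_isotopic cells (standard_partition 3) L\<^sub>1 L\<^sub>2 \<longleftrightarrow> iso_rel (rel_of L\<^sub>1) (rel_of L\<^sub>2)"
proof
  assume "ds_isotopic cells (standard_partition 3) L\<^sub>1 L\<^sub>2"
  then obtain a b c where p: "a permutes cells" "b permutes cells" "c permutes cells"
    "maps_blocks (standard_partition 3) a" "maps_blocks (standard_partition 3) b"
    "maps_blocks (standard_partition 3) c"
    and eq: "\<forall>x\<in>cells. \<forall>y\<in>cells. L\<^sub>2 (a x, b y) = c (L\<^sub>1 (x, y))"
    unfolding ds_isotopic_def isotopism_def by blast
  obtain \<alpha> where \<alpha>: "blockmap \<alpha>" "\<And>P. a (num P) = num (\<alpha> P)"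
    using block_permutation_imp_blockmap[OF p(1,4)] by blast
  obtain \<beta> where \<beta>: "blockmap \<beta>" "\<And>P. b (num P) = num (\<beta> P)"
    using block_permutation_imp_blockmap[OF p(2,5)] by blast
  obtain \<gamma> where \<gamma>: "blockmap \<gamma>" "\<And>P. c (num P) = num (\<gamma> P)"
    using block_permutation_imp_blockmap[OF p(3,6)] by blast
  have "L\<^sub>2 (num (\<alpha> P), num (\<beta> Q)) = c (L\<^sub>1 (num P, num Q))" for P Q
    using eq[unfolded ball_num, rule_format, of P Q] by (simp add: \<alpha>(2) \<beta>(2))
  moreover have "c n = c m \<longleftrightarrow> n = m" for n m
    using permutes_inj[OF p(3)] by (simp add: inj_eq)
  ultimately have "rel_of L\<^sub>1 = (\<lambda>P Q R. rel_of L\<^sub>2 (\<alpha> P) (\<beta> Q) (\<gamma> R))"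
    by (simp add: rel_of_def fun_eq_iff \<gamma>(2)[symmetric])
  then show "iso_rel (rel_of L\<^sub>1) (rel_of L\<^sub>2)"
    unfolding iso_rel_def using \<alpha>(1) \<beta>(1) \<gamma>(1) by blast
next
  assume "iso_rel (rel_of L\<^sub>1) (rel_of L\<^sub>2)"
  then obtain \<alpha> \<beta> \<gamma> where m: "blockmap \<alpha>" "blockmap \<beta>" "blockmap \<gamma>"
    and eq: "rel_of L\<^sub>1 = (\<lambda>P Q R. rel_of L\<^sub>2 (\<alpha> P) (\<beta> Q) (\<gamma> R))"
    unfolding iso_rel_def by blast
  obtain a where a: "a permutes cells" "maps_blocks (standard_partition 3) a"
    "\<And>P. a (num P) = num (\<alpha> P)"
    using blockmap_imp_block_permutation[OF m(1)] by blast
  obtain b where b: "b permutes cells" "maps_blocks (standard_partition 3) b"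
    "\<And>P. b (num P) = num (\<beta> P)"
    using blockmap_imp_block_permutation[OF m(2)] by blast
  obtain c where c: "c permutes cells" "maps_blocks (standard_partition 3) c"
    "\<And>P. c (num P) = num (\<gamma> P)"
    using blockmap_imp_block_permutation[OF m(3)] by blast
  have "L\<^sub>2 (a (num P), b (num Q)) = c (L\<^sub>1 (num P, num Q))" for P Q
  proof -
    have "L\<^sub>1 (num P, num Q) \<in> cells"
      by (rule PiE_mem[OF assms(1)[unfolded mem_sudokus, THEN conjunct1]])
        simp
    then obtain R where R: "L\<^sub>1 (num P, num Q) = num R" by (rule num_cases)
    then have "rel_of L\<^sub>1 P Q R" by (simp add: rel_of_def)
    then have "rel_of L\<^sub>2 (\<alpha> P) (\<beta> Q) (\<gamma> R)" by (simp add: eq)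
    then show ?thesis by (simp add: rel_of_def a b c R)
  qed
  then have "isotopism cells L\<^sub>1 L\<^sub>2 a b c"
    unfolding isotopism_def ball_num using a b c by blast
  then show "ds_isotopic cells (standard_partition 3) L\<^sub>1 L\<^sub>2"
    unfolding ds_isotopic_def using a b c by blast
qed


section \<open>Conjugates\<close>

definition triples_of :: "rel3 \<Rightarrow> (nat \<times> nat \<times> nat) set" where
  "triples_of O' = {(num P, num Q, num R) | P Q R. O' P Q R}"

lemma orth_array_sudoku: "L \<in> sudokus \<Longrightarrow> orth_array cells L = triples_of (rel_of L)"
  unfolding triples_of_def mem_sudokus using orth_array_num by blast

lemma latin_square_sudoku: "L \<in> sudokus \<Longrightarrow> latin_square cells L"
  using division_sudoku_iff[of L] by (simp add: mem_sudokus division_sudoku_def)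

lemma orth_array_inject:
  assumes "latin_square X L" "latin_square X L'" "orth_array X L = orth_array X L'"
  shows "L = L'"
proof -
  have E: "L \<in> X \<times> X \<rightarrow>\<^sub>E X" "L' \<in> X \<times> X \<rightarrow>\<^sub>E X"
    using assms by (simp_all add: latin_square_def)
  show ?thesis
  proof (rule PiE_ext[OF E])
    fix t assume "t \<in> X \<times> X"
    then obtain x y where t: "t = (x, y)" "x \<in> X" "y \<in> X" by blast
    then have "(x, y, L (x, y)) \<in> orth_array X L'"
      unfolding assms(3)[symmetric] by (auto simp: orth_array_def)
    then show "L t = L' t" by (auto simp: orth_array_def t)
  qed
qed

text \<open>A conjugation on the levels of relations, sign data and triples.  The condition is preserved by
  composition, so that only a rotation and one exchange of coordinates have to be examined.\<close>

definition conjugation ::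
  "(rel3 \<Rightarrow> rel3) \<Rightarrow> (mat tri \<Rightarrow> mat tri) \<Rightarrow> (nat \<times> nat \<times> nat \<Rightarrow> nat \<times> nat \<times> nat) \<Rightarrow> bool" where
  "conjugation f c g \<longleftrightarrow> (\<forall>O' t. has_signs O' t \<longrightarrow> has_signs (f O') (c t)) \<and>
     (\<forall>O'. triples_of (f O') = g ` triples_of O')"

lemma conjugation_comp:
  "conjugation f c g \<Longrightarrow> conjugation f' c' g' \<Longrightarrow> conjugation (f \<circ> f') (c \<circ> c') (g \<circ> g')"
  by (simp add: conjugation_def image_comp)

lemma conjugation_id: "conjugation id id id"
  by (simp add: conjugation_def)

lemma conjugation_rotate: "conjugation rotate_rel rot (\<lambda>(x, y, z). (y, z, x))"
  unfolding conjugation_def triples_of_def rotate_rel_def[of O' for O']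
  using has_signs_rotate by (force simp: rotate_rel_def)

lemma conjugation_swap12: "conjugation swap12 flip (\<lambda>(x, y, z). (y, x, z))"
  unfolding conjugation_def triples_of_def
  using has_signs_swap12 by (force simp: swap12_def)

definition permute_coords :: "(nat \<Rightarrow> nat) \<Rightarrow> nat \<times> nat \<times> nat \<Rightarrow> nat \<times> nat \<times> nat" where
  "permute_coords \<theta> t = (coord t (\<theta> 1), coord t (\<theta> 2), coord t (\<theta> 3))"

text \<open>The conjugate is given by a description.  The described square exists because the permuted
  relation is again that of a division sudoku.\<close>

lemma has_signs_conjugate:
  assumes "conjugation f c (permute_coords \<theta>)" "L \<in> sudokus" "has_signs (rel_of L) t"
  shows "conjugate cells \<theta> L \<in> sudokus \<and> has_signs (rel_of (conjugate cells \<theta> L)) (c t)"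
proof -
  have signs: "has_signs (f (rel_of L)) (c t)"
    using assms by (simp add: conjugation_def)
  then have "f (rel_of L) \<in> rel_of ` sudokus"
    using bij_betw_rel_of has_signs_ds_relation by (auto simp: bij_betw_def)
  then obtain L' where L': "L' \<in> sudokus" "rel_of L' = f (rel_of L)" by auto
  have orth: "orth_array cells L' = permute_coords \<theta> ` orth_array cells L"
    using assms(1,2) L' by (simp add: orth_array_sudoku conjugation_def)
  have "conjugate cells \<theta> L = L'"
    unfolding conjugate_def permute_coords_def[symmetric]
  proof (rule the_equality)
    show "latin_square cells L' \<and> orth_array cells L' = permute_coords \<theta> ` orth_array cells L"
      using latin_square_sudoku[OF L'(1)] orth by simp
    show "M = L'" if "latin_square cells M \<and>
        orth_array cells M = permute_coords \<theta> ` orth_array cells L" for M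
      using orth_array_inject[of cells M L'] latin_square_sudoku[OF L'(1)] orth that by simp
  qed
  then show ?thesis using L' signs by simp
qed

lemma conjugations:
  "conjugation id id (\<lambda>(x, y, z). (x, y, z))"
  "conjugation rotate_rel rot (\<lambda>(x, y, z). (y, z, x))"
  "conjugation (rotate_rel \<circ> rotate_rel) (rot \<circ> rot) (\<lambda>(x, y, z). (z, x, y))"
  "conjugation swap12 flip (\<lambda>(x, y, z). (y, x, z))"
  "conjugation (swap12 \<circ> rotate_rel) (flip \<circ> rot) (\<lambda>(x, y, z). (z, y, x))"
  "conjugation (swap12 \<circ> (rotate_rel \<circ> rotate_rel)) (flip \<circ> (rot \<circ> rot)) (\<lambda>(x, y, z). (x, z, y))"
proof -
  note r = conjugation_rotate and s = conjugation_swap12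
  show "conjugation id id (\<lambda>(x, y, z). (x, y, z))"
    using conjugation_id by (simp add: id_def case_prod_beta)
  show "conjugation rotate_rel rot (\<lambda>(x, y, z). (y, z, x))" by (rule r)
  show "conjugation swap12 flip (\<lambda>(x, y, z). (y, x, z))" by (rule s)
  have compose: "(\<lambda>(x, y, z). (y, z, x)) \<circ> (\<lambda>(x, y, z). (y, z, x)) = (\<lambda>(x, y, z). (z, x, y))"
    "(\<lambda>(x, y, z). (y, x, z)) \<circ> (\<lambda>(x, y, z). (y, z, x)) = (\<lambda>(x, y, z). (z, y, x))"
    "(\<lambda>(x, y, z). (y, x, z)) \<circ> (\<lambda>(x, y, z). (z, x, y)) = (\<lambda>(x, y, z). (x, z, y))"
    by (simp_all add: fun_eq_iff)
  show rr: "conjugation (rotate_rel \<circ> rotate_rel) (rot \<circ> rot) (\<lambda>(x, y, z). (z, x, y))"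
    using conjugation_comp[OF r r] unfolding compose .
  show "conjugation (swap12 \<circ> rotate_rel) (flip \<circ> rot) (\<lambda>(x, y, z). (z, y, x))"
    using conjugation_comp[OF s r] unfolding compose .
  show "conjugation (swap12 \<circ> (rotate_rel \<circ> rotate_rel)) (flip \<circ> (rot \<circ> rot)) (\<lambda>(x, y, z). (x, z, y))"
    using conjugation_comp[OF s rr] unfolding compose .
qed

lemma permutation_imp_conjugation:
  assumes "\<theta> permutes {1, 2, 3}"
  shows "\<exists>c\<in>conjs. \<exists>f. conjugation f c (permute_coords \<theta>)"
proof -
  have mem: "\<theta> 1 \<in> {1, 2, 3}" "\<theta> 2 \<in> {1, 2, 3}" "\<theta> 3 \<in> {1, 2, 3}"
    using permutes_in_image[OF assms] by blast+
  have ne: "\<theta> 1 \<noteq> \<theta> 2" "\<theta> 1 \<noteq> \<theta> 3" "\<theta> 2 \<noteq> \<theta> 3"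
    using permutes_inj[OF assms] by (simp_all add: inj_eq)
  consider "\<theta> 1 = 1" "\<theta> 2 = 2" "\<theta> 3 = 3" | "\<theta> 1 = 2" "\<theta> 2 = 3" "\<theta> 3 = 1"
    | "\<theta> 1 = 3" "\<theta> 2 = 1" "\<theta> 3 = 2" | "\<theta> 1 = 2" "\<theta> 2 = 1" "\<theta> 3 = 3"
    | "\<theta> 1 = 3" "\<theta> 2 = 2" "\<theta> 3 = 1" | "\<theta> 1 = 1" "\<theta> 2 = 3" "\<theta> 3 = 2"
    using mem ne by auto
  then show ?thesis
  proof cases
    case 1
    then have "permute_coords \<theta> = (\<lambda>(x, y, z). (x, y, z))"
      by (auto simp: fun_eq_iff permute_coords_def coord_def)
    then show ?thesis using conjugations(1) by (auto simp: conjs_def)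
  next
    case 2
    then have "permute_coords \<theta> = (\<lambda>(x, y, z). (y, z, x))"
      by (auto simp: fun_eq_iff permute_coords_def coord_def)
    then show ?thesis using conjugations(2) by (auto simp: conjs_def)
  next
    case 3
    then have "permute_coords \<theta> = (\<lambda>(x, y, z). (z, x, y))"
      by (auto simp: fun_eq_iff permute_coords_def coord_def)
    then show ?thesis using conjugations(3) by (auto simp: conjs_def)
  next
    case 4
    then have "permute_coords \<theta> = (\<lambda>(x, y, z). (y, x, z))"
      by (auto simp: fun_eq_iff permute_coords_def coord_def)
    then show ?thesis using conjugations(4) by (auto simp: conjs_def)
  next
    case 5
    then have "permute_coords \<theta> = (\<lambda>(x, y, z). (z, y, x))"
      by (auto simp: fun_eq_iff permute_coords_def coord_def)
    then show ?thesis using conjugations(5) by (auto simp: conjs_def)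
  next
    case 6
    then have "permute_coords \<theta> = (\<lambda>(x, y, z). (x, z, y))"
      by (auto simp: fun_eq_iff permute_coords_def coord_def)
    then show ?thesis using conjugations(6) by (auto simp: conjs_def)
  qed
qed

lemma conjugation_imp_permutation:
  assumes "c \<in> conjs"
  shows "\<exists>\<theta>. \<theta> permutes {1, 2, 3} \<and> (\<exists>f. conjugation f c (permute_coords \<theta>))"
proof -
  define \<theta> :: "nat \<Rightarrow> nat \<Rightarrow> nat \<Rightarrow> nat \<Rightarrow> nat" where
    "\<theta> a b d = (\<lambda>n. if n = 1 then a else if n = 2 then b else if n = 3 then d else n)" for a b d
  have coords: "permute_coords (\<theta> a b d) = (\<lambda>t. (coord t a, coord t b, coord t d))" for a b d
    by (simp add: permute_coords_def \<theta>_def fun_eq_iff)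
  have perm: "\<theta> a b d permutes {1, 2, 3}" if "{a, b, d} = {1, 2, 3}" for a b d
  proof (rule bij_imp_permutes)
    have "\<theta> a b d ` {1, 2, 3} = {a, b, d}"
      by (auto simp: \<theta>_def)
    then have "\<theta> a b d ` {1, 2, 3} = {1, 2, 3}"
      using that by simp
    then show "bij_betw (\<theta> a b d) {1, 2, 3} {1, 2, 3}"
      unfolding bij_betw_def using eq_card_imp_inj_on[of "{1, 2, 3}" "\<theta> a b d"] by simp
    show "\<theta> a b d x = x" if "x \<notin> {1, 2, 3}" for x
      using that by (simp add: \<theta>_def)
  qed
  have sets: "{2, 3, 1} = {1, 2, 3::nat}" "{3, 1, 2} = {1, 2, 3::nat}" "{2, 1, 3} = {1, 2, 3::nat}"
    "{3, 2, 1} = {1, 2, 3::nat}" "{1, 3, 2} = {1, 2, 3::nat}"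
    by auto
  have eqs: "permute_coords (\<theta> 1 2 3) = (\<lambda>(x, y, z). (x, y, z))"
    "permute_coords (\<theta> 2 3 1) = (\<lambda>(x, y, z). (y, z, x))"
    "permute_coords (\<theta> 3 1 2) = (\<lambda>(x, y, z). (z, x, y))"
    "permute_coords (\<theta> 2 1 3) = (\<lambda>(x, y, z). (y, x, z))"
    "permute_coords (\<theta> 3 2 1) = (\<lambda>(x, y, z). (z, y, x))"
    "permute_coords (\<theta> 1 3 2) = (\<lambda>(x, y, z). (x, z, y))"
    unfolding coords by (auto simp: fun_eq_iff coord_def)
  note p = perm[OF refl] perm[OF sets(1)] perm[OF sets(2)] perm[OF sets(3)] perm[OF sets(4)]
    perm[OF sets(5)]
  note c = conjugations[folded eqs]
  show ?thesis
    using assms p c unfolding conjs_def by (elim insertE emptyE) blast+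
qed

lemma ds_paratopic_iff:
  assumes L: "L\<^sub>1 \<in> sudokus" "L\<^sub>2 \<in> sudokus"
    and t: "has_signs (rel_of L\<^sub>1) t\<^sub>1" "has_signs (rel_of L\<^sub>2) t\<^sub>2"
  shows "ds_paratopic cells (standard_partition 3) L\<^sub>1 L\<^sub>2 \<longleftrightarrow> paratopic t\<^sub>1 t\<^sub>2"
proof
  have iso: "paratopic t t'" if H: "M \<in> sudokus" "M' \<in> sudokus" "has_signs (rel_of M) t"
    "has_signs (rel_of M') t'" "\<theta> permutes {1, 2, 3}"
    "ds_isotopic cells (standard_partition 3) M (conjugate cells \<theta> M')" for M M' t t' \<theta>
  proof -
    obtain c f where c: "c \<in> conjs" "conjugation f c (permute_coords \<theta>)"
      using permutation_imp_conjugation[OF H(5)] by blast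
    note h = has_signs_conjugate[OF c(2) H(2,4)]
    have "iso_rel (rel_of M) (rel_of (conjugate cells \<theta> M'))"
      using ds_isotopic_iff[OF H(1) conjunct1[OF h]] H(6) by blast
    then show ?thesis
      using iso_rel_iff[OF H(3) conjunct2[OF h]] c(1) by (auto simp: paratopic_iff_isotopic)
  qed
  assume "ds_paratopic cells (standard_partition 3) L\<^sub>1 L\<^sub>2"
  then show "paratopic t\<^sub>1 t\<^sub>2"
    unfolding ds_paratopic_def using iso L t paratopic_sym by metis
next
  assume "paratopic t\<^sub>1 t\<^sub>2"
  then obtain c where c: "c \<in> conjs" "isotopic t\<^sub>1 (c t\<^sub>2)"
    by (auto simp: paratopic_iff_isotopic)
  obtain \<theta> f where th: "\<theta> permutes {1, 2, 3}" "conjugation f c (permute_coords \<theta>)"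
    using conjugation_imp_permutation[OF c(1)] by blast
  note h = has_signs_conjugate[OF th(2) L(2) t(2)]
  have "iso_rel (rel_of L\<^sub>1) (rel_of (conjugate cells \<theta> L\<^sub>2))"
    using iso_rel_iff[OF t(1) conjunct2[OF h]] c(2) by blast
  then have "ds_isotopic cells (standard_partition 3) L\<^sub>1 (conjugate cells \<theta> L\<^sub>2)"
    using ds_isotopic_iff[OF L(1) conjunct1[OF h]] by blast
  then show "ds_paratopic cells (standard_partition 3) L\<^sub>1 L\<^sub>2"
    unfolding ds_paratopic_def using th(1) by blast
qed


section \<open>Counting orbits by their least elements\<close>

lemma card_quotient_least:
  fixes T :: "'a::linorder set"
  assumes T: "finite T" "equiv T E"
  shows "card (T // E) = card {t \<in> T. \<forall>t'. (t, t') \<in> E \<longrightarrow> t \<le> t'}" (is "_ = card ?M")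
proof -
  have sub: "E `` {t} \<subseteq> T" for t
    using T(2) by (auto simp: equiv_def refl_on_def)
  have "bij_betw (\<lambda>t. E `` {t}) ?M (T // E)"
    unfolding bij_betw_def
  proof
    show "inj_on (\<lambda>t. E `` {t}) ?M"
    proof (rule inj_onI)
      fix t t' assume t: "t \<in> ?M" "t' \<in> ?M" "E `` {t} = E `` {t'}"
      then have "(t, t') \<in> E" "(t', t) \<in> E"
        using eq_equiv_class_iff[OF T(2)] by (metis (no_types, lifting) mem_Collect_eq)+
      then show "t = t'" using t by (auto intro: antisym)
    qed
    show "(\<lambda>t. E `` {t}) ` ?M = T // E"
    proof
      show "(\<lambda>t. E `` {t}) ` ?M \<subseteq> T // E" by (auto simp: quotient_def)
      show "T // E \<subseteq> (\<lambda>t. E `` {t}) ` ?M"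
      proof
        fix C assume C: "C \<in> T // E"
        then obtain s where s: "s \<in> T" "C = E `` {s}" by (auto simp: quotient_def)
        have fin: "finite C" "C \<noteq> {}"
          using s sub T finite_subset equiv_class_self by fast+
        define m where "m = Min C"
        have m: "m \<in> C" unfolding m_def by (rule Min_in[OF fin])
        then have C_eq: "C = E `` {m}"
          using s equiv_class_eq[OF T(2)] by blast
        moreover have "m \<in> T"
          using m s(2) sub by blast
        moreover have "m \<le> t'" if "(m, t') \<in> E" for t'
          unfolding m_def using that C_eq by (intro Min_le[OF fin(1)]) blast
        ultimately show "C \<in> (\<lambda>t. E `` {t}) ` ?M" by blast
      qed
    qed
  qed
  then show ?thesis by (simp add: bij_betw_same_card)
qed


section \<open>Lazy comparison of a triple with its images\<close>

text \<open>A comparison \<open>t \<le> act q t'\<close> is mostly decided by the first row of the first matrix.  So the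
  images are computed row by row.  The image of the first matrix depends on \<open>(g3, h3)\<close> only through
  the product \<open>s\<close> of \<open>g3\<close> and the common sign; so \<open>(g3, h3)\<close> is chosen, for fixed \<open>s\<close>, only after the
  first matrix is found to be equal to its image.  The conditionals are
  essential: the simplifier evaluates a branch only when the condition is decided.\<close>

definition all3 :: "(gf3 \<Rightarrow> bool) \<Rightarrow> bool" where
  "all3 p = (if p G0 then if p G1 then p G2 else False else False)"

definition all2 :: "(gf3 \<Rightarrow> bool) \<Rightarrow> bool" where
  "all2 p = (if p G1 then p G2 else False)"

definition all_affine :: "(gf3 \<Rightarrow> gf3 \<Rightarrow> bool) \<Rightarrow> bool" where
  "all_affine p = (if all3 (p G1) then all3 (p G2) else False)"

lemma all3: "all3 p \<longleftrightarrow> (\<forall>x. p x)"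
  by (simp add: all3_def all_gf3)

lemma all2: "all2 p \<longleftrightarrow> (\<forall>x. x \<noteq> 0 \<longrightarrow> p x)"
  by (simp add: all2_def all_gf3 zero_gf3_def)

lemma all_affine: "all_affine p \<longleftrightarrow> (\<forall>g h. g \<noteq> 0 \<longrightarrow> p g h)"
proof -
  have "(\<forall>g. g \<noteq> 0 \<longrightarrow> (\<forall>h. p g h)) \<longleftrightarrow> (\<forall>h. p G1 h) \<and> (\<forall>h. p G2 h)"
    by (subst all_gf3) (simp add: zero_gf3_def)
  then show ?thesis
    unfolding all_affine_def all3 by auto
qed

fun image_row :: "gf3 \<Rightarrow> gf3 \<times> gf3 \<Rightarrow> gf3 tri \<Rightarrow> gf3 tri" where
  "image_row s (g, h) r = Tri (s * nth3 r h) (s * nth3 r (g + h)) (s * nth3 r (h - g))"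

fun image_mat :: "gf3 \<Rightarrow> gf3 \<times> gf3 \<Rightarrow> gf3 \<times> gf3 \<Rightarrow> mat \<Rightarrow> mat" where
  "image_mat s (g, h) b A =
     Tri (image_row s b (nth3 A h)) (image_row s b (nth3 A (g + h))) (image_row s b (nth3 A (h - g)))"

lemma image_mat_eq: "image_mat s a b A = act_mat s a b A"
proof -
  obtain g h g' h' where ab: "a = (g, h)" "b = (g', h')" by (cases a; cases b)
  have eval: "g * G0 + h = h" "g * G1 + h = g + h" "g * G2 + h = h - g" for g h
    by (cases g; cases h; simp add: gf3_eval)+
  show ?thesis
    by (simp add: ab act_mat_def mat_of_def tab_def ent_def eval)
qed

definition less_eq_rest ::
  "mat \<Rightarrow> mat \<Rightarrow> gf3 \<Rightarrow> gf3 \<times> gf3 \<Rightarrow> gf3 \<times> gf3 \<Rightarrow> mat \<Rightarrow> mat \<Rightarrow> gf3 \<Rightarrow> gf3 \<Rightarrow> bool" where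
  "less_eq_rest B C s a b B' C' g3 h3 =
     (if B = image_mat (s * g3 * fst a) b (g3, h3) B' then C \<le> image_mat (s * g3 * fst b) (g3, h3) a C'
      else B < image_mat (s * g3 * fst a) b (g3, h3) B')"

fun below_pair ::
  "mat tri \<Rightarrow> mat tri \<Rightarrow> gf3 \<Rightarrow> gf3 \<Rightarrow> gf3 \<Rightarrow> gf3 \<Rightarrow> gf3 \<Rightarrow> bool" where
  "below_pair (Tri (Tri r0 r1 r2) B C) (Tri A' B' C') s g1 h1 g2 h2 =
     (if r0 = image_row s (g2, h2) (nth3 A' h1) then
        if r1 = image_row s (g2, h2) (nth3 A' (g1 + h1)) then
          if r2 = image_row s (g2, h2) (nth3 A' (h1 - g1)) then
            all_affine (less_eq_rest B C s (g1, h1) (g2, h2) B' C')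
          else r2 < image_row s (g2, h2) (nth3 A' (h1 - g1))
        else r1 < image_row s (g2, h2) (nth3 A' (g1 + h1))
      else r0 < image_row s (g2, h2) (nth3 A' h1))"

definition below_affine :: "mat tri \<Rightarrow> mat tri \<Rightarrow> gf3 \<Rightarrow> gf3 \<Rightarrow> gf3 \<Rightarrow> bool" where
  "below_affine t t' s g1 h1 = all_affine (below_pair t t' s g1 h1)"

definition below_sign :: "mat tri \<Rightarrow> mat tri \<Rightarrow> gf3 \<Rightarrow> bool" where
  "below_sign t t' s = all_affine (below_affine t t' s)"

definition below :: "mat tri \<Rightarrow> mat tri \<Rightarrow> bool" where
  "below t t' = all2 (below_sign t t')"

lemma below_pair:
  "below_pair t t' s g1 h1 g2 h2 \<longleftrightarrow>
     (\<forall>g3 h3. g3 \<noteq> 0 \<longrightarrow> t \<le> act (s * g3, (g1, h1), (g2, h2), (g3, h3)) t')"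
proof -
  obtain r0 r1 r2 B C where t: "t = Tri (Tri r0 r1 r2) B C"
    by (metis tri.exhaust)
  obtain A' B' C' where t': "t' = Tri A' B' C'" by (cases t')
  let ?A = "Tri r0 r1 r2" and ?A' = "image_mat s (g1, h1) (g2, h2) A'"
  have "below_pair t t' s g1 h1 g2 h2 \<longleftrightarrow>
      (if ?A = ?A' then \<forall>g3 h3. g3 \<noteq> 0 \<longrightarrow> less_eq_rest B C s (g1, h1) (g2, h2) B' C' g3 h3
       else ?A < ?A')"
    by (simp add: t t' all_affine del: image_row.simps)
  moreover have "t \<le> act (s * g3, (g1, h1), (g2, h2), (g3, h3)) t' \<longleftrightarrow>
      (if ?A = ?A' then less_eq_rest B C s (g1, h1) (g2, h2) B' C' g3 h3 else ?A < ?A')"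
    if "g3 \<noteq> 0" for g3 h3
    using that square_gf3[of g3]
    by (simp add: t t' less_eq_rest_def image_mat_eq mult.assoc del: less_tri.simps image_mat.simps)
  moreover have "(1::gf3) \<noteq> 0" by simp
  ultimately show ?thesis by metis
qed

lemma below_iff: "below t t' \<longleftrightarrow> (\<forall>q\<in>syms. t \<le> act q t')"
proof -
  have "below t t' \<longleftrightarrow> (\<forall>s g1 h1 g2 h2 g3 h3. s \<noteq> 0 \<longrightarrow> g1 \<noteq> 0 \<longrightarrow> g2 \<noteq> 0 \<longrightarrow> g3 \<noteq> 0 \<longrightarrow>
      t \<le> act (s * g3, (g1, h1), (g2, h2), (g3, h3)) t')"
    unfolding below_def below_sign_def below_affine_def all2 all_affine below_pair by blast
  also have "\<dots> \<longleftrightarrow> (\<forall>q\<in>syms. t \<le> act q t')"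
  proof
    assume l: "\<forall>s g1 h1 g2 h2 g3 h3. s \<noteq> 0 \<longrightarrow> g1 \<noteq> 0 \<longrightarrow> g2 \<noteq> 0 \<longrightarrow> g3 \<noteq> 0 \<longrightarrow>
      t \<le> act (s * g3, (g1, h1), (g2, h2), (g3, h3)) t'"
    show "\<forall>q\<in>syms. t \<le> act q t'"
    proof
      fix q assume "q \<in> syms"
      then obtain z g1 h1 g2 h2 g3 h3 where q: "q = (z, (g1, h1), (g2, h2), (g3, h3))"
        "z \<noteq> 0" "g1 \<noteq> 0" "g2 \<noteq> 0" "g3 \<noteq> 0"
        by (auto simp: syms_def)
      have "z * g3 * g3 = z"
        using q(5) by (simp add: mult.assoc square_gf3)
      then show "t \<le> act q t'"
        using l[rule_format, of "z * g3" g1 g2 g3 h1 h2 h3] q by (simp add: mult_nonzero_gf3)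
    qed
  qed (auto simp: syms_def mult_nonzero_gf3)
  finally show ?thesis .
qed

text \<open>A least triple begins with a matrix that is least among its own images.  There are only
  \<open>7\<close> such matrices, so this test removes most triples.\<close>

fun matrix_below_pair :: "mat \<Rightarrow> gf3 \<Rightarrow> gf3 \<Rightarrow> gf3 \<Rightarrow> gf3 \<Rightarrow> gf3 \<Rightarrow> bool" where
  "matrix_below_pair (Tri r0 r1 r2) s g1 h1 g2 h2 =
     (if r0 = image_row s (g2, h2) (nth3 (Tri r0 r1 r2) h1) then
        if r1 = image_row s (g2, h2) (nth3 (Tri r0 r1 r2) (g1 + h1)) then
          r2 \<le> image_row s (g2, h2) (nth3 (Tri r0 r1 r2) (h1 - g1))
        else r1 < image_row s (g2, h2) (nth3 (Tri r0 r1 r2) (g1 + h1))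
      else r0 < image_row s (g2, h2) (nth3 (Tri r0 r1 r2) h1))"

definition matrix_below_affine :: "mat \<Rightarrow> gf3 \<Rightarrow> gf3 \<Rightarrow> gf3 \<Rightarrow> bool" where
  "matrix_below_affine A s g1 h1 = all_affine (matrix_below_pair A s g1 h1)"

definition matrix_below_sign :: "mat \<Rightarrow> gf3 \<Rightarrow> bool" where
  "matrix_below_sign A s = all_affine (matrix_below_affine A s)"

definition matrix_least :: "mat \<Rightarrow> bool" where
  "matrix_least A = all2 (matrix_below_sign A)"

lemma matrix_least_if_below:
  assumes "below (Tri A B C) (Tri A B' C')"
  shows "matrix_least A"
proof -
  have "matrix_below_pair A s g1 h1 g2 h2"
    if "s \<noteq> 0" "g1 \<noteq> 0" "g2 \<noteq> 0" for s g1 h1 g2 h2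
  proof -
    have "(s, (g1, h1), (g2, h2), (1, 0)) \<in> syms"
      using that by (auto simp: syms_def)
    then have "Tri A B C \<le> act (s, (g1, h1), (g2, h2), (1, 0)) (Tri A B' C')"
      using assms unfolding below_iff by blast
    then have "A \<le> image_mat s (g1, h1) (g2, h2) A"
      by (auto simp: image_mat_eq split: if_splits simp del: image_mat.simps)
    then show ?thesis
      by (cases A) (simp del: image_row.simps)
  qed
  then show ?thesis
    by (simp add: matrix_least_def matrix_below_sign_def matrix_below_affine_def all2 all_affine)
qed

fun below_conjs :: "mat tri \<Rightarrow> bool" where
  "below_conjs t =
     (if below t (rot t) then if below t (rot (rot t)) then if below t (flip t) then
        if below t (flip (rot t)) then below t (flip (rot (rot t)))
        else False else False else False else False)"

lemma below_conjs_iff: "below t t \<and> below_conjs t \<longleftrightarrow> (\<forall>c\<in>conjs. below t (c t))"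
  by (auto simp: conjs_def)


section \<open>The numbers of orbits\<close>

text \<open>The nested sum of lemma \<open>sum_triples\<close>, with one function for each summation, and restricted to
  least matrices \<open>A\<close>.\<close>

fun tally :: "('a \<Rightarrow> int) \<Rightarrow> 'a list \<Rightarrow> int" where
  "tally f [] = 0"
| "tally f (x # xs) = f x + tally f xs"

lemma tally: "distinct xs \<Longrightarrow> tally f xs = (\<Sum>x\<in>set xs. f x)"
  by (induction xs) simp_all

definition total :: "(gf3 \<Rightarrow> int) \<Rightarrow> int" where
  "total f = f G0 + f G1 + f G2"

lemma total: "total f = (\<Sum>x\<in>UNIV. f x)"
  by (simp add: total_def UNIV_gf3)

definition count_C :: "(mat tri \<Rightarrow> int) \<Rightarrow> mat \<Rightarrow> mat \<Rightarrow> mat \<Rightarrow> int" where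
  "count_C f A B C = f (Tri A B C)"

definition count_B :: "(mat tri \<Rightarrow> int) \<Rightarrow> mat \<Rightarrow> gf3 \<Rightarrow> gf3 \<Rightarrow> gf3 \<Rightarrow> gf3 \<Rightarrow> gf3 \<Rightarrow> mat \<Rightarrow> int" where
  "count_B f A x y c z d B = tally (count_C f A B) (mats_with (- y) (- z) (- (c + d)))"

definition count_d :: "(mat tri \<Rightarrow> int) \<Rightarrow> mat \<Rightarrow> gf3 \<Rightarrow> gf3 \<Rightarrow> gf3 \<Rightarrow> gf3 \<Rightarrow> gf3 \<Rightarrow> int" where
  "count_d f A x y c z d = tally (count_B f A x y c z d) (mats_with z (- x) d)"

definition count_z :: "(mat tri \<Rightarrow> int) \<Rightarrow> mat \<Rightarrow> gf3 \<Rightarrow> gf3 \<Rightarrow> gf3 \<Rightarrow> gf3 \<Rightarrow> int" where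
  "count_z f A x y c z = total (count_d f A x y c z)"

definition count_A :: "(mat tri \<Rightarrow> int) \<Rightarrow> gf3 \<Rightarrow> gf3 \<Rightarrow> gf3 \<Rightarrow> mat \<Rightarrow> int" where
  "count_A f x y c A = (if matrix_least A then total (count_z f A x y c) else 0)"

definition count_c :: "(mat tri \<Rightarrow> int) \<Rightarrow> gf3 \<Rightarrow> gf3 \<Rightarrow> gf3 \<Rightarrow> int" where
  "count_c f x y c = tally (count_A f x y c) (mats_with x y c)"

definition count_y :: "(mat tri \<Rightarrow> int) \<Rightarrow> gf3 \<Rightarrow> gf3 \<Rightarrow> int" where
  "count_y f x y = total (count_c f x y)"

definition count_x :: "(mat tri \<Rightarrow> int) \<Rightarrow> gf3 \<Rightarrow> int" where
  "count_x f x = total (count_y f x)"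

lemma total_count_x:
  assumes "\<And>A B C. \<not> matrix_least A \<Longrightarrow> f (Tri A B C) = 0"
  shows "total (count_x f) = (\<Sum>t\<in>triples. f t)"
proof -
  have "count_A f x y c A = (\<Sum>z\<in>UNIV. \<Sum>d\<in>UNIV. \<Sum>B\<in>set (mats_with z (- x) d).
     \<Sum>C\<in>set (mats_with (- y) (- z) (- (c + d))). f (Tri A B C))" for x y c A
    using assms
    by (auto simp: count_A_def count_z_def count_d_def count_B_def count_C_def total
        tally[OF distinct_mats_with])
  then show ?thesis
    by (simp add: sum_triples count_x_def count_y_def count_c_def total
        tally[OF distinct_mats_with])
qed

definition isotopy_leader :: "mat tri \<Rightarrow> int" where
  "isotopy_leader t = (if below t t then 1 else 0)"

definition paratopy_leader :: "mat tri \<Rightarrow> int" where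
  "paratopy_leader t = (if below t t then if below_conjs t then 1 else 0 else 0)"

text \<open>Two evaluations by rewriting.  With the \<open>7\<close> least matrices as \<open>A\<close> there are \<open>2940\<close> triples to
  test.\<close>

lemma number_of_isotopy_leaders: "total (count_x isotopy_leader) = 186"
  by code_simp

lemma number_of_paratopy_leaders: "total (count_x paratopy_leader) = 45"
  by code_simp


section \<open>The numbers of classes\<close>

text \<open>Classes are compared along a relation and not along a function, since a division sudoku has two
  sign triples.\<close>

lemma num_classes_correspondence:
  assumes left: "\<And>a. a \<in> A \<Longrightarrow> \<exists>b\<in>B. r a b" and right: "\<And>b. b \<in> B \<Longrightarrow> \<exists>a\<in>A. r a b"
    and iff: "\<And>a a' b b'. a \<in> A \<Longrightarrow> a' \<in> A \<Longrightarrow> b \<in> B \<Longrightarrow> b' \<in> B \<Longrightarrow> r a b \<Longrightarrow> r a' b' \<Longrightarrow>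
      E a a' \<longleftrightarrow> F b b'"
  shows "num_classes A E = num_classes B F"
proof -
  define forward where "forward C = {b \<in> B. \<exists>a\<in>C. r a b}" for C
  define backward where "backward D = {a \<in> A. \<exists>b\<in>D. r a b}" for D
  have cls: "rel_on A E `` {a} = {a' \<in> A. E a a'}" if "a \<in> A" for a
    using that by (auto simp: rel_on_def)
  have clsF: "rel_on B F `` {b} = {b' \<in> B. F b b'}" if "b \<in> B" for b
    using that by (auto simp: rel_on_def)
  have forward_class: "forward {a' \<in> A. E a a'} = {b' \<in> B. F b b'}" if "a \<in> A" "b \<in> B" "r a b" for a b
    unfolding forward_def using right iff[OF that(1) _ that(2) _ that(3)] by blast
  have backward_class: "backward {b' \<in> B. F b b'} = {a' \<in> A. E a a'}" if "a \<in> A" "b \<in> B" "r a b" for a b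
    unfolding backward_def using left iff[OF that(1) _ that(2) _ that(3)] by blast
  have "bij_betw forward (A // rel_on A E) (B // rel_on B F)"
  proof (rule bij_betw_byWitness[where f' = "backward"])
    show "\<forall>C\<in>A // rel_on A E. backward (forward C) = C"
    proof
      fix C assume "C \<in> A // rel_on A E"
      then obtain a where a: "a \<in> A" "C = {a' \<in> A. E a a'}" using cls by (auto simp: quotient_def)
      then obtain b where b: "b \<in> B" "r a b" using left by blast
      show "backward (forward C) = C"
        by (simp add: a(2) forward_class[OF a(1) b] backward_class[OF a(1) b])
    qed
    show "\<forall>D\<in>B // rel_on B F. forward (backward D) = D"
    proof
      fix D assume "D \<in> B // rel_on B F"
      then obtain b where b: "b \<in> B" "D = {b' \<in> B. F b b'}" using clsF by (auto simp: quotient_def)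
      then obtain a where a: "a \<in> A" "r a b" using right by blast
      show "forward (backward D) = D"
        by (simp add: b(2) forward_class[OF a(1) b(1) a(2)] backward_class[OF a(1) b(1) a(2)])
    qed
    show "forward ` (A // rel_on A E) \<subseteq> B // rel_on B F"
    proof
      fix D assume "D \<in> forward ` (A // rel_on A E)"
      then obtain a where a: "a \<in> A" "D = forward {a' \<in> A. E a a'}" using cls by (auto simp: quotient_def)
      then obtain b where b: "b \<in> B" "r a b" using left by blast
      have "D = rel_on B F `` {b}"
        by (simp add: a(2) forward_class[OF a(1) b] clsF[OF b(1)])
      then show "D \<in> B // rel_on B F" using b(1) by (auto simp: quotient_def)
    qed
    show "backward ` (B // rel_on B F) \<subseteq> A // rel_on A E"
    proof
      fix C assume "C \<in> backward ` (B // rel_on B F)"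
      then obtain b where b: "b \<in> B" "C = backward {b' \<in> B. F b b'}"
        using clsF by (auto simp: quotient_def)
      then obtain a where a: "a \<in> A" "r a b" using right by blast
      have "C = rel_on A E `` {a}"
        by (simp add: b(2) backward_class[OF a(1) b(1) a(2)] cls[OF a(1)])
      then show "C \<in> A // rel_on A E" using a(1) by (auto simp: quotient_def)
    qed
  qed
  then show ?thesis unfolding num_classes_def by (rule bij_betw_same_card)
qed

lemma act_triples:
  assumes "t \<in> triples" "q \<in> syms"
  shows "act q t \<in> triples"
proof -
  obtain A B C where t: "t = Tri A B C" by (cases t)
  obtain z g1 h1 g2 h2 g3 h3 where q: "q = (z, (g1, h1), (g2, h2), (g3, h3))"
    "z \<noteq> 0" "g1 \<noteq> 0" "g2 \<noteq> 0" "g3 \<noteq> 0"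
    using assms(2) by (auto simp: syms_def)
  obtain p q' r where c: "cocycle (ent A) (ent B) (ent C) p q' r"
    and s: "signs A" "signs B" "signs C"
    using assms(1) unfolding t triples_iff by blast
  have e: "ent (act_mat (z * g) (g', h') (g'', h'') M) =
      (\<lambda>i j. z * (g * ent M (g' * i + h') (g'' * j + h'')))" for g g' h' g'' h'' M
    by (simp add: fun_eq_iff mult.assoc)
  have "signs (act_mat (z * g) a b M)" if "signs M" "g \<noteq> 0" for g a b M
    using that q(2) by (simp add: signs_def mult_nonzero_gf3)
  then have "signs (act_mat (z * g3) (g1, h1) (g2, h2) A)"
    "signs (act_mat (z * g1) (g2, h2) (g3, h3) B)" "signs (act_mat (z * g2) (g3, h3) (g1, h1) C)"
    using s q by blast+
  moreover have "\<exists>p q r. cocycle (ent (act_mat (z * g3) (g1, h1) (g2, h2) A))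
      (ent (act_mat (z * g1) (g2, h2) (g3, h3) B)) (ent (act_mat (z * g2) (g3, h3) (g1, h1) C)) p q r"
    unfolding e
    by (intro exI, rule cocycle_scale,
        rule cocycle_pullback[OF c, where a = "\<lambda>_. 0" and b = "\<lambda>_. 0" and c = "\<lambda>_. 0"])
  ultimately show ?thesis
    by (simp add: t q(1) triples_iff)
qed

lemma conjs_triples:
  assumes "t \<in> triples" "c \<in> conjs"
  shows "c t \<in> triples"
proof -
  have "rot t \<in> triples" "flip t \<in> triples" if "t \<in> triples" for t
    using triples_has_signs[OF that] has_signs_rotate has_signs_swap12 has_signs_in_triples by blast+
  then show ?thesis using assms by (auto simp: conjs_def)
qed

lemma num_classes_least:
  assumes "\<And>t. F t t" "\<And>t t'. F t t' \<Longrightarrow> F t' t" "\<And>t t' t''. F t t' \<Longrightarrow> F t' t'' \<Longrightarrow> F t t''"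
  shows "num_classes triples F = card {t \<in> triples. \<forall>t'\<in>triples. F t' t \<longrightarrow> t \<le> t'}"
proof -
  have "equiv triples (rel_on triples F)"
    unfolding equiv_def refl_on_def sym_def trans_def rel_on_def using assms by blast
  then have "num_classes triples F =
      card {t \<in> triples. \<forall>t'. (t, t') \<in> rel_on triples F \<longrightarrow> t \<le> t'}"
    unfolding num_classes_def by (rule card_quotient_least[OF finite_triples])
  also have "{t \<in> triples. \<forall>t'. (t, t') \<in> rel_on triples F \<longrightarrow> t \<le> t'} =
      {t \<in> triples. \<forall>t'\<in>triples. F t' t \<longrightarrow> t \<le> t'}"
    unfolding rel_on_def using assms(2) by blast
  finally show ?thesis .
qed

text \<open>A triple that is least in its orbit is at most its own images, so its first matrix is least.\<close>

lemma card_leaders: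
  assumes "\<And>t. f t = (if Q t then 1 else 0 :: int)" "\<And>t. Q t \<Longrightarrow> below t t"
  shows "int (card {t \<in> triples. Q t}) = total (count_x f)"
proof -
  have "f (Tri A B C) = 0" if "\<not> matrix_least A" for A B C
  proof -
    have "\<not> Q (Tri A B C)"
      using that assms(2)[of "Tri A B C"] matrix_least_if_below[of A B C B C] by blast
    then show ?thesis by (simp add: assms(1))
  qed
  then have "total (count_x f) = (\<Sum>t\<in>triples. f t)" by (rule total_count_x)
  also have "\<dots> = int (card {t \<in> triples. Q t})"
    using finite_triples by (simp add: assms(1) sum.If_cases Int_def)
  finally show ?thesis by simp
qed

lemma num_classes_isotopic: "num_classes triples isotopic = 186"
proof -
  have "(\<forall>t'\<in>triples. isotopic t' t \<longrightarrow> t \<le> t') \<longleftrightarrow> below t t" if "t \<in> triples" for t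
    using act_triples[OF that] by (auto simp: isotopic_def below_iff)
  then have "{t \<in> triples. \<forall>t'\<in>triples. isotopic t' t \<longrightarrow> t \<le> t'} = {t \<in> triples. below t t}"
    by blast
  moreover have "num_classes triples isotopic =
      card {t \<in> triples. \<forall>t'\<in>triples. isotopic t' t \<longrightarrow> t \<le> t'}"
    by (rule num_classes_least[OF isotopic_refl isotopic_sym isotopic_trans])
  moreover have "int (card {t \<in> triples. below t t}) = 186"
    using card_leaders[of isotopy_leader "\<lambda>t. below t t"] number_of_isotopy_leaders
    by (simp add: isotopy_leader_def)
  ultimately show ?thesis by simp
qed

lemma num_classes_paratopic: "num_classes triples paratopic = 45"
proof -
  have "(\<forall>t'\<in>triples. paratopic t' t \<longrightarrow> t \<le> t') \<longleftrightarrow> below t t \<and> below_conjs t"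
    if "t \<in> triples" for t
    unfolding below_conjs_iff
  proof (intro iffI ballI impI)
    fix c assume l: "\<forall>t'\<in>triples. paratopic t' t \<longrightarrow> t \<le> t'" and c: "c \<in> conjs"
    show "below t (c t)"
      unfolding below_iff
    proof
      fix q assume q: "q \<in> syms"
      then have "paratopic (act q (c t)) t" using c unfolding paratopic_def by blast
      then show "t \<le> act q (c t)"
        using l act_triples[OF conjs_triples[OF that c] q] by blast
    qed
  next
    fix t' assume l: "\<forall>c\<in>conjs. below t (c t)" and "paratopic t' t"
    then obtain c q where "c \<in> conjs" "q \<in> syms" "t' = act q (c t)"
      unfolding paratopic_def by (elim bexE)
    then show "t \<le> t'" using l by (simp add: below_iff)
  qed
  then have "{t \<in> triples. \<forall>t'\<in>triples. paratopic t' t \<longrightarrow> t \<le> t'} = {t \<in> triples. below t t \<and> below_conjs t}"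
    by blast
  moreover have "num_classes triples paratopic =
      card {t \<in> triples. \<forall>t'\<in>triples. paratopic t' t \<longrightarrow> t \<le> t'}"
    by (rule num_classes_least[OF paratopic_refl paratopic_sym paratopic_trans])
  moreover have "int (card {t \<in> triples. below t t \<and> below_conjs t}) = 45"
    using card_leaders[of paratopy_leader "\<lambda>t. below t t \<and> below_conjs t"]
      number_of_paratopy_leaders
    by (simp add: paratopy_leader_def)
  ultimately show ?thesis by simp
qed

lemma sudoku_has_signs:
  "L \<in> sudokus \<Longrightarrow> \<exists>t\<in>triples. has_signs (rel_of L) t"
  unfolding mem_sudokus using ds_relation_has_signs has_signs_in_triples by blast

lemma triple_has_sudoku:
  assumes "t \<in> triples"
  shows "\<exists>L\<in>sudokus. has_signs (rel_of L) t"
proof -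
  obtain O' where O': "has_signs O' t" using triples_has_signs[OF assms] by blast
  then have "O' \<in> rel_of ` sudokus"
    using bij_betw_rel_of has_signs_ds_relation by (auto simp: bij_betw_def)
  then show ?thesis using O' by blast
qed

theorem theorem4p7:
  shows "card (standard_division_sudokus 3) = 104015259648 \<and>
         (104015259648 :: nat) = 2 ^ 11 * 3 ^ 8 * 7741 \<and>
         num_classes (standard_division_sudokus 3)
           (ds_isotopic {1..3\<^sup>2} (standard_partition 3)) = 186 \<and>
         num_classes (standard_division_sudokus 3)
           (ds_paratopic {1..3\<^sup>2} (standard_partition 3)) = 45"
proof (intro conjI)
  have cells: "{1..3\<^sup>2} = cells" by (simp add: range_num)
  show "card sudokus = 104015259648"
    using bij_betw_same_card[OF bij_betw_rel_of] card_ds_relations by simp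
  show "(104015259648 :: nat) = 2 ^ 11 * 3 ^ 8 * 7741"
    by simp
  have "num_classes sudokus (ds_isotopic cells (standard_partition 3)) =
      num_classes triples isotopic"
  proof (rule num_classes_correspondence[where r = "\<lambda>L t. has_signs (rel_of L) t"])
    show "ds_isotopic cells (standard_partition 3) L L' \<longleftrightarrow> isotopic t t'"
      if "L \<in> sudokus" "L' \<in> sudokus" "has_signs (rel_of L) t" "has_signs (rel_of L') t'"
      for L L' t t'
      using ds_isotopic_iff[OF that(1,2)] iso_rel_iff[OF that(3,4)] by simp
  qed (fact sudoku_has_signs triple_has_sudoku)+
  then show "num_classes sudokus (ds_isotopic {1..3\<^sup>2} (standard_partition 3)) = 186"
    unfolding cells by (simp add: num_classes_isotopic)
  have "num_classes sudokus (ds_paratopic cells (standard_partition 3)) =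
      num_classes triples paratopic"
  proof (rule num_classes_correspondence[where r = "\<lambda>L t. has_signs (rel_of L) t"])
    show "ds_paratopic cells (standard_partition 3) L L' \<longleftrightarrow> paratopic t t'"
      if "L \<in> sudokus" "L' \<in> sudokus" "has_signs (rel_of L) t" "has_signs (rel_of L') t'"
      for L L' t t'
      by (rule ds_paratopic_iff[OF that])
  qed (fact sudoku_has_signs triple_has_sudoku)+
  then show "num_classes sudokus (ds_paratopic {1..3\<^sup>2} (standard_partition 3)) = 45"
    unfolding cells by (simp add: num_classes_paratopic)
qed

end
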